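(* There is an algorithm that, given a simple directed graph with $n$ vertices and $m$ edges, computes its 2-edge strongly connected components in time $O(m^2/\log n)$.
   Context: Two distinct vertices $u,v$ of a directed graph are 2-edge strongly connected if there are two edge-disjoint paths from $u$ to $v$ and two edge-disjoint paths from $v$ to $u$ (equivalently, they remain strongly connected after removal of any single edge). The 2-edge strongly connected components of $G$ are its maximal induced subgraphs $G[S]$ in which every pair of distinct vertices of $S$ is 2-edge strongly connected in $G[S]$.
   Formalization: The time bound is claimed for n ≥ 2 and n ≤ K·m²/log n, for any constant K (the O-constant may depend on K), since writing the output for n vertices takes about n steps, so the bound fails for example when m = 0; correctness holds for all simple digraphs. *)

theory Defs
  imports Complex_Main "Graph_Theory.Digraph_Component"
begin

section \<open>2-edge strongly connected components\<close>

definition two_edge_disjoint_paths :: "('a, 'b) pre_digraph \<Rightarrow> 'a \<Rightarrow> 'a \<Rightarrow> bool" where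
  "two_edge_disjoint_paths G u v \<longleftrightarrow>
     (\<exists>p q. pre_digraph.apath G u p v \<and> pre_digraph.apath G u q v \<and> set p \<inter> set q = {})"

definition two_edge_strongly_connected :: "('a, 'b) pre_digraph \<Rightarrow> 'a \<Rightarrow> 'a \<Rightarrow> bool" where
  "two_edge_strongly_connected G u v \<longleftrightarrow>
     u \<noteq> v \<and> two_edge_disjoint_paths G u v \<and> two_edge_disjoint_paths G v u"

definition two_edge_sc_set :: "('a, 'b) pre_digraph \<Rightarrow> 'a set \<Rightarrow> bool" where
  "two_edge_sc_set G S \<longleftrightarrow> S \<noteq> {} \<and> S \<subseteq> verts G \<and>
     (\<forall>u\<in>S. \<forall>v\<in>S. u \<noteq> v \<longrightarrow> two_edge_strongly_connected (G \<restriction> S) u v)"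

definition two_edge_sccs :: "('a, 'b) pre_digraph \<Rightarrow> ('a, 'b) pre_digraph set" where
  "two_edge_sccs G =
     {G \<restriction> S | S. two_edge_sc_set G S \<and> (\<forall>T. two_edge_sc_set G T \<and> S \<subseteq> T \<longrightarrow> T = S)}"


section \<open>Word RAM programs\<close>

text \<open>
  The machine model is the word RAM with word length \<open>w\<close>: memory cells hold numbers below
  \<open>2 ^ w\<close>, every operation on words has unit cost, and cells are addressed indirectly. Programs
  are structured (sequencing, conditionals, loops). The memory is divided into segments whose
  names are literals in the program, so that a program uses a fixed finite number of them;
  storing \<open>k\<close> segments interleaved in a single memory changes running times only by a constant
  factor.
\<close>

type_synonym memory = "nat \<Rightarrow> nat \<Rightarrow> nat"  \<comment> \<open>segment, address, contents\<close>

datatype binop = Plus | Minus | Times | Div | Less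

datatype expr = Const nat | Cell nat expr | Op binop expr expr

datatype prog =
    Skip
  | Assign nat expr expr
  | Seq prog prog
  | Cond expr prog prog
  | While expr prog

text \<open>\<open>Minus\<close> is truncated at 0, and division by 0 yields 0.\<close>

fun binop_val :: "nat \<Rightarrow> binop \<Rightarrow> nat \<Rightarrow> nat \<Rightarrow> nat" where
  "binop_val w Plus x y = (x + y) mod 2 ^ w"
| "binop_val w Minus x y = x - y"
| "binop_val w Times x y = (x * y) mod 2 ^ w"
| "binop_val w Div x y = x div y"
| "binop_val w Less x y = (if x < y then 1 else 0) mod 2 ^ w"

fun expr_val :: "nat \<Rightarrow> memory \<Rightarrow> expr \<Rightarrow> nat" where
  "expr_val w M (Const k) = k mod 2 ^ w"
| "expr_val w M (Cell a e) = M a (expr_val w M e)"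
| "expr_val w M (Op f e1 e2) = binop_val w f (expr_val w M e1) (expr_val w M e2)"

fun expr_cost :: "expr \<Rightarrow> nat" where
  "expr_cost (Const k) = 1"
| "expr_cost (Cell a e) = 1 + expr_cost e"
| "expr_cost (Op f e1 e2) = 1 + expr_cost e1 + expr_cost e2"

text \<open>\<open>exec w P M t M'\<close>: started in memory \<open>M\<close>, the program \<open>P\<close> halts after \<open>t\<close> steps in memory
  \<open>M'\<close>. A condition holds if its value is nonzero.\<close>

inductive exec :: "nat \<Rightarrow> prog \<Rightarrow> memory \<Rightarrow> nat \<Rightarrow> memory \<Rightarrow> bool" for w where
  Skip: "exec w Skip M 1 M"
| Assign: "exec w (Assign a e1 e2) M (1 + expr_cost e1 + expr_cost e2)
     (M(a := (M a)(expr_val w M e1 := expr_val w M e2)))"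
| Seq: "exec w P M t M' \<Longrightarrow> exec w Q M' t' M'' \<Longrightarrow> exec w (Seq P Q) M (t + t') M''"
| CondTrue: "expr_val w M e \<noteq> 0 \<Longrightarrow> exec w P M t M' \<Longrightarrow>
     exec w (Cond e P Q) M (1 + expr_cost e + t) M'"
| CondFalse: "expr_val w M e = 0 \<Longrightarrow> exec w Q M t M' \<Longrightarrow>
     exec w (Cond e P Q) M (1 + expr_cost e + t) M'"
| WhileFalse: "expr_val w M e = 0 \<Longrightarrow> exec w (While e P) M (1 + expr_cost e) M"
| WhileTrue: "expr_val w M e \<noteq> 0 \<Longrightarrow> exec w P M t M' \<Longrightarrow> exec w (While e P) M' t' M'' \<Longrightarrow>
     exec w (While e P) M (1 + expr_cost e + t + t') M''"

lemma exec_deterministic: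
  "exec w P M t M' \<Longrightarrow> exec w P M s M'' \<Longrightarrow> s = t \<and> M'' = M'"
proof (induction arbitrary: s M'' rule: exec.induct)
  case (Skip M)
  from Skip.prems show ?case by cases simp
next
  case (Assign a e1 e2 M)
  from Assign.prems show ?case by cases simp
next
  case (Seq P M t M' Q t' N)
  from Seq.prems show ?case by cases (use Seq.IH in blast)
next
  case (CondTrue M e P t M' Q)
  from CondTrue.prems show ?case
    by cases (use CondTrue.hyps(1) CondTrue.IH in simp_all)
next
  case (CondFalse M e Q t M' P)
  from CondFalse.prems show ?case
    by cases (use CondFalse.hyps(1) CondFalse.IH in simp_all)
next
  case (WhileFalse M e P)
  from WhileFalse.prems show ?case by cases (use WhileFalse.hyps in simp_all)
next
  case (WhileTrue M e P t M' t' N)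
  from WhileTrue.prems show ?case
  proof cases
    case WhileFalse
    with WhileTrue.hyps(1) show ?thesis by simp
  next
    case (WhileTrue t1 M1 t2)
    with WhileTrue.IH show ?thesis by blast
  qed
qed


section \<open>Input and output\<close>

text \<open>The graph with vertices \<open>0, \<dots>, n - 1\<close> and the edges listed in \<open>es\<close> (in any order).\<close>

definition graph_of :: "nat \<Rightarrow> (nat \<times> nat) list \<Rightarrow> (nat, nat \<times> nat) pre_digraph" where
  "graph_of n es = \<lparr>verts = {..<n}, arcs = set es, tail = fst, head = snd\<rparr>"

text \<open>Segment 0 holds \<open>n\<close> and \<open>m\<close>, segments 1 and 2 the tails and heads of the \<open>m\<close> edges. All
  other cells are 0.\<close>

definition input_memory :: "nat \<Rightarrow> (nat \<times> nat) list \<Rightarrow> memory" where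
  "input_memory n es = (\<lambda>a i.
     if a = 0 \<and> i = 0 then n
     else if a = 0 \<and> i = 1 then length es
     else if a = 1 \<and> i < length es then fst (es ! i)
     else if a = 2 \<and> i < length es then snd (es ! i)
     else 0)"

text \<open>A labelling of the vertices represents the subgraphs induced by its classes of equally
  labelled vertices. The output is the labelling in segment 3.\<close>

definition labelled_subgraphs :: "('a, 'b) pre_digraph \<Rightarrow> ('a \<Rightarrow> nat) \<Rightarrow> ('a, 'b) pre_digraph set" where
  "labelled_subgraphs G l = {G \<restriction> {v \<in> verts G. l v = l u} | u. u \<in> verts G}"

definition output_labels :: "memory \<Rightarrow> nat \<Rightarrow> nat" where
  "output_labels M = M 3"


section \<open>Correctness and running time\<close>

text \<open>The same program works for every word length \<open>w \<ge> c \<cdot> log (n + 2)\<close>.\<close>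

definition computes_two_edge_sccs :: "prog \<Rightarrow> nat \<Rightarrow> bool" where
  "computes_two_edge_sccs P c \<longleftrightarrow>
     (\<forall>n es w. digraph (graph_of n es) \<and> distinct es \<and> (n + 2) ^ c \<le> 2 ^ w \<longrightarrow>
        (\<exists>t M. exec w P (input_memory n es) t M \<and>
           labelled_subgraphs (graph_of n es) (output_labels M) = two_edge_sccs (graph_of n es)))"

text \<open>
  The output has \<open>n\<close> entries, so a running time \<open>O(f n m)\<close> is possible only where \<open>n = O(f n m)\<close>,
  and it is claimed for all inputs in every such range. For \<open>f n m = m\<^sup>2 / log n\<close> this leaves out
  only graphs consisting almost entirely of isolated vertices; \<open>m \<ge> n \<ge> 2\<close> is covered by \<open>K = 1\<close>.
\<close>

definition runs_in_time :: "prog \<Rightarrow> nat \<Rightarrow> (nat \<Rightarrow> nat \<Rightarrow> real) \<Rightarrow> bool" where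
  "runs_in_time P c f \<longleftrightarrow>
     (\<forall>K. \<exists>C. \<forall>n es w t M. digraph (graph_of n es) \<and> distinct es \<and> (n + 2) ^ c \<le> 2 ^ w \<and>
        n \<ge> 2 \<and> real n \<le> K * f n (length es) \<and> exec w P (input_memory n es) t M \<longrightarrow>
        real t \<le> C * f n (length es))"

end

(* A set that is left, or entered, by at most one edge cannot be separated within a 2-edge strongly
   connected subgraph, so all edges crossing it may be deleted. When no such set is left in a weak
   component, the component is 2-edge strongly connected by Menger's theorem. It remains to find
   these cuts quickly.

   Weigh a vertex by its degree. To find a cut around v, grow a search tree from v until its weight
   exceeds a limit, choose few tree vertices z that hit every heavy subtree part, and search from v
   in the residual graph of the tree path to z; if this residual search stops within the limit, the
   reached set is left by at most one edge. Every deletion makes the end points of the deleted edge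
   candidates for new cuts of weight at most D = q^3, where q is about m^(1/4), and a worklist of
   candidates is processed by local searches with limit 2 D. Once the worklist is empty, both sides
   of every remaining cut weigh more than D, so that searches through whole components succeed at
   most O((m / D)^2) times and need to try only O(q) vertices z each. The total time is
   O(n + m q^3) = O(n + m^(7/4)). *)

theory Submission
  imports Defs "HOL-Library.Transitive_Closure_Table"
begin

section \<open>The case of two edge-disjoint paths, proved by one flow augmentation\<close>

section \<open>Menger's theorem for two paths\<close>

text \<open>One search from v has to detect every light set S around v that is left by at most one
  edge. If the tree vertex z lies outside S, the residual search cannot leave S
  (\<open>one_out_resid_closed\<close>), so it stops within the limit; and any set at which it stops
  is a cut itself (\<open>resid_closed_one_out\<close>). So one test costs no more than the limit,
  and it remains to choose some z outside S without knowing S. Tree weight is carried towards the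
  root and a vertex is tested once it has collected a fraction 1 / K of the total: at most K + 1
  tests, enough if that fraction lies outside S. Locally K = 2 works, as the tree weighs more than 2
  D and S at most D, or S is the lighter side of the whole component. Globally K = 2 q works, as the
  far side weighs more than D and the tree at most 2 m <= 2 q D. The choice D = q^3, m about q^4
  balances O(m) local searches of cost O(D) with O((m / D)^2) successful global ones of cost O(m q):
  both give q^7. Finally, n <= K m^2 / log n, with the K of \<open>runs_in_time\<close>, makes log n
  of order O(q), which turns m q^3 into O(m^2 / log n).\<close>

definition one_out :: "('a \<times> 'a) set \<Rightarrow> 'a set \<Rightarrow> bool" where
  "one_out E S \<longleftrightarrow> (\<forall>a b c d. (a, b) \<in> E \<and> (c, d) \<in> E \<and> a \<in> S \<and> b \<notin> S \<and> c \<in> S \<and> d \<notin> S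
     \<longrightarrow> a = c \<and> b = d)"

definition crossing :: "'a set \<Rightarrow> ('a \<times> 'a) set" where
  "crossing S = {(a, b). (a \<in> S) \<noteq> (b \<in> S)}"

definition arc_bal :: "'a \<times> 'a \<Rightarrow> 'a \<Rightarrow> int" where
  "arc_bal e x = of_bool (fst e = x) - of_bool (snd e = x)"

definition bal :: "('a \<times> 'a) set \<Rightarrow> 'a \<Rightarrow> int" where
  "bal F x = (\<Sum>e\<in>F. arc_bal e x)"

text \<open>A unit-capacity integral flow of value \<open>k\<close>, represented by the set of edges
  that carry it. The difference of indicators vanishes for \<open>u = v\<close>, which the empty
  path in \<open>bal_apath\<close> needs.\<close>

definition flow :: "('a \<times> 'a) set \<Rightarrow> int \<Rightarrow> 'a \<Rightarrow> 'a \<Rightarrow> bool" where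
  "flow F k u v \<longleftrightarrow> (\<forall>x. bal F x = k * (of_bool (x = u) - of_bool (x = v)))"

text \<open>Arcs are the pairs themselves, so induced subgraphs of \<open>graph_of\<close> take
  exactly this form (\<open>graph_of_induce\<close>) and path lemmas can vary the edge set
  alone.\<close>

definition pg :: "'a set \<Rightarrow> ('a \<times> 'a) set \<Rightarrow> ('a, 'a \<times> 'a) pre_digraph" where
  "pg C F = \<lparr>verts = C, arcs = F, tail = fst, head = snd\<rparr>"

lemma sum_bal:
  assumes "finite F" "finite R"
  shows "(\<Sum>x\<in>R. bal F x) = (\<Sum>e\<in>F. of_bool (fst e \<in> R) - of_bool (snd e \<in> R))"
proof -
  have "(\<Sum>x\<in>R. bal F x) = (\<Sum>e\<in>F. \<Sum>x\<in>R. arc_bal e x)"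
    unfolding bal_def by (rule sum.swap)
  also have "\<dots> = (\<Sum>e\<in>F. of_bool (fst e \<in> R) - of_bool (snd e \<in> R))"
    by (intro sum.cong refl)
       (simp add: arc_bal_def sum_subtractf of_bool_def assms(2))
  finally show ?thesis .
qed

lemma sum_flow:
  assumes "flow F k u v" "finite R" "u \<in> R" "v \<notin> R"
  shows "(\<Sum>x\<in>R. bal F x) = k"
proof -
  have "(\<Sum>x\<in>R. bal F x) = (\<Sum>x\<in>R. k * of_bool (x = u))"
    using assms by (intro sum.cong) (auto simp: flow_def)
  also have "\<dots> = k * (\<Sum>x\<in>R. of_bool (x = u))"
    by (simp add: sum_distrib_left)
  also have "(\<Sum>x\<in>R. of_bool (x = u)) = (1::int)"
    using assms by (simp add: of_bool_def)
  finally show ?thesis by simp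
qed

lemma apath_pg_mono:
  assumes "pre_digraph.apath (pg C F) u p v" "set p \<subseteq> F'"
  shows "pre_digraph.apath (pg C F') u p v"
proof -
  have "pre_digraph.cas (pg C F) a p b = pre_digraph.cas (pg C F') a p b" for a b
    by (induction p arbitrary: a) (auto simp: pre_digraph.cas.simps pg_def)
  moreover have "pre_digraph.awalk_verts (pg C F) a p = pre_digraph.awalk_verts (pg C F') a p" for a
    by (induction p arbitrary: a) (auto simp: pre_digraph.awalk_verts.simps pg_def)
  ultimately show ?thesis
    using assms by (auto simp: pre_digraph.apath_def pre_digraph.awalk_def pg_def)
qed

lemma pg_reach_apath:
  assumes "F \<subseteq> C \<times> C" "u \<in> C" "(u, v) \<in> F\<^sup>*"
  shows "\<exists>p. pre_digraph.apath (pg C F) u p v"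
proof -
  interpret wf_digraph "pg C F"
    using assms(1) by unfold_locales (auto simp: pg_def)
  have "\<exists>p. awalk u p v"
    using assms(3)
  proof (induction rule: rtrancl_induct)
    case base
    have "awalk u [] u" using assms(2) by (simp add: awalk_Nil_iff) (simp add: pg_def)
    then show ?case ..
  next
    case (step y z)
    then obtain p where "awalk u p y" by blast
    moreover have "awalk y [(y, z)] z"
      using step assms(1) by (simp add: awalk_Cons_iff awalk_Nil_iff) (auto simp: pg_def)
    ultimately show ?case by (metis awalk_appendI)
  qed
  then show ?thesis using apath_awalk_to_apath by blast
qed

lemma tail_in_awalk_verts:
  "e \<in> set p \<Longrightarrow> fst e \<in> set (pre_digraph.awalk_verts (pg C F) a p)"
  by (induction p arbitrary: a) (auto simp: pre_digraph.awalk_verts.simps pg_def)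

text \<open>\<open>set p\<close> counts a repeated edge only once; the contributions telescope
  because the vertices of the path, and hence its edges, are distinct.\<close>

lemma bal_apath:
  assumes "pre_digraph.apath (pg C F) u p v"
  shows "flow (set p) 1 u v"
proof -
  have "pre_digraph.cas (pg C F) u p v" "distinct (pre_digraph.awalk_verts (pg C F) u p)"
    using assms by (auto simp: pre_digraph.apath_def pre_digraph.awalk_def)
  then show ?thesis
  proof (induction p arbitrary: u)
    case Nil
    then show ?case by (auto simp: pre_digraph.cas.simps flow_def bal_def)
  next
    case (Cons e p)
    have t: "tail (pg C F) = fst" "head (pg C F) = snd" by (simp_all add: pg_def)
    have e: "fst e = u" "pre_digraph.cas (pg C F) (snd e) p v"
      and nin: "u \<notin> set (pre_digraph.awalk_verts (pg C F) (snd e) p)"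
      and d: "distinct (pre_digraph.awalk_verts (pg C F) (snd e) p)"
      using Cons.prems by (auto simp: pre_digraph.cas.simps pre_digraph.awalk_verts.simps t)
    have "e \<notin> set p" using nin e(1) tail_in_awalk_verts[of e p C F "snd e"] by auto
    then have "bal (set (e # p)) x = arc_bal e x + bal (set p) x" for x
      by (simp add: bal_def)
    moreover have "bal (set p) x = of_bool (x = snd e) - of_bool (x = v)" for x
      using Cons.IH[OF e(2) d] by (simp add: flow_def)
    ultimately show ?case by (auto simp: flow_def arc_bal_def e(1) of_bool_def)
  qed
qed

text \<open>Were \<open>v\<close> unreachable, no edge of \<open>F\<close> would leave the set
  reached from \<open>u\<close>, so its net outflow could not be the positive value
  \<open>k\<close>. Removing a path from \<open>u\<close> to \<open>v\<close> lowers the value by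
  one.\<close>

lemma flow_path:
  assumes "F \<subseteq> C \<times> C" "finite C" "u \<in> C" "flow F k u v" "k > 0"
  shows "\<exists>p. pre_digraph.apath (pg C F) u p v \<and> set p \<subseteq> F \<and> flow (F - set p) (k - 1) u v"
proof -
  have fF: "finite F" using assms(1,2) by (meson finite_SigmaI finite_subset)
  have "(u, v) \<in> F\<^sup>*"
  proof (rule ccontr)
    assume nv: "(u, v) \<notin> F\<^sup>*"
    define R where "R = {x. (u, x) \<in> F\<^sup>*}"
    have "R \<subseteq> C"
    proof
      fix x assume "x \<in> R"
      then have "(u, x) \<in> F\<^sup>*" by (simp add: R_def)
      then show "x \<in> C" using assms(1,3) by (induction) auto
    qed
    then have fR: "finite R" using assms(2) by (rule finite_subset)
    have "k = (\<Sum>e\<in>F. of_bool (fst e \<in> R) - of_bool (snd e \<in> R))"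
      using sum_flow[OF assms(4) fR] sum_bal[OF fF fR] nv by (auto simp: R_def)
    also have "\<dots> \<le> 0"
      by (rule sum_nonpos) (auto simp: R_def dest: rtrancl_into_rtrancl)
    finally show False using assms(5) by simp
  qed
  from pg_reach_apath[OF assms(1,3) this] obtain p where p: "pre_digraph.apath (pg C F) u p v" ..
  then have sub: "set p \<subseteq> F" by (auto simp: pre_digraph.apath_def pre_digraph.awalk_def pg_def)
  have "bal (F - set p) x = bal F x - bal (set p) x" for x
    unfolding bal_def using sub fF by (simp add: sum_diff)
  then have "flow (F - set p) (k - 1) u v"
    using bal_apath[OF p] assms(4) unfolding flow_def by (metis left_diff_distrib)
  then show ?thesis using p sub by blast
qed

definition resflow :: "('a \<times> 'a) set \<Rightarrow> ('a \<times> 'a) set \<Rightarrow> 'a \<Rightarrow> 'a \<Rightarrow> bool" where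
  "resflow E F a b \<longleftrightarrow> (a, b) \<in> E - F \<or> (b, a) \<in> F"

text \<open>The unit is pushed along one arc at a time. This changes the residual relation only
  between the ends of that arc, and the rest of a path with distinct vertices avoids the vertex just
  left.\<close>

lemma augment:
  assumes "rtrancl_path (resflow E F) x ys y" "distinct (x # ys)" "F \<subseteq> E" "finite F"
  shows "\<exists>F'\<subseteq>E. \<forall>z. bal F' z = bal F z + (of_bool (z = x) - of_bool (z = y))"
  using assms
proof (induction ys arbitrary: x F)
  case Nil
  then have "x = y" by (auto elim: rtrancl_path.cases)
  with Nil show ?case by auto
next
  case (Cons x1 ys)
  from Cons.prems(1) have r: "resflow E F x x1" and p: "rtrancl_path (resflow E F) x1 ys y"
    by (auto elim: rtrancl_path.cases)
  define F1 where "F1 = (if (x, x1) \<in> E - F then insert (x, x1) F else F - {(x1, x)})"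
  have sub: "F1 \<subseteq> E" "finite F1"
    using Cons.prems(3,4) by (auto simp: F1_def)
  have b: "bal F1 z = bal F z + (of_bool (z = x) - of_bool (z = x1))" for z
    using r Cons.prems(3,4)
    by (auto simp: F1_def bal_def arc_bal_def resflow_def sum_diff1)
  have mono: "resflow E F1 a b" if "resflow E F a b" "a \<noteq> x" "b \<noteq> x" for a b
    using that by (auto simp: resflow_def F1_def)
  have "rtrancl_path (resflow E F1) x1 ys y"
    if "\<And>a b. resflow E F a b \<Longrightarrow> a \<noteq> x \<Longrightarrow> b \<noteq> x \<Longrightarrow> resflow E F1 a b"
    using p Cons.prems(2)
  proof (induction rule: rtrancl_path.induct)
    case base
    then show ?case by (simp add: rtrancl_path.base)
  next
    case (step x1 x2 ys y)
    then show ?case using that by (auto intro: rtrancl_path.step)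
  qed
  note this[OF mono]
  moreover have "distinct (x1 # ys)" using Cons.prems(2) by simp
  ultimately obtain F' where "F' \<subseteq> E" "\<forall>z. bal F' z = bal F1 z + (of_bool (z = x1) - of_bool (z = y))"
    using Cons.IH sub by blast
  then show ?case using b by (intro exI[of _ F']) (auto)
qed

text \<open>One path gives a flow of value 1. If it cannot be augmented, every edge leaving the
  residually reached set \<open>R\<close> carries flow and no flow edge enters \<open>R\<close>, so
  the value 1 leaves room for a single edge and \<open>R\<close> contradicts \<open>cut\<close>.
  Otherwise the flow of value 2 splits into two paths.\<close>

lemma menger_two:
  assumes E: "E \<subseteq> C \<times> C" "finite C" and uv: "u \<in> C" "v \<in> C" "u \<noteq> v"
    and cut: "\<And>S. S \<subseteq> C \<Longrightarrow> u \<in> S \<Longrightarrow> v \<notin> S \<Longrightarrow> \<not> one_out E S"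
  shows "\<exists>p q. pre_digraph.apath (pg C E) u p v \<and> pre_digraph.apath (pg C E) u q v
    \<and> set p \<inter> set q = {}"
proof -
  have fE: "finite E" using E by (meson finite_SigmaI finite_subset)
  have "(u, v) \<in> E\<^sup>*"
  proof (rule ccontr)
    assume nv: "(u, v) \<notin> E\<^sup>*"
    have "x \<in> C" if "(u, x) \<in> E\<^sup>*" for x using that E(1) uv(1) by induction auto
    then have "{x. (u, x) \<in> E\<^sup>*} \<subseteq> C" by auto
    then show False using cut[of "{x. (u, x) \<in> E\<^sup>*}"] nv
      by (auto simp: one_out_def dest: rtrancl_into_rtrancl)
  qed
  from pg_reach_apath[OF E(1) uv(1) this] obtain p where p: "pre_digraph.apath (pg C E) u p v" ..
  define F where "F = set p"
  have F: "F \<subseteq> E" "finite F"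
    using p by (auto simp: F_def pre_digraph.apath_def pre_digraph.awalk_def pg_def)
  have fl: "flow F 1 u v" unfolding F_def by (rule bal_apath[OF p])
  have "(resflow E F)\<^sup>*\<^sup>* u v"
  proof (rule ccontr)
    assume nv: "\<not> (resflow E F)\<^sup>*\<^sup>* u v"
    define R where "R = {x. (resflow E F)\<^sup>*\<^sup>* u x}"
    have "x \<in> C" if "(resflow E F)\<^sup>*\<^sup>* u x" for x
      using that E(1) F(1) uv(1) by induction (auto simp: resflow_def)
    then have "R \<subseteq> C" by (auto simp: R_def)
    have cl: "b \<in> R" if "resflow E F a b" "a \<in> R" for a b
      using that by (auto simp: R_def intro: rtranclp.rtrancl_into_rtrancl)
    have fR: "finite R" using \<open>R \<subseteq> C\<close> E(2) by (rule finite_subset)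
    have R: "u \<in> R" "v \<notin> R" using nv by (auto simp: R_def)
    have "1 = (\<Sum>e\<in>F. of_bool (fst e \<in> R) - of_bool (snd e \<in> R) :: int)"
      using sum_flow[OF fl fR R] sum_bal[OF F(2) fR] by simp
    also have "\<dots> = (\<Sum>e\<in>F. of_bool (fst e \<in> R \<and> snd e \<notin> R))"
    proof (intro sum.cong refl)
      fix e assume "e \<in> F"
      then show "of_bool (fst e \<in> R) - of_bool (snd e \<in> R) = (of_bool (fst e \<in> R \<and> snd e \<notin> R) :: int)"
        using cl[of "snd e" "fst e"] by (auto simp: resflow_def)
    qed
    also have "\<dots> = int (card {e \<in> F. fst e \<in> R \<and> snd e \<notin> R})"
      using F(2) by (simp add: of_bool_def sum.If_cases Int_def)
    finally have "card {e \<in> F. fst e \<in> R \<and> snd e \<notin> R} = 1" by simp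
    then obtain e0 where "{e \<in> F. fst e \<in> R \<and> snd e \<notin> R} = {e0}" by (meson card_1_singletonE)
    then have e0: "e = e0" if "e \<in> F" "fst e \<in> R" "snd e \<notin> R" for e using that by blast
    have "one_out E R"
      unfolding one_out_def
    proof (intro allI impI)
      fix a b c d assume a: "(a, b) \<in> E \<and> (c, d) \<in> E \<and> a \<in> R \<and> b \<notin> R \<and> c \<in> R \<and> d \<notin> R"
      then have "(a, b) \<in> F" "(c, d) \<in> F" using cl[of a b] cl[of c d] by (auto simp: resflow_def)
      then have "(a, b) = e0" "(c, d) = e0" using a e0[of "(a, b)"] e0[of "(c, d)"] by simp_all
      then show "a = c \<and> b = d" by auto
    qed
    then show False using cut \<open>R \<subseteq> C\<close> R by blast
  qed
  then obtain ys where "rtrancl_path (resflow E F) u ys v"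
    by (auto simp: rtranclp_eq_rtrancl_path)
  then obtain ys' where "rtrancl_path (resflow E F) u ys' v" "distinct (u # ys')"
    by (rule rtrancl_path_distinct)
  from augment[OF this F] obtain F' where F': "F' \<subseteq> E"
    "\<forall>z. bal F' z = bal F z + (of_bool (z = u) - of_bool (z = v))" by blast
  have "flow F' 2 u v" using F'(2) fl by (auto simp: flow_def)
  have "F' \<subseteq> C \<times> C" using F' E by blast
  from flow_path[OF this E(2) uv(1) \<open>flow F' 2 u v\<close>] obtain p1
    where p1: "pre_digraph.apath (pg C F') u p1 v" "set p1 \<subseteq> F'" "flow (F' - set p1) 1 u v" by auto
  have "F' - set p1 \<subseteq> C \<times> C" using \<open>F' \<subseteq> C \<times> C\<close> by blast
  from flow_path[OF this E(2) uv(1) p1(3)] obtain p2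
    where p2: "pre_digraph.apath (pg C (F' - set p1)) u p2 v" "set p2 \<subseteq> F' - set p1" by auto
  have "pre_digraph.apath (pg C E) u p1 v" "pre_digraph.apath (pg C E) u p2 v"
    using apath_pg_mono[OF p1(1)] apath_pg_mono[OF p2(1)] p1(2) p2(2) F'(1) by blast+
  then show ?thesis using p2(2) by blast
qed

section \<open>Cuts do not separate 2-edge strongly connected sets\<close>

section \<open>Cuts and components\<close>

lemma graph_of_induce:
  "graph_of n es \<restriction> C = pg C (set es \<inter> C \<times> C)"
  by (auto simp: graph_of_def pg_def induce_subgraph_def)

text \<open>Sets entered by at most one edge become sets left by at most one edge in direction 1, so
  only outgoing cuts have to be treated.\<close>

definition dir_rel :: "nat \<Rightarrow> ('a \<times> 'a) set \<Rightarrow> ('a \<times> 'a) set" where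
  "dir_rel d E = (if d = 0 then E else E\<inverse>)"

definition weak_comp :: "('a \<times> 'a) set \<Rightarrow> 'a \<Rightarrow> 'a set" where
  "weak_comp E v = {x. (v, x) \<in> (E \<union> E\<inverse>)\<^sup>*}"

lemma apath_leaves:
  assumes "pre_digraph.apath (pg C F) u p v" "u \<in> S" "v \<notin> S"
  shows "\<exists>e\<in>set p. e \<in> F \<and> fst e \<in> S \<and> snd e \<notin> S"
proof -
  have "pre_digraph.cas (pg C F) u p v" "set p \<subseteq> F"
    using assms by (auto simp: pre_digraph.apath_def pre_digraph.awalk_def pg_def)
  then show ?thesis using assms(2)
  proof (induction p arbitrary: u)
    case Nil
    then show ?case using assms(3) by (simp add: pre_digraph.cas.simps)
  next
    case (Cons e p)
    then have "fst e = u" "pre_digraph.cas (pg C F) (snd e) p v"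
      by (auto simp: pre_digraph.cas.simps pg_def)
    then show ?case using Cons.IH[of "snd e"] Cons.prems by (cases "snd e \<in> S") auto
  qed
qed

lemma two_edge_disjoint_paths_leave:
  assumes "two_edge_disjoint_paths (pg T F) u v" "u \<in> S" "v \<notin> S"
  shows "\<not> one_out F S"
proof
  assume o: "one_out F S"
  obtain p q where pq: "pre_digraph.apath (pg T F) u p v" "pre_digraph.apath (pg T F) u q v"
    "set p \<inter> set q = {}"
    using assms(1) by (auto simp: two_edge_disjoint_paths_def)
  from apath_leaves[OF pq(1) assms(2,3)] obtain e where e: "e \<in> set p" "e \<in> F" "fst e \<in> S" "snd e \<notin> S"
    by blast
  from apath_leaves[OF pq(2) assms(2,3)] obtain f where f: "f \<in> set q" "f \<in> F" "fst f \<in> S" "snd f \<notin> S"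
    by blast
  have "e = f" using o e f unfolding one_out_def by (metis prod.collapse)
  then show False using e f pq(3) by auto
qed

lemma one_out_converse: "one_out (E\<inverse>) S \<longleftrightarrow> one_out E (- S)"
  by (auto simp: one_out_def)

lemma one_out_mono: "one_out E S \<Longrightarrow> F \<subseteq> E \<Longrightarrow> one_out F S"
  unfolding one_out_def by blast

text \<open>Two disjoint paths cannot share the only edge that leaves \<open>S\<close>, or, in the
  other direction, the only one that enters it. Hence each \<open>T\<close> lies on one side of
  \<open>S\<close>, and deleting the edges across \<open>S\<close> preserves the assumption on
  \<open>E\<close> (\<open>invar_delete\<close>).\<close>

lemma two_edge_sc_set_one_side:
  assumes T: "two_edge_sc_set (graph_of n es) T"
    and E: "set es \<inter> T \<times> T \<subseteq> E" and S: "one_out (dir_rel d E) S" "T \<inter> S \<noteq> {}"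
  shows "T \<subseteq> S"
proof
  fix v assume v: "v \<in> T"
  show "v \<in> S"
  proof (rule ccontr)
    assume nv: "v \<notin> S"
    obtain u where u: "u \<in> T" "u \<in> S" using S(2) by blast
    have tp: "two_edge_disjoint_paths (pg T (set es \<inter> T \<times> T)) u v"
      "two_edge_disjoint_paths (pg T (set es \<inter> T \<times> T)) v u"
    proof -
      have "u \<noteq> v" using u nv by blast
      then have "two_edge_strongly_connected (graph_of n es \<restriction> T) u v"
        using T u(1) v unfolding two_edge_sc_set_def by blast
      then show "two_edge_disjoint_paths (pg T (set es \<inter> T \<times> T)) u v"
        "two_edge_disjoint_paths (pg T (set es \<inter> T \<times> T)) v u"
        unfolding two_edge_strongly_connected_def graph_of_induce by auto
    qed
    show False
    proof (cases "d = 0")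
      case True
      then have "one_out E S" using S(1) by (simp add: dir_rel_def)
      then have "one_out (set es \<inter> T \<times> T) S" using E by (rule one_out_mono)
      then show False using two_edge_disjoint_paths_leave[OF tp(1) u(2) nv] by simp
    next
      case False
      then have "one_out E (- S)" using S(1) by (simp add: dir_rel_def one_out_converse)
      then have "one_out (set es \<inter> T \<times> T) (- S)" using E by (rule one_out_mono)
      then show False using two_edge_disjoint_paths_leave[OF tp(2), of "- S"] u nv by simp
    qed
  qed
qed

text \<open>Edges deleted inside \<open>C\<close> return in the induced subgraph, which only helps:
  by \<open>clo\<close>, every edge of \<open>E\<close> that starts in \<open>C\<close> belongs to
  the induced subgraph, so a cut of the latter is a cut of \<open>E\<close>.\<close>

lemma uncut_two_edge_sc_set:
  assumes C: "C \<subseteq> {..<n}" "C \<noteq> {}" and E: "E \<subseteq> set es"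
    and clo: "\<And>a b. (a, b) \<in> E \<Longrightarrow> a \<in> C \<Longrightarrow> b \<in> C"
    and uncut: "\<And>S. S \<subset> C \<Longrightarrow> S \<noteq> {} \<Longrightarrow> \<not> one_out E S"
  shows "two_edge_sc_set (graph_of n es) C"
proof -
  have fC: "finite C" using C(1) finite_subset by blast
  have "two_edge_disjoint_paths (graph_of n es \<restriction> C) u v" if uv: "u \<in> C" "v \<in> C" "u \<noteq> v" for u v
  proof -
    have "\<not> one_out (set es \<inter> C \<times> C) S" if "S \<subseteq> C" "u \<in> S" "v \<notin> S" for S
    proof
      assume "one_out (set es \<inter> C \<times> C) S"
      then have "one_out E S" using clo \<open>S \<subseteq> C\<close> E
        unfolding one_out_def by blast
      moreover have "S \<subset> C" "S \<noteq> {}" using that uv by auto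
      ultimately show False using uncut by blast
    qed
    from menger_two[OF _ fC uv this] show ?thesis
      unfolding two_edge_disjoint_paths_def graph_of_induce by blast
  qed
  then show ?thesis using C by (auto simp: two_edge_sc_set_def two_edge_strongly_connected_def graph_of_def)
qed

text \<open>\<open>max\<close> is stronger than maximality: a set that merely meets a class lies
  inside it. So a maximal set is contained in the class of any of its vertices, and equals
  it.\<close>

lemma labelled_subgraphs_two_edge_sccs:
  assumes cl: "\<And>u. u < n \<Longrightarrow> two_edge_sc_set (graph_of n es) {v \<in> {..<n}. l v = l u}"
    and max: "\<And>T u. two_edge_sc_set (graph_of n es) T \<Longrightarrow> u < n \<Longrightarrow>
      T \<inter> {v \<in> {..<n}. l v = l u} \<noteq> {} \<Longrightarrow> T \<subseteq> {v \<in> {..<n}. l v = l u}"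
  shows "labelled_subgraphs (graph_of n es) l = two_edge_sccs (graph_of n es)"
proof -
  have vg: "verts (graph_of n es) = {..<n}" by (simp add: graph_of_def)
  have "(\<exists>u<n. S = {v \<in> {..<n}. l v = l u}) \<longleftrightarrow>
    two_edge_sc_set (graph_of n es) S \<and> (\<forall>T. two_edge_sc_set (graph_of n es) T \<and> S \<subseteq> T \<longrightarrow> T = S)" for S
  proof
    assume "\<exists>u<n. S = {v \<in> {..<n}. l v = l u}"
    then obtain u where u: "u < n" "S = {v \<in> {..<n}. l v = l u}" by blast
    then have uS: "u \<in> S" by auto
    have "T = S" if "two_edge_sc_set (graph_of n es) T" "S \<subseteq> T" for T
      using max[OF that(1) u(1)] that(2) u uS by blast
    then show "two_edge_sc_set (graph_of n es) S \<and> (\<forall>T. two_edge_sc_set (graph_of n es) T \<and> S \<subseteq> T \<longrightarrow> T = S)"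
      using cl u by blast
  next
    assume a: "two_edge_sc_set (graph_of n es) S \<and> (\<forall>T. two_edge_sc_set (graph_of n es) T \<and> S \<subseteq> T \<longrightarrow> T = S)"
    then obtain u where u: "u \<in> S" "u < n" by (auto simp: two_edge_sc_set_def vg)
    then have "S \<subseteq> {v \<in> {..<n}. l v = l u}" using max[of S u] a by blast
    then show "\<exists>u<n. S = {v \<in> {..<n}. l v = l u}" using a cl[OF u(2)] u(2) by blast
  qed
  then have "{S. \<exists>u<n. S = {v \<in> {..<n}. l v = l u}} = {S. two_edge_sc_set (graph_of n es) S \<and>
    (\<forall>T. two_edge_sc_set (graph_of n es) T \<and> S \<subseteq> T \<longrightarrow> T = S)}" by (rule Collect_cong)
  moreover have "labelled_subgraphs (graph_of n es) l =
    (\<lambda>S. graph_of n es \<restriction> S) ` {S. \<exists>u<n. S = {v \<in> {..<n}. l v = l u}}"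
    unfolding labelled_subgraphs_def vg by auto
  moreover have "two_edge_sccs (graph_of n es) =
    (\<lambda>S. graph_of n es \<restriction> S) ` {S. two_edge_sc_set (graph_of n es) S \<and>
    (\<forall>T. two_edge_sc_set (graph_of n es) T \<and> S \<subseteq> T \<longrightarrow> T = S)}"
    unfolding two_edge_sccs_def by (simp only: setcompr_eq_image)
  ultimately show ?thesis by (simp only:)
qed

section \<open>Sets closed under residual edges versus sets left by one edge\<close>

section \<open>Residual graphs of tree paths\<close>

text \<open>The residual graph of a unit flow along a tree path. The path is given by its vertices
  \<open>P\<close> without the root, \<open>x\<close> standing for the edge from
  \<open>par x\<close> to \<open>x\<close>; these edges are reversed.\<close>

definition resid :: "('a \<times> 'a) set \<Rightarrow> 'a set \<Rightarrow> ('a \<Rightarrow> 'a) \<Rightarrow> ('a \<times> 'a) set" where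
  "resid E P par = {(u, x). (u \<in> P \<and> x = par u) \<or> ((u, x) \<in> E \<and> \<not> (x \<in> P \<and> par x = u))}"

text \<open>Positions follow the order of discovery, so parents precede their children. The root is
  a fixed point of \<open>par\<close>, so \<open>tree_path\<close> may range over all
  iterates.\<close>

definition tree :: "('a \<times> 'a) set \<Rightarrow> (nat \<Rightarrow> 'a) \<Rightarrow> nat \<Rightarrow> ('a \<Rightarrow> 'a) \<Rightarrow> bool" where
  "tree E q k par \<longleftrightarrow> 0 < k \<and> inj_on q {..<k} \<and> par (q 0) = q 0 \<and>
     (\<forall>i. 0 < i \<and> i < k \<longrightarrow> (\<exists>j<i. par (q i) = q j \<and> (q j, q i) \<in> E))"

definition tree_path :: "(nat \<Rightarrow> 'a) \<Rightarrow> ('a \<Rightarrow> 'a) \<Rightarrow> 'a \<Rightarrow> 'a set" where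
  "tree_path q par z = {(par ^^ i) z | i. True} - {q 0}"

text \<open>Each step to the parent lowers the position until 0 is reached, where both
  \<open>par\<close> and the truncated difference stay.\<close>

lemma tree_anc:
  assumes "tree E q k par" "p < k"
  shows "\<exists>p'\<le>p - t. (par ^^ t) (q p) = q p'"
proof (induction t)
  case (Suc t)
  then obtain p' where p': "p' \<le> p - t" "(par ^^ t) (q p) = q p'" by blast
  show ?case
  proof (cases "p' = 0")
    case True
    then show ?thesis using p' assms by (auto simp: tree_def)
  next
    case False
    then obtain j where "j < p'" "par (q p') = q j"
      using assms p'(1) unfolding tree_def by (metis bot_nat_0.not_eq_extremum diff_le_self le_trans not_le)
    then show ?thesis using p' by (auto intro!: exI[of _ j])
  qed
qed auto

text \<open>Positions strictly decrease along \<open>par\<close> except at the root, so only the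
  root can recur.\<close>

lemma tree_acyclic:
  assumes "tree E q k par" "p < k" "(par ^^ i) (q p) = (par ^^ j) (q p)" "i < j"
  shows "(par ^^ i) (q p) = q 0"
proof -
  obtain p1 where p1: "p1 \<le> p - i" "(par ^^ i) (q p) = q p1"
    using tree_anc[OF assms(1,2)] by blast
  have "(par ^^ j) (q p) = (par ^^ (j - i)) ((par ^^ i) (q p))"
    using assms(4) by (metis funpow_add less_imp_le_nat le_add_diff_inverse2 o_apply)
  moreover have "p1 < k" using p1 assms(2) by linarith
  ultimately obtain p2 where p2: "p2 \<le> p1 - (j - i)" "(par ^^ j) (q p) = q p2"
    using tree_anc[OF assms(1), of p1] p1(2) by metis
  have "q p1 = q p2" using assms(3) p1 p2 by simp
  then have "p1 = p2" using assms(1) \<open>p1 < k\<close> p2(1) by (auto simp: tree_def inj_on_def)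
  then have "p1 = 0" using p2(1) assms(4) by linarith
  then show ?thesis using p1 by simp
qed

text \<open>Closedness under reversed path edges makes \<open>R\<close> contain, with a path vertex,
  the whole path from there to the root. An edge leaving \<open>R\<close> must be missing from the
  residual graph, hence be a path edge, and the path crosses the border of \<open>R\<close> at most
  once.\<close>

lemma resid_closed_one_out:
  assumes P: "P = tree_path q par z" and t: "par (q 0) = q 0"
    and R: "q 0 \<in> R" "\<And>u x. u \<in> R \<Longrightarrow> (u, x) \<in> resid E P par \<Longrightarrow> x \<in> R"
  shows "one_out E R"
proof -
  have down: "par y \<in> R" if "y \<in> R" "y = (par ^^ i) z" for y i
    using that R(2)[of y "par y"] R(1) t by (cases "y = q 0") (auto simp: resid_def P tree_path_def)
  have anc: "(par ^^ j) z \<in> R" if "(par ^^ i) z \<in> R" "i \<le> j" for i j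
    using that(2) by (induction rule: dec_induct) (use that(1) down in auto)
  have lv: "\<exists>i. b = (par ^^ i) z \<and> (par ^^ Suc i) z = a" if "(a, b) \<in> E" "a \<in> R" "b \<notin> R" for a b
  proof -
    have "b \<in> P \<and> par b = a" using R(2)[OF that(2), of b] that by (auto simp: resid_def)
    then show ?thesis by (auto simp: P tree_path_def)
  qed
  show ?thesis unfolding one_out_def
  proof (intro allI impI)
    fix a b c d assume a: "(a, b) \<in> E \<and> (c, d) \<in> E \<and> a \<in> R \<and> b \<notin> R \<and> c \<in> R \<and> d \<notin> R"
    obtain i where i: "b = (par ^^ i) z" "(par ^^ Suc i) z = a" using lv a by blast
    obtain j where j: "d = (par ^^ j) z" "(par ^^ Suc j) z = c" using lv a by blast
    have "\<not> i < j" using anc[of "Suc i" j] a i j by (metis Suc_leI)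
    moreover have "\<not> j < i" using anc[of "Suc j" i] a i j by (metis Suc_leI)
    ultimately have "i = j" by simp
    then show "a = c \<and> b = d" using i j by simp
  qed
qed

text \<open>The tree path leads from \<open>q 0\<close> inside \<open>S\<close> to \<open>z\<close>
  outside, so it uses the one edge leaving \<open>S\<close>, which the residual graph reverses.
  Leaving \<open>S\<close> twice would repeat a vertex, so the path never returns to
  \<open>S\<close>, and reversed path edges do not lead out of \<open>S\<close> either.\<close>

lemma one_out_resid_closed:
  assumes t: "tree E q k par" and z: "z \<in> q ` {..<k}" "z \<notin> S"
    and P: "P = tree_path q par z" and S: "one_out E S" "q 0 \<in> S"
    and u: "u \<in> S" "(u, x) \<in> resid E P par"
  shows "x \<in> S"
proof (rule ccontr)
  assume x: "x \<notin> S"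
  obtain p where p: "p < k" "z = q p" using z by auto
  have ev: "(par ^^ (p + i)) z = q 0" for i
    using tree_anc[OF t p(1), of "p + i"] p by auto
  have inP: "(par ^^ i) z \<in> P" if "(par ^^ i) z \<notin> S" for i
    using that S(2) by (auto simp: P tree_path_def)
  have edge: "((par ^^ Suc i) z, (par ^^ i) z) \<in> E" if "(par ^^ i) z \<notin> S" for i
  proof -
    obtain p' where p': "p' \<le> p - i" "(par ^^ i) z = q p'" using tree_anc[OF t p(1)] p(2) by blast
    then have "p' \<noteq> 0" "p' < k" using that S(2) p(1) by (auto intro: gr0I)
    then show ?thesis using t p' unfolding tree_def by auto
  qed
  \<comment> \<open>Counted from \<open>z\<close> towards the root, \<open>i0\<close> is the first
    ancestor in \<open>S\<close>; the edge from it to its child on the path is the one edge leaving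
    \<open>S\<close>.\<close>
  define i0 where "i0 = (LEAST i. (par ^^ i) z \<in> S)"
  have ex: "(par ^^ p) z \<in> S" using ev[of 0] S(2) by simp
  have i0: "(par ^^ i0) z \<in> S" unfolding i0_def by (rule LeastI[of _ p]) (rule ex)
  have lt: "(par ^^ i) z \<notin> S" if "i < i0" for i using that unfolding i0_def by (rule not_less_Least)
  have "i0 \<noteq> 0" using i0 z(2) by (cases i0) auto
  then obtain j0 where j0: "i0 = Suc j0" by (cases i0) auto
  have up: "(par ^^ i) z \<in> S" if "i0 \<le> i" for i
  proof (rule ccontr)
    assume ni: "(par ^^ i) z \<notin> S"
    \<comment> \<open>An ancestor outside \<open>S\<close> beyond \<open>i0\<close> would force a
      second exit from \<open>S\<close>. It would have to be the same edge, so a vertex other than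
      the root would recur.\<close>
    define k0 where "k0 = (LEAST l. (par ^^ (i + l)) z \<in> S)"
    have "(par ^^ (i + p)) z \<in> S" using ev[of i] S(2) by (simp add: add.commute)
    then have k0: "(par ^^ (i + k0)) z \<in> S" unfolding k0_def by (rule LeastI)
    then obtain j1 where j1: "k0 = Suc j1" using ni by (cases k0) auto
    have nj: "(par ^^ (i + j1)) z \<notin> S"
      using not_less_Least[of j1 "\<lambda>l. (par ^^ (i + l)) z \<in> S"] j1 unfolding k0_def by simp
    have "((par ^^ Suc (i + j1)) z, (par ^^ (i + j1)) z) \<in> E" using edge[OF nj] .
    moreover have "((par ^^ Suc j0) z, (par ^^ j0) z) \<in> E" using edge[of j0] lt[of j0] j0 by simp
    ultimately have "(par ^^ j0) z = (par ^^ (i + j1)) z"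
      using S(1) k0 nj i0 lt[of j0] unfolding one_out_def j0 j1 by auto
    then have "(par ^^ j0) z = q 0"
      using tree_acyclic[OF t p(1), of j0 "i + j1"] p(2) that j0 by auto
    then show False using lt[of j0] j0 S(2) by auto
  qed
  from u(2) consider "u \<in> P" "x = par u" | "(u, x) \<in> E" "\<not> (x \<in> P \<and> par x = u)"
    by (auto simp: resid_def)
  then show False
  proof cases
    case 1
    then obtain i where i: "u = (par ^^ i) z" by (auto simp: P tree_path_def)
    then have "i0 \<le> i" using lt u(1) by (meson not_le)
    then show False using up[of "Suc i"] 1 i x by simp
  next
    case 2
    have "((par ^^ Suc j0) z, (par ^^ j0) z) \<in> E" using edge[of j0] lt[of j0] j0 by simp
    then have "u = (par ^^ Suc j0) z \<and> x = (par ^^ j0) z"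
      using S(1) 2(1) u(1) x i0 lt[of j0] unfolding one_out_def j0 by blast
    then show False using 2(2) inP[of j0] lt[of j0] j0 by auto
  qed
qed

lemma tree_subset:
  assumes "tree E q k par" "q 0 \<in> X" "\<And>u x. u \<in> X \<Longrightarrow> (u, x) \<in> E \<Longrightarrow> x \<in> X" "p < k"
  shows "q p \<in> X"
  using assms(4)
proof (induction p rule: less_induct)
  case (less p)
  show ?case
  proof (cases "p = 0")
    case False
    then obtain j where "j < p" "(q j, q p) \<in> E" using assms(1) less.prems unfolding tree_def by blast
    moreover from this have "q j \<in> X" using less.IH[of j] less.prems by simp
    ultimately show ?thesis using assms(3) by blast
  qed (use assms(2) in simp)
qed

lemma tree_first_outside:
  assumes "tree E q k par" "q 0 \<in> S" "p < k" "q p \<notin> S"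
  shows "\<exists>p'\<le>p. 0 < p' \<and> q p' \<notin> S \<and> par (q p') \<in> S \<and> (par (q p'), q p') \<in> E"
  using assms(3,4)
proof (induction p rule: less_induct)
  case (less p)
  have "p \<noteq> 0" using assms(2) less.prems(2) by metis
  then obtain j where j: "j < p" "par (q p) = q j" "(q j, q p) \<in> E"
    using assms(1) less.prems unfolding tree_def by blast
  show ?case
  proof (cases "q j \<in> S")
    case True
    then show ?thesis using j less.prems \<open>p \<noteq> 0\<close> by (intro exI[of _ p]) auto
  next
    case False
    then obtain p' where "p' \<le> j" "0 < p' \<and> q p' \<notin> S \<and> par (q p') \<in> S \<and> (par (q p'), q p') \<in> E"
      using less.IH[of j] j(1) less.prems by auto
    then show ?thesis using j(1) by (intro exI[of _ p']) auto
  qed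
qed

section \<open>A program logic with elapsed time and frame conditions\<close>

section \<open>Weakest preconditions\<close>

fun writes :: "prog \<Rightarrow> nat set" where
  "writes Skip = {}"
| "writes (Assign a e1 e2) = {a}"
| "writes (Seq P Q) = writes P \<union> writes Q"
| "writes (Cond e P Q) = writes P \<union> writes Q"
| "writes (While e P) = writes P"

text \<open>The frame condition works on whole segments. As every register has a segment of its own,
  syntactic write sets suffice to rewrite the untouched memory.\<close>

definition unchanged :: "prog \<Rightarrow> memory \<Rightarrow> memory \<Rightarrow> bool" where
  "unchanged P M M' \<longleftrightarrow> (\<forall>s. s \<notin> writes P \<longrightarrow> M' s = M s)"

lemma exec_unchanged: "exec w P M t M' \<Longrightarrow> unchanged P M M'"
  by (induction rule: exec.induct) (auto simp: unchanged_def)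

text \<open>The argument \<open>b\<close> is the time elapsed before the program starts, so that
  postconditions bound the total time.\<close>

definition wp :: "nat \<Rightarrow> prog \<Rightarrow> (nat \<Rightarrow> memory \<Rightarrow> bool) \<Rightarrow> nat \<Rightarrow> memory \<Rightarrow> bool" where
  "wp w P Q b M \<longleftrightarrow> (\<exists>t M'. exec w P M t M' \<and> Q (b + t) M')"

lemma wp_Skip: "wp w Skip Q b M \<longleftrightarrow> Q (b + 1) M"
proof
  assume "wp w Skip Q b M"
  then obtain t M' where "exec w Skip M t M'" "Q (b + t) M'" by (auto simp: wp_def)
  then show "Q (b + 1) M" by cases auto
qed (auto simp: wp_def intro!: exec.intros exI)

lemma wp_Assign: "wp w (Assign a e1 e2) Q b M \<longleftrightarrow>
    Q (b + (1 + expr_cost e1 + expr_cost e2)) (M(a := (M a)(expr_val w M e1 := expr_val w M e2)))"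
proof
  assume "wp w (Assign a e1 e2) Q b M"
  then obtain t M' where "exec w (Assign a e1 e2) M t M'" "Q (b + t) M'" by (auto simp: wp_def)
  then show "Q (b + (1 + expr_cost e1 + expr_cost e2)) (M(a := (M a)(expr_val w M e1 := expr_val w M e2)))"
    by cases auto
qed (auto simp: wp_def intro!: exec.intros exI)

lemma wp_Seq: "wp w (Seq P P') Q b M \<longleftrightarrow> wp w P (wp w P' Q) b M"
proof
  assume "wp w (Seq P P') Q b M"
  then obtain t M' where "exec w (Seq P P') M t M'" "Q (b + t) M'" by (auto simp: wp_def)
  then show "wp w P (wp w P' Q) b M"
    by cases (auto simp: wp_def add.assoc)
next
  assume "wp w P (wp w P' Q) b M"
  then obtain t M1 t' M' where "exec w P M t M1" "exec w P' M1 t' M'" "Q (b + t + t') M'"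
    by (auto simp: wp_def)
  then show "wp w (Seq P P') Q b M"
    by (auto simp: wp_def add.assoc intro!: exec.intros exI[of _ "t + t'"])
qed

lemma wp_Cond: "wp w (Cond e P P') Q b M \<longleftrightarrow>
    (if expr_val w M e \<noteq> 0 then wp w P Q (b + (1 + expr_cost e)) M
     else wp w P' Q (b + (1 + expr_cost e)) M)"
proof
  assume "wp w (Cond e P P') Q b M"
  then obtain t M' where "exec w (Cond e P P') M t M'" "Q (b + t) M'" by (auto simp: wp_def)
  then show "if expr_val w M e \<noteq> 0 then wp w P Q (b + (1 + expr_cost e)) M
     else wp w P' Q (b + (1 + expr_cost e)) M"
    by cases (auto simp: wp_def add.assoc)
next
  assume a: "if expr_val w M e \<noteq> 0 then wp w P Q (b + (1 + expr_cost e)) M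
     else wp w P' Q (b + (1 + expr_cost e)) M"
  show "wp w (Cond e P P') Q b M"
  proof (cases "expr_val w M e = 0")
    case True
    then obtain t M' where "exec w P' M t M'" "Q (b + (1 + expr_cost e) + t) M'"
      using a by (auto simp: wp_def)
    then show ?thesis using exec.CondFalse[OF True] unfolding wp_def by (metis add.assoc)
  next
    case False
    then obtain t M' where "exec w P M t M'" "Q (b + (1 + expr_cost e) + t) M'"
      using a by (auto simp: wp_def)
    then show ?thesis using exec.CondTrue[OF False] unfolding wp_def by (metis add.assoc)
  qed
qed

lemma wp_conseq:
  assumes "wp w P Q' b M" "\<And>b' M'. Q' b' M' \<Longrightarrow> unchanged P M M' \<Longrightarrow> Q b' M'"
  shows "wp w P Q b M"
  using assms exec_unchanged unfolding wp_def by blast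

lemma unchanged_trans: "unchanged P M M' \<Longrightarrow> unchanged P M' M'' \<Longrightarrow> unchanged P M M''"
  by (auto simp: unchanged_def)

text \<open>Elapsed time strictly grows in each iteration, so its bound \<open>N\<close> under the
  invariant also serves as the termination argument.\<close>

lemma wp_While:
  assumes "I b M"
    and "\<And>b M'. I b M' \<Longrightarrow> b \<le> N"
    and step: "\<And>b M'. I b M' \<Longrightarrow> unchanged P M M' \<Longrightarrow> expr_val w M' e \<noteq> 0 \<Longrightarrow>
      wp w P I (b + (1 + expr_cost e)) M'"
    and exit: "\<And>b M'. I b M' \<Longrightarrow> unchanged P M M' \<Longrightarrow> expr_val w M' e = 0 \<Longrightarrow> Q (b + (1 + expr_cost e)) M'"
  shows "wp w (While e P) Q b M"
proof -
  have "wp w (While e P) Q b M'" if "I b M'" "unchanged P M M'" for b M'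
    using that
  proof (induction "N - b" arbitrary: b M' rule: less_induct)
    case less
    show ?case
    proof (cases "expr_val w M' e = 0")
      case True
      then show ?thesis using exit[OF less.prems True] exec.WhileFalse[OF True]
        unfolding wp_def by blast
    next
      case False
      from step[OF less.prems this] obtain t M1 where 1: "exec w P M' t M1" "I (b + (1 + expr_cost e) + t) M1"
        unfolding wp_def by blast
      have "N - (b + (1 + expr_cost e) + t) < N - b" using assms(2)[OF less.prems(1)] assms(2)[OF 1(2)] by simp
      from less.hyps[OF this 1(2)] obtain t' M2 where
        "exec w (While e P) M1 t' M2" "Q (b + (1 + expr_cost e) + t + t') M2"
        using unchanged_trans[OF less.prems(2) exec_unchanged[OF 1(1)]] unfolding wp_def by blast
      then show ?thesis using exec.WhileTrue[OF False 1(1)] unfolding wp_def by (metis add.assoc)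
    qed
  qed
  moreover have "unchanged P M M" by (simp add: unchanged_def)
  ultimately show ?thesis using assms(1) by blast
qed

lemmas wp_simps = wp_Skip wp_Assign wp_Seq wp_Cond

section \<open>Graph representation and the bounded search program\<close>

section \<open>Memory layout\<close>

text \<open>
  \<open>DST\<close>, \<open>NXT\<close> and \<open>FST\<close> hold two families of adjacency lists, in direction \<open>d = 0\<close> along the
  edges and in direction \<open>d = 1\<close> against them: \<open>FST\<close> at \<open>2 v + d\<close> starts the list of \<open>v\<close>, \<open>NXT\<close> at
  \<open>2 e + d\<close> continues it after edge \<open>e\<close>, and \<open>DST\<close> at \<open>2 e + d\<close> is the other end of \<open>e\<close>. List links
  store \<open>e + 1\<close>, and 0 ends a list. Deleted edges stay in the lists and are marked in \<open>DEAD\<close>;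
  \<open>DEG\<close> is the total degree in the input graph.

  The worklist \<open>STK\<close> holds \<open>2 v + d\<close> for a pending search from \<open>v\<close> in direction \<open>d\<close>. A search tree
  consists of the queue \<open>QB\<close>, its marks \<open>MB\<close> and its parents \<open>PB\<close>; the first tree of a search is
  copied to \<open>QA\<close> and \<open>PA\<close>, and \<open>ONP\<close> marks the chosen tree path without the root. Names starting
  with \<open>r\<close> are registers, kept at address 0 of a segment of their own.
\<close>

abbreviation (input) "TAIL \<equiv> (1::nat)"
abbreviation (input) "HEAD \<equiv> (2::nat)"
abbreviation (input) "LAB \<equiv> (3::nat)"
abbreviation (input) "DST \<equiv> (4::nat)"
abbreviation (input) "NXT \<equiv> (5::nat)"
abbreviation (input) "FST \<equiv> (6::nat)"
abbreviation (input) "DEAD \<equiv> (7::nat)"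
abbreviation (input) "DEG \<equiv> (8::nat)"
abbreviation (input) "STK \<equiv> (9::nat)"
abbreviation (input) "QA \<equiv> (10::nat)"
abbreviation (input) "PA \<equiv> (11::nat)"
abbreviation (input) "ACC \<equiv> (12::nat)"
abbreviation (input) "ONP \<equiv> (13::nat)"
abbreviation (input) "MB \<equiv> (14::nat)"
abbreviation (input) "QB \<equiv> (15::nat)"
abbreviation (input) "PB \<equiv> (16::nat)"
abbreviation (input) "rSP \<equiv> (20::nat)"
abbreviation (input) "rQ \<equiv> (21::nat)"
abbreviation (input) "rDELTA \<equiv> (22::nat)"
abbreviation (input) "rI \<equiv> (23::nat)"
abbreviation (input) "rU \<equiv> (24::nat)"
abbreviation (input) "rV \<equiv> (25::nat)"
abbreviation (input) "rROOT \<equiv> (26::nat)"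
abbreviation (input) "rD \<equiv> (27::nat)"
abbreviation (input) "rLIM \<equiv> (28::nat)"
abbreviation (input) "rK \<equiv> (29::nat)"
abbreviation (input) "rFOUND \<equiv> (30::nat)"
abbreviation (input) "rAN \<equiv> (31::nat)"
abbreviation (input) "rW \<equiv> (32::nat)"
abbreviation (input) "rQN \<equiv> (33::nat)"
abbreviation (input) "rWT \<equiv> (34::nat)"
abbreviation (input) "rQI \<equiv> (35::nat)"
abbreviation (input) "rJ \<equiv> (36::nat)"
abbreviation (input) "rX \<equiv> (37::nat)"
abbreviation (input) "rZ \<equiv> (38::nat)"
abbreviation (input) "rR \<equiv> (39::nat)"
abbreviation (input) "rGD \<equiv> (40::nat)"
abbreviation (input) "rE \<equiv> (41::nat)"
abbreviation (input) "rDD \<equiv> (42::nat)"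

abbreviation (input) C :: "nat \<Rightarrow> expr" where "C k \<equiv> Const k"
abbreviation (input) Reg :: "nat \<Rightarrow> expr" (\<open>$_\<close> [100] 100) where "$s \<equiv> Cell s (Const 0)"
abbreviation (input) At :: "nat \<Rightarrow> expr \<Rightarrow> expr" (\<open>_\<lbrakk>_\<rbrakk>\<close> [100, 0] 100) where "s\<lbrakk>e\<rbrakk> \<equiv> Cell s e"
abbreviation (input) plus_expr :: "expr \<Rightarrow> expr \<Rightarrow> expr" (infixl \<open>[+]\<close> 65) where "a [+] b \<equiv> Op Plus a b"
abbreviation (input) minus_expr :: "expr \<Rightarrow> expr \<Rightarrow> expr" (infixl \<open>[-]\<close> 65) where "a [-] b \<equiv> Op Minus a b"
abbreviation (input) times_expr :: "expr \<Rightarrow> expr \<Rightarrow> expr" (infixl \<open>[*]\<close> 70) where "a [*] b \<equiv> Op Times a b"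
abbreviation (input) div_expr :: "expr \<Rightarrow> expr \<Rightarrow> expr" (infixl \<open>[div]\<close> 70) where "a [div] b \<equiv> Op Div a b"
abbreviation (input) set_reg :: "nat \<Rightarrow> expr \<Rightarrow> prog" (infix \<open>\<leftarrow>\<close> 60) where "s \<leftarrow> e \<equiv> Assign s (Const 0) e"
abbreviation (input) set_cell :: "nat \<Rightarrow> expr \<Rightarrow> expr \<Rightarrow> prog" (\<open>_\<langle>_\<rangle> \<leftarrow> _\<close> [61, 0, 61] 60) where
  "s\<langle>i\<rangle> \<leftarrow> e \<equiv> Assign s i e"
abbreviation (input) seq_prog :: "prog \<Rightarrow> prog \<Rightarrow> prog" (infixr \<open>;;\<close> 55) where "P ;; Q \<equiv> Seq P Q"

definition arc_at :: "nat \<Rightarrow> nat \<Rightarrow> expr" where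
  "arc_at s d = $s [+] $s [+] $d"

lemma expr_cost_arc_at [simp]: "expr_cost (arc_at s d) = 8"
  by (simp add: arc_at_def)

text \<open>Conjunction is expressed by division, since \<open>x div 0 = 0\<close>: for \<open>b\<close> in \<open>{0, 1}\<close>,
  the quotient \<open>a div b\<close> is nonzero iff both are.\<close>

definition blocked :: expr where
  "blocked = ONP\<lbrakk>$rX\<rbrakk> [div] (C 1 [-] ((PA\<lbrakk>$rX\<rbrakk> [-] $rU) [+] ($rU [-] PA\<lbrakk>$rX\<rbrakk>)))"

lemma expr_cost_blocked [simp]: "expr_cost blocked = 19"
  by (simp add: blocked_def)

text \<open>The limit is tested before a vertex is added, and the weight never decreases. So a final
  weight within the limit certifies that no vertex was ever refused.\<close>

definition visit :: prog where
  "visit = Cond (MB\<lbrakk>$rX\<rbrakk>) Skip (Cond ($rWT [-] $rLIM) Skip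
     (MB\<langle>$rX\<rangle> \<leftarrow> C 1 ;; QB\<langle>$rQN\<rangle> \<leftarrow> $rX ;; PB\<langle>$rX\<rangle> \<leftarrow> $rU ;;
      rQN \<leftarrow> $rQN [+] C 1 ;; rWT \<leftarrow> $rWT [+] DEG\<lbrakk>$rX\<rbrakk>))"

definition scan_step :: prog where
  "scan_step =
      rE \<leftarrow> $rJ [-] C 1 ;; rX \<leftarrow> DST\<lbrakk>arc_at rE rD\<rbrakk> ;;
      Cond (DEAD\<lbrakk>$rE\<rbrakk>) Skip
        (Cond blocked Skip visit) ;;
      rJ \<leftarrow> NXT\<lbrakk>arc_at rE rD\<rbrakk>"

definition scan :: prog where
  "scan = While ($rJ) scan_step"

definition explore_step :: prog where
  "explore_step =
      rU \<leftarrow> QB\<lbrakk>$rQI\<rbrakk> ;;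
      Cond (ONP\<lbrakk>$rU\<rbrakk>) (rX \<leftarrow> PA\<lbrakk>$rU\<rbrakk> ;; visit) Skip ;;
      rJ \<leftarrow> FST\<lbrakk>arc_at rU rD\<rbrakk> ;;
      scan ;;
      rQI \<leftarrow> $rQI [+] C 1"

text \<open>In the loop condition the divisor is 1 while \<open>rWT\<close> is at most
  \<open>rLIM\<close> and 0 afterwards; since a quotient by 0 is 0, exceeding the limit also ends
  the loop.\<close>

definition explore :: prog where
  "explore =
     QB\<langle>C 0\<rangle> \<leftarrow> $rROOT ;; MB\<langle>$rROOT\<rangle> \<leftarrow> C 1 ;; PB\<langle>$rROOT\<rangle> \<leftarrow> $rROOT ;;
     rQN \<leftarrow> C 1 ;; rWT \<leftarrow> DEG\<lbrakk>$rROOT\<rbrakk> ;; rQI \<leftarrow> C 0 ;;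
     While (($rQN [-] $rQI) [div] (C 1 [-] ($rWT [-] $rLIM))) explore_step"

lemma writes_visit: "writes visit = {MB, QB, PB, rQN, rWT}"
  by (auto simp: visit_def)

lemma writes_scan: "writes scan = {MB, QB, PB, rQN, rWT, rE, rX, rJ}"
  by (auto simp: scan_def scan_step_def writes_visit)

lemma writes_explore_step: "writes explore_step = {MB, QB, PB, rQN, rWT, rE, rX, rJ, rU, rQI}"
  by (auto simp: explore_step_def writes_visit writes_scan)

lemma writes_explore: "writes explore = {MB, QB, PB, rQN, rWT, rE, rX, rJ, rU, rQI}"
  by (auto simp: explore_def writes_explore_step)

fun linked :: "(nat \<Rightarrow> nat) \<Rightarrow> nat \<Rightarrow> nat \<Rightarrow> nat list \<Rightarrow> bool" where
  "linked N d j [] \<longleftrightarrow> j = 0"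
| "linked N d j (e # js) \<longleftrightarrow> j = Suc e \<and> linked N d (N (e + e + d)) js"

definition src :: "nat \<Rightarrow> nat \<times> nat \<Rightarrow> nat" where
  "src d p = (if d = 0 then fst p else snd p)"

definition dst :: "nat \<Rightarrow> nat \<times> nat \<Rightarrow> nat" where
  "dst d p = (if d = 0 then snd p else fst p)"

section \<open>Weights, word-size bounds and the state of a search\<close>

section \<open>The input graph\<close>

locale input =
  fixes w n :: nat and es :: "(nat \<times> nat) list"
  assumes digraph: "digraph (graph_of n es)"
    and distinct_es: "distinct es"
    and word: "(n + 2) ^ 11 \<le> 2 ^ w"
begin

definition m :: nat where "m = length es"

text \<open>Computed values are kept within \<open>100 * lim\<close>, so that arithmetic does not
  wrap around (\<open>mod_word\<close>). Degree 4 accommodates the products \<open>K * ACC\<close>,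
  at most of order \<open>m * m\<close>; the exponent 11 in \<open>word\<close> leaves seven factors
  to absorb \<open>128 = 2 ^ 7\<close>.\<close>

definition lim :: nat where "lim = (n + 2) ^ 4"

text \<open>Reversed, because \<open>build_step\<close> inserts each edge at the front of its
  lists.\<close>

definition adj :: "nat \<Rightarrow> nat \<Rightarrow> nat list" where
  "adj d u = rev (filter (\<lambda>e. src d (es ! e) = u) [0..<m])"

definition deg :: "nat \<Rightarrow> nat" where
  "deg u = length (adj 0 u) + length (adj 1 u)"

text \<open>Degrees are those of the input graph: they bound the time for scanning lists that still
  contain deleted edges, and deletions need not update them.\<close>

definition vol :: "nat set \<Rightarrow> nat" where
  "vol X = (\<Sum>u\<in>X. deg u)"

definition alive :: "memory \<Rightarrow> (nat \<times> nat) set" where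
  "alive M = {es ! e | e. e < m \<and> M DEAD e = 0}"

definition static :: "memory \<Rightarrow> bool" where
  "static M \<longleftrightarrow> M 0 0 = n \<and> M 0 1 = m \<and>
    (\<forall>e<m. M TAIL e = fst (es ! e) \<and> M HEAD e = snd (es ! e)) \<and>
    (\<forall>e<m. \<forall>d<2. M DST (e + e + d) = dst d (es ! e)) \<and>
    (\<forall>u<n. \<forall>d<2. linked (M NXT) d (M FST (u + u + d)) (adj d u)) \<and>
    (\<forall>u<n. M DEG u = deg u)"

lemma edge_bound: "(a, b) \<in> set es \<Longrightarrow> a < n \<and> b < n \<and> a \<noteq> b"
proof -
  interpret digraph "graph_of n es" by (rule digraph)
  show "(a, b) \<in> set es \<Longrightarrow> a < n \<and> b < n \<and> a \<noteq> b"
    using wellformed[of "(a, b)"] no_loops[of "(a, b)"] by (auto simp: graph_of_def)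
qed

lemma nth_bound: "e < m \<Longrightarrow> fst (es ! e) < n \<and> snd (es ! e) < n \<and> fst (es ! e) \<noteq> snd (es ! e)"
  using edge_bound[of "fst (es ! e)" "snd (es ! e)"] by (simp add: m_def)

lemma dst_bound: "e < m \<Longrightarrow> dst d (es ! e) < n"
  using nth_bound by (simp add: dst_def)

lemma m_le: "m \<le> n * n"
proof -
  have "set es \<subseteq> {..<n} \<times> {..<n}" using edge_bound by auto
  then have "card (set es) \<le> card ({..<n} \<times> {..<n})" by (intro card_mono) auto
  then show ?thesis by (simp add: distinct_card distinct_es m_def card_cartesian_product)
qed

lemma lim_bounds: "8 * n + 16 \<le> lim" "4 * m \<le> lim" "4 * (m * m) \<le> 4 * lim" "128 * lim \<le> 2 ^ w"
proof -
  have "8 * (n + 2) \<le> (n + 2) ^ 3 * (n + 2)"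
    using power_mono[of 2 "n + 2" 3] by (intro mult_right_mono) auto
  also have "\<dots> = lim" by (simp add: lim_def power_def numeral_eq_Suc)
  finally show "8 * n + 16 \<le> lim" by simp
  have "4 * (n * n) \<le> (n + 2)^2 * (n + 2)^2"
    using power_mono[of 2 "n + 2" 2] power_mono[of n "n + 2" 2]
    by (intro mult_mono) (auto simp: power2_eq_square)
  then show "4 * m \<le> lim" using m_le by (simp add: lim_def flip: power_add)
  have "m * m \<le> (n * n) * (n * n)" using m_le by (intro mult_mono) auto
  also have "\<dots> = n ^ 4" by (simp add: numeral_eq_Suc)
  also have "\<dots> \<le> lim" unfolding lim_def by (intro power_mono) auto
  finally show "4 * (m * m) \<le> 4 * lim" by simp
  have "128 * lim \<le> (n + 2) ^ 7 * (n + 2) ^ 4"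
    using power_mono[of 2 "n + 2" 7] unfolding lim_def by (intro mult_right_mono) auto
  also have "\<dots> = (n + 2) ^ 11" by (simp flip: power_add)
  finally show "128 * lim \<le> 2 ^ w" using word by simp
qed

lemma small_word: "x \<le> 100 * lim \<Longrightarrow> x < 2 ^ w"
  using lim_bounds(1,4) by linarith

lemma mod_word: "x \<le> 100 * lim \<Longrightarrow> x mod 2 ^ w = x"
  using small_word by simp

lemma word_pos [simp]: "0 < w"
  using lim_bounds(1,4) by (cases w) auto

lemma const_mod [simp]: "Suc 0 mod 2 ^ w = Suc 0" "2 mod 2 ^ w = (2::nat)"
  using mod_word[of 1] mod_word[of 2] lim_bounds(1) by simp_all

lemma finite_vol [simp]: "X \<subseteq> {..<n} \<Longrightarrow> finite X"
  using finite_subset by blast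

lemma set_adj: "set (adj d u) = {e. e < m \<and> src d (es ! e) = u}"
  by (auto simp: adj_def)

lemma distinct_adj: "distinct (adj d u)"
  by (simp add: adj_def)

lemma sum_deg: "(\<Sum>u<n. deg u) = 2 * m"
proof -
  have "(\<Sum>u<n. length (adj d u)) = m" for d
  proof -
    have "length (adj d u) = card {e. e < m \<and> src d (es ! e) = u}" for u
      using distinct_card[OF distinct_adj] set_adj by metis
    then have "(\<Sum>u<n. length (adj d u)) = (\<Sum>u<n. card {e. e < m \<and> src d (es ! e) = u})" by simp
    also have "\<dots> = card (\<Union>u<n. {e. e < m \<and> src d (es ! e) = u})"
      by (rule card_UN_disjoint[symmetric]) auto
    also have "(\<Union>u<n. {e. e < m \<and> src d (es ! e) = u}) = {..<m}"
      using nth_bound by (auto simp: src_def)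
    finally show ?thesis by simp
  qed
  then show ?thesis by (simp add: deg_def sum.distrib)
qed

lemma vol_mono: "X \<subseteq> Y \<Longrightarrow> Y \<subseteq> {..<n} \<Longrightarrow> vol X \<le> vol Y"
  unfolding vol_def by (intro sum_mono2) auto

lemma vol_le: "X \<subseteq> {..<n} \<Longrightarrow> vol X \<le> 2 * m"
  using vol_mono[of X "{..<n}"] sum_deg by (simp add: vol_def)

lemma alive_subset: "alive M \<subseteq> set es"
  by (auto simp: alive_def m_def)

lemma alive_cong: "M' DEAD = M DEAD \<Longrightarrow> alive M' = alive M"
  by (simp add: alive_def)

lemma alive_nth: "e < m \<Longrightarrow> es ! e \<in> alive M \<longleftrightarrow> M DEAD e = 0"
  using distinct_es by (auto simp: alive_def m_def nth_eq_iff_index_eq)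

lemma dir_alive_iff: "(u, x) \<in> dir_rel d (alive M) \<longleftrightarrow>
    (\<exists>e<m. M DEAD e = 0 \<and> src d (es ! e) = u \<and> dst d (es ! e) = x)"
proof -
  have "(a, b) \<in> alive M \<longleftrightarrow> (\<exists>e<m. M DEAD e = 0 \<and> fst (es ! e) = a \<and> snd (es ! e) = b)" for a b
    by (simp add: alive_def) (metis fst_conv snd_conv prod.collapse)
  then show ?thesis by (auto simp: dir_rel_def src_def dst_def)
qed

lemma dir_alive_bound: "(u, x) \<in> dir_rel d (alive M) \<Longrightarrow> u < n \<and> x < n \<and> u \<noteq> x"
  unfolding dir_alive_iff src_def dst_def using nth_bound by (cases "d = 0") fastforce+

lemma deg_pos: "(u, x) \<in> dir_rel d (alive M) \<Longrightarrow> 0 < deg u \<and> 0 < deg x"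
proof -
  assume "(u, x) \<in> dir_rel d (alive M)"
  then obtain e where "e < m" "src d (es ! e) = u" "dst d (es ! e) = x"
    unfolding dir_alive_iff by blast
  then have "(e \<in> set (adj 0 u) \<and> e \<in> set (adj 1 x)) \<or> (e \<in> set (adj 1 u) \<and> e \<in> set (adj 0 x))"
    by (auto simp: set_adj src_def dst_def)
  then show ?thesis unfolding deg_def by (metis add_pos_nonneg add_nonneg_pos le0 length_pos_if_in_set)
qed

abbreviation (input) visited :: "memory \<Rightarrow> nat set" where
  "visited M \<equiv> M QB ` {..<M rQN 0}"

text \<open>The last conjunct bounds passes over the queue even if the last vertex has a huge
  degree: before an addition the weight is within the limit, which allows \<open>rLIM + 1\<close>
  entries by \<open>queue_le_vol\<close>, and the addition contributes one more.\<close>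

definition explored :: "(nat \<times> nat) set \<Rightarrow> memory \<Rightarrow> bool" where
  "explored G M \<longleftrightarrow> tree G (M QB) (M rQN 0) (M PB) \<and> M QB 0 = M rROOT 0 \<and>
     visited M \<subseteq> {..<n} \<and> (\<forall>v. M MB v = of_bool (v \<in> visited M)) \<and>
     M rWT 0 = vol (visited M) \<and> M rQN 0 \<le> M rLIM 0 + 2"

definition extends :: "memory \<Rightarrow> memory \<Rightarrow> bool" where
  "extends M M' \<longleftrightarrow> M rQN 0 \<le> M' rQN 0 \<and> (\<forall>i<M rQN 0. M' QB i = M QB i) \<and> M rWT 0 \<le> M' rWT 0"

lemma vol_queue_Suc: "inj_on q {..i} \<Longrightarrow> vol (q ` {..<Suc i}) = vol (q ` {..<i}) + deg (q i)"
proof -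
  assume "inj_on q {..i}"
  then have "q i \<notin> q ` {..<i}" by (auto dest: inj_onD)
  then show ?thesis by (simp add: lessThan_Suc vol_def)
qed

text \<open>Every queued vertex except the root was reached by an edge and weighs at least 1. This
  converts numbers of vertices into weights in the time bounds.\<close>

lemma queue_le_vol:
  assumes "\<And>j. 0 < j \<Longrightarrow> j < k \<Longrightarrow> 0 < deg (q j)" "inj_on q {..<k}" "i \<le> k"
  shows "i \<le> 1 + vol (q ` {..<i})"
  using assms(3)
proof (induction i)
  case (Suc i)
  have "inj_on q {..i}" using assms(2) Suc.prems by (auto simp: inj_on_def)
  then have "vol (q ` {..<Suc i}) = vol (q ` {..<i}) + deg (q i)" by (rule vol_queue_Suc)
  then show ?case using Suc assms(1)[of i] by (cases "i = 0") auto
qed simp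

lemma explored_QN_le: "explored G M \<Longrightarrow> M rQN 0 \<le> n"
proof -
  assume "explored G M"
  then have "card (visited M) = M rQN 0" "visited M \<subseteq> {..<n}"
    by (auto simp: explored_def tree_def card_image)
  then show ?thesis using card_mono[of "{..<n}" "visited M"] by simp
qed

lemma visit_spec:
  assumes M: "explored G M" "static M" and x: "M rX 0 < n" "(M rU 0, M rX 0) \<in> G"
    and u: "M rU 0 \<in> visited M" and G: "\<And>u x. (u, x) \<in> G \<Longrightarrow> 0 < deg x"
    and Q: "\<And>b' M'. explored G M' \<Longrightarrow> extends M M' \<Longrightarrow>
      (M' rWT 0 \<le> M rLIM 0 \<Longrightarrow> M rX 0 \<in> visited M') \<Longrightarrow>
      unchanged visit M M' \<Longrightarrow> b' \<le> b + 40 \<Longrightarrow> Q b' M'"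
  shows "wp w visit Q b M"
proof (rule wp_conseq)
  let ?X = "visited M"
  define x where "x = M rX 0"
  define k where "k = M rQN 0"
  have bnd: "M rQN 0 + 1 \<le> 100 * lim" "M rWT 0 + deg x \<le> 100 * lim" "deg x \<le> 2 * m"
  proof -
    show "M rQN 0 + 1 \<le> 100 * lim" using explored_QN_le[OF M(1)] lim_bounds by linarith
    show "deg x \<le> 2 * m" using vol_le[of "{x}"] x by (simp add: vol_def x_def)
    moreover have "M rWT 0 \<le> 2 * m" using vol_le[of ?X] M(1) by (simp add: explored_def)
    ultimately show "M rWT 0 + deg x \<le> 100 * lim" using lim_bounds by linarith
  qed
  have dg: "M DEG x = deg x" using M(2) x by (simp add: static_def x_def)
  let ?P = "\<lambda>b' M'. explored G M' \<and> extends M M' \<and> b' \<le> b + 40 \<and>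
      (M' rWT 0 \<le> M rLIM 0 \<longrightarrow> M rX 0 \<in> visited M')"
  have new: "explored G M'" if nv: "x \<notin> ?X"
    and M': "M' QB = (M QB)(k := x)" "M' PB = (M PB)(x := M rU 0)" "M' MB = (M MB)(x := 1)"
      "M' rQN 0 = Suc k" "M' rWT 0 = M rWT 0 + deg x" "M' rROOT 0 = M rROOT 0" "M' rLIM 0 = M rLIM 0" and wt: "M rWT 0 \<le> M rLIM 0" for M'
  proof -
    have t: "tree G (M QB) k (M PB)" using M(1) by (simp add: explored_def k_def)
    have im: "visited M' = insert x ?X"
      by (auto simp: M' k_def lessThan_Suc)
    have "tree G (M' QB) (M' rQN 0) (M' PB)"
      unfolding tree_def M'(4)
    proof (intro conjI allI impI)
      show "0 < Suc k" by simp
      show "inj_on (M' QB) {..<Suc k}"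
        using t nv by (auto simp: M' tree_def inj_on_def k_def less_Suc_eq)
      have "M QB 0 \<in> ?X" using t by (auto simp: tree_def k_def)
      then show "M' PB (M' QB 0) = M' QB 0" using t nv by (auto simp: M' tree_def)
      fix i assume i: "0 < i \<and> i < Suc k"
      show "\<exists>j<i. M' PB (M' QB i) = M' QB j \<and> (M' QB j, M' QB i) \<in> G"
      proof (cases "i = k")
        case True
        then obtain j where "j < k" "M rU 0 = M QB j" using u by (auto simp: k_def)
        then show ?thesis using x True by (auto simp: M' x_def intro!: exI[of _ j])
      next
        case False
        then have "i < k" using i by simp
        moreover from this have "M QB i \<noteq> x" using nv by (auto simp: k_def)
        moreover obtain j where "j < i" "M PB (M QB i) = M QB j" "(M QB j, M QB i) \<in> G"
          using t i \<open>i < k\<close> unfolding tree_def by blast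
        ultimately show ?thesis by (auto simp: M' intro!: exI[of _ j])
      qed
    qed
    moreover have "M' QB 0 = M' rROOT 0"
      using M(1) t by (auto simp: M' explored_def tree_def)
    moreover have "Suc k \<le> M rLIM 0 + 2"
    proof -
      have "0 < deg (M QB j)" if "0 < j" "j < k" for j
        using t that G unfolding tree_def by blast
      then have "k \<le> 1 + vol (M QB ` {..<k})"
        using t queue_le_vol[of k "M QB" k] by (simp add: tree_def)
      then show ?thesis using wt M(1) by (simp add: explored_def k_def)
    qed
    moreover have "vol (insert x ?X) = vol ?X + deg x"
      using nv by (simp add: vol_def)
    ultimately show ?thesis
      using M(1) x unfolding explored_def im by (simp add: M'(3-7) x_def insert_subset)
  qed
  show "wp w visit ?P b M"
  proof (cases "M MB x = 0 \<and> M rWT 0 \<le> M rLIM 0")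
    case False
    then show ?thesis
    proof (cases "M MB x = 0")
      case True
      with False show ?thesis using M
        by (simp add: visit_def wp_simps extends_def flip: x_def)
    next
      case mb: False
      then have "x \<in> ?X" using M(1) by (auto simp: explored_def)
      with mb show ?thesis using M
        by (simp add: visit_def wp_simps extends_def flip: x_def)
    qed
  next
    case True
    then have nv: "x \<notin> ?X" using M(1) by (auto simp: explored_def)
    show ?thesis using True
      apply (simp add: visit_def wp_simps extends_def dg mod_word[OF bnd(1), simplified] mod_word[OF bnd(2)] flip: x_def)
      apply (intro conjI new[OF nv])
      apply (auto simp: k_def)
      done
  qed
qed (use Q in auto)

end

section \<open>Breadth-first search of a residual graph up to a weight limit\<close>

section \<open>Exploration\<close>

text \<open>Loops along a linked list or a tree path are verified by induction on the list or the
  position, with one unfolding per element, instead of an invariant.\<close>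

lemma wp_While_unfold: "wp w (While e P) Q b M \<longleftrightarrow>
    (if expr_val w M e \<noteq> 0 then wp w P (wp w (While e P) Q) (b + (1 + expr_cost e)) M
     else Q (b + (1 + expr_cost e)) M)"
proof
  assume "wp w (While e P) Q b M"
  then obtain t M' where "exec w (While e P) M t M'" "Q (b + t) M'" by (auto simp: wp_def)
  then show "if expr_val w M e \<noteq> 0 then wp w P (wp w (While e P) Q) (b + (1 + expr_cost e)) M
     else Q (b + (1 + expr_cost e)) M"
    by cases (auto simp: wp_def add.assoc)
next
  assume a: "if expr_val w M e \<noteq> 0 then wp w P (wp w (While e P) Q) (b + (1 + expr_cost e)) M
     else Q (b + (1 + expr_cost e)) M"
  show "wp w (While e P) Q b M"
  proof (cases "expr_val w M e = 0")
    case True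
    then have "Q (b + (1 + expr_cost e)) M" using a by simp
    then show ?thesis using exec.WhileFalse[OF True] unfolding wp_def by blast
  next
    case False
    then obtain t M1 t' M' where "exec w P M t M1" "exec w (While e P) M1 t' M'"
      "Q (b + (1 + expr_cost e) + t + t') M'"
      using a by (auto simp: wp_def)
    then show ?thesis using exec.WhileTrue[OF False] unfolding wp_def by (metis add.assoc)
  qed
qed

lemma scan_unfold: "wp w scan Q b M \<longleftrightarrow>
    (if M rJ 0 \<noteq> 0 then wp w scan_step (wp w scan Q) (b + 3) M else Q (b + 3) M)"
  unfolding scan_def by (subst wp_While_unfold) (simp add: numeral_3_eq_3)

lemma unchangedD: "unchanged P M M' \<Longrightarrow> s \<notin> writes P \<Longrightarrow> M' s = M s"
  by (simp add: unchanged_def)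

context input
begin

definition ready :: "memory \<Rightarrow> bool" where
  "ready M \<longleftrightarrow> static M \<and> M rD 0 < 2 \<and> (\<forall>v. M ONP v \<le> 1) \<and>
    (\<forall>v. M ONP v \<noteq> 0 \<longrightarrow> (M PA v, v) \<in> dir_rel (M rD 0) (alive M))"

text \<open>Without marks in \<open>ONP\<close> this is the graph itself
  (\<open>resid_no_path\<close>), so one program grows both the first tree and the residual
  searches.\<close>

definition res :: "memory \<Rightarrow> (nat \<times> nat) set" where
  "res M = resid (dir_rel (M rD 0) (alive M)) {v. M ONP v \<noteq> 0} (M PA)"

lemma static_cong:
  assumes "M' 0 = M 0" "M' TAIL = M TAIL" "M' HEAD = M HEAD" "M' DST = M DST" "M' NXT = M NXT"
    "M' FST = M FST" "M' DEG = M DEG"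
  shows "static M' = static M"
  using assms by (simp add: static_def)

lemma ready_cong:
  assumes "M' 0 = M 0" "M' TAIL = M TAIL" "M' HEAD = M HEAD" "M' DST = M DST" "M' NXT = M NXT"
    "M' FST = M FST" "M' DEG = M DEG" "M' DEAD = M DEAD" "M' rD = M rD" "M' ONP = M ONP" "M' PA = M PA"
  shows "ready M' = ready M" "res M' = res M"
  using assms static_cong[of M' M] alive_cong[of M' M] by (simp_all add: ready_def res_def)

lemma res_bound:
  assumes "ready M" "(u, x) \<in> res M"
  shows "u < n" "x < n" "0 < deg x"
proof -
  have "(u, x) \<in> dir_rel (M rD 0) (alive M) \<or> (x, u) \<in> dir_rel (M rD 0) (alive M)"
    using assms by (auto simp: ready_def res_def resid_def)
  then show "u < n" "x < n" "0 < deg x"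
    using dir_alive_bound deg_pos by blast+
qed

lemma explored_cong:
  assumes "M' QB = M QB" "M' PB = M PB" "M' MB = M MB" "M' rQN = M rQN" "M' rWT = M rWT" "M' rROOT = M rROOT"
    "M' rLIM = M rLIM"
  shows "explored G M' = explored G M"
  using assms by (simp add: explored_def)

lemma extends_visited: "extends M M' \<Longrightarrow> visited M \<subseteq> visited M'"
  by (auto simp: extends_def) (metis imageI lessThan_iff order_less_le_trans)

lemma extends_trans: "extends M M' \<Longrightarrow> extends M' M'' \<Longrightarrow> extends M M''"
  by (auto simp: extends_def)

definition scan_post :: "nat list \<Rightarrow> nat \<Rightarrow> memory \<Rightarrow> nat \<Rightarrow> memory \<Rightarrow> bool" where
  "scan_post js b M b' M' \<longleftrightarrow> explored (res M) M' \<and> extends M M' \<and>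
    (M' rWT 0 \<le> M rLIM 0 \<longrightarrow> (\<forall>e\<in>set js. M DEAD e = 0 \<longrightarrow>
       \<not> (M ONP (dst (M rD 0) (es ! e)) \<noteq> 0 \<and> M PA (dst (M rD 0) (es ! e)) = M rU 0) \<longrightarrow> dst (M rD 0) (es ! e) \<in> visited M')) \<and>
    b' \<le> b + 100 * (length js + 1)"

lemma arc_at_val:
  assumes "M d 0 < 2" "M s 0 \<le> n \<or> M s 0 \<le> m"
  shows "expr_val w M (arc_at s d) = M s 0 + M s 0 + M d 0"
proof -
  have "M s 0 + M s 0 + M d 0 \<le> 100 * lim" "M s 0 + M s 0 \<le> 100 * lim"
    using assms lim_bounds by linarith+
  then show ?thesis by (simp add: arc_at_def mod_word)
qed

lemma blocked_val:
  assumes "M ONP (M rX 0) \<le> 1" "M PA (M rX 0) \<le> n" "M rU 0 \<le> n"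
  shows "expr_val w M blocked = 0 \<longleftrightarrow> \<not> (M ONP (M rX 0) \<noteq> 0 \<and> M PA (M rX 0) = M rU 0)"
proof -
  let ?a = "M PA (M rX 0)" and ?u = "M rU 0"
  have "(?a - ?u) + (?u - ?a) \<le> 100 * lim" using assms lim_bounds by linarith
  then have "expr_val w M ((PA\<lbrakk>$rX\<rbrakk> [-] $rU) [+] ($rU [-] PA\<lbrakk>$rX\<rbrakk>)) = (?a - ?u) + (?u - ?a)"
    by (simp add: mod_word)
  moreover have "M ONP (M rX 0) = 0 \<or> M ONP (M rX 0) = 1" using assms(1) by linarith
  moreover have "?a = ?u \<longleftrightarrow> (?a - ?u) + (?u - ?a) = 0" by linarith
  moreover have "Suc 0 div (Suc 0 - x) = of_bool (x = 0)" for x by (cases x) auto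
  ultimately show ?thesis unfolding blocked_def by (elim disjE) simp_all
qed

lemma scan_spec:
  assumes "explored (res M) M" "ready M" "linked (M NXT) (M rD 0) (M rJ 0) js"
    "set js \<subseteq> set (adj (M rD 0) (M rU 0))" "M rU 0 \<in> visited M"
  shows "wp w scan (scan_post js b M) b M"
  using assms
proof (induction js arbitrary: b M)
  case Nil
  then show ?case
    by (simp add: scan_unfold scan_post_def extends_def)
next
  case (Cons e js)
  define d where "d = M rD 0"
  define u where "u = M rU 0"
  define x where "x = dst d (es ! e)"
  have d2: "d < 2" and st: "static M" using Cons.prems(2) by (auto simp: ready_def d_def)
  have em: "e < m" "src d (es ! e) = u" using Cons.prems(4) by (auto simp: set_adj d_def u_def)
  have xn: "x < n" using em dst_bound by (simp add: x_def)
  have un: "u < n" using Cons.prems(1,5) by (auto simp: explored_def u_def)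
  have J: "M rJ 0 = Suc e" "linked (M NXT) d (M NXT (e + e + d)) js"
    using Cons.prems(3) by (simp_all add: d_def)
  have dst: "M DST (e + e + d) = x" using st em d2 by (simp add: static_def x_def)
  \<comment> \<open>The remainder of the scan, for whichever branch has dealt with edge
    \<open>e\<close>; only \<open>x\<close>'s membership is left to the branch.\<close>
  have rest: "wp w scan (scan_post (e # js) b M) b2 M2"
    if M2: "explored (res M) M2" "extends M M2" "unchanged scan M M2" "M2 rJ 0 = M NXT (e + e + d)"
      "b2 \<le> b + 100" and x: "M2 rWT 0 \<le> M rLIM 0 \<Longrightarrow> M DEAD e = 0 \<Longrightarrow> \<not> (M ONP x \<noteq> 0 \<and> M PA x = u) \<Longrightarrow> x \<in> visited M2"
    for M2 b2
  proof (rule wp_conseq)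
    note un = unchangedD[OF M2(3), unfolded writes_scan]
    have res: "res M2 = res M" "ready M2 = ready M" by (rule ready_cong; simp add: un)+
    show "wp w scan (scan_post js b2 M2) b2 M2"
      using Cons.IH[of M2 b2] Cons.prems M2 J(2) extends_visited[OF M2(2)]
      by (auto simp: res un d_def)
    fix b' M' assume p: "scan_post js b2 M2 b' M'"
    then have "M2 rWT 0 \<le> M' rWT 0" by (simp add: scan_post_def extends_def)
    with p show "scan_post (e # js) b M b' M'"
      using M2(2,5) x extends_visited[of M2 M'] unfolding scan_post_def
      by (auto simp: res un x_def u_def d_def intro: extends_trans)
  qed
  have av: "expr_val w M' (arc_at rE rD) = e + e + d" if "M' rE 0 = e" "M' rD 0 = d" for M'
    using arc_at_val[of M' rD rE] that d2 em by simp
  define M1 where "M1 = M(rE := (M rE)(0 := e), rX := (M rX)(0 := x))"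
  have M1res: "res M1 = res M" "ready M1 = ready M" by (rule ready_cong; simp add: M1_def)+
  have M1ex: "explored (res M) M1"
    using Cons.prems(1) explored_cong[of M1 M] by (simp add: M1_def)
  have bv: "expr_val w M' blocked = 0 \<longleftrightarrow> \<not> (M ONP x \<noteq> 0 \<and> M PA x = u)"
    if "M' rX 0 = x" "M' ONP = M ONP" "M' PA = M PA" "M' rU 0 = u" for M'
  proof (cases "M ONP x = 0")
    case False
    then have "M PA x < n" using Cons.prems(2) dir_alive_bound[of "M PA x" x] by (auto simp: ready_def)
    moreover have "M ONP x \<le> 1" using Cons.prems(2) by (auto simp: ready_def)
    ultimately show ?thesis using blocked_val[of M'] un that by simp
  qed (simp add: that blocked_def)
  let ?tail = "\<lambda>b2 M2. wp w scan (scan_post (e # js) b M) b2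
    (M2(rJ := (M2 rJ)(0 := M NXT (e + e + d))))"
  have t1: "?tail b2 M1" if "b2 \<le> b + 100" "M DEAD e \<noteq> 0 \<or> (M ONP x \<noteq> 0 \<and> M PA x = u)" for b2
  proof (rule rest)
    show "unchanged scan M (M1(rJ := (M1 rJ)(0 := M NXT (e + e + d))))"
      by (simp add: unchanged_def writes_scan M1_def)
    show "extends M (M1(rJ := (M1 rJ)(0 := M NXT (e + e + d))))"
      by (simp add: extends_def M1_def)
    show "explored (res M) (M1(rJ := (M1 rJ)(0 := M NXT (e + e + d))))"
      using M1ex explored_cong[of "M1(rJ := (M1 rJ)(0 := M NXT (e + e + d)))" M1] by simp
  qed (use that in \<open>auto simp: M1_def\<close>)
  have t2: "wp w visit (wp w (rJ \<leftarrow> NXT\<lbrakk>arc_at rE rD\<rbrakk>) (wp w scan (scan_post (e # js) b M))) b2 M1"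
    if b2: "b2 \<le> b + 45" and nb: "M DEAD e = 0" "\<not> (M ONP x \<noteq> 0 \<and> M PA x = u)" for b2
  proof (rule visit_spec)
    show "explored (res M) M1" by (rule M1ex)
    show "static M1" using M1res(2) Cons.prems(2) by (simp add: ready_def)
    show "M1 rX 0 < n" using xn by (simp add: M1_def)
    have "(u, x) \<in> dir_rel d (alive M)" using em nb(1) by (auto simp: dir_alive_iff x_def)
    then show "(M1 rU 0, M1 rX 0) \<in> res M" using nb(2) by (auto simp: M1_def res_def resid_def u_def d_def)
    show "0 < deg x" if "(u, x) \<in> res M" for u x using res_bound[OF Cons.prems(2) that] by simp
    show "M1 rU 0 \<in> visited M1" using Cons.prems(5) by (simp add: M1_def)
    fix b' M' assume M': "explored (res M) M'" "extends M1 M'"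
      "M' rWT 0 \<le> M1 rLIM 0 \<Longrightarrow> M1 rX 0 \<in> visited M'" "unchanged visit M1 M'" "b' \<le> b2 + 40"
    note un = unchangedD[OF M'(4), unfolded writes_visit]
    have "?tail (b' + 11) M'"
    proof (rule rest)
      show "unchanged scan M (M'(rJ := (M' rJ)(0 := M NXT (e + e + d))))"
        using M'(4) by (simp add: unchanged_def writes_scan writes_visit M1_def)
      show "extends M (M'(rJ := (M' rJ)(0 := M NXT (e + e + d))))"
        using M'(2) by (simp add: extends_def M1_def)
      show "explored (res M) (M'(rJ := (M' rJ)(0 := M NXT (e + e + d))))"
        using M'(1) explored_cong[of "M'(rJ := (M' rJ)(0 := M NXT (e + e + d)))" M'] by simp
      show "x \<in> (M'(rJ := (M' rJ)(0 := M NXT (e + e + d)))) QB ` {..<(M'(rJ := (M' rJ)(0 := M NXT (e + e + d)))) rQN 0}"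
        if "(M'(rJ := (M' rJ)(0 := M NXT (e + e + d)))) rWT 0 \<le> M rLIM 0"
        using M'(3) that by (simp add: M1_def)
    qed (use M'(5) b2 in auto)
    moreover have "M' NXT = M NXT" by (simp add: un M1_def)
    moreover have "expr_val w M' (arc_at rE rD) = e + e + d"
      by (rule av) (simp_all add: un M1_def d_def)
    ultimately show "wp w (rJ \<leftarrow> NXT\<lbrakk>arc_at rE rD\<rbrakk>) (wp w scan (scan_post (e # js) b M)) b' M'"
      by (simp add: wp_Assign)
  qed
  show ?case
    apply (subst scan_unfold)
    apply (simp add: scan_step_def wp_simps J(1) av bv dst d_def[symmetric] u_def[symmetric])
    using t1[unfolded M1_def] t2[unfolded M1_def] by (auto simp: add.commute)
qed

definition step_post :: "nat \<Rightarrow> memory \<Rightarrow> nat \<Rightarrow> memory \<Rightarrow> bool" where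
  "step_post b M b' M' \<longleftrightarrow> explored (res M) M' \<and> extends M M' \<and> M' rQI 0 = Suc (M rQI 0) \<and>
    (M' rWT 0 \<le> M rLIM 0 \<longrightarrow> (\<forall>x. (M QB (M rQI 0), x) \<in> res M \<longrightarrow> x \<in> visited M')) \<and>
    b' \<le> b + 250 + 100 * deg (M QB (M rQI 0))"

lemma length_adj_le: "d < 2 \<Longrightarrow> length (adj d u) \<le> deg u"
  by (auto simp: deg_def less_2_cases_iff)

lemma explore_step_spec:
  assumes M: "explored (res M) M" "ready M" "M rQI 0 < M rQN 0"
  shows "wp w explore_step (step_post b M) b M"
proof -
  define u where "u = M QB (M rQI 0)"
  define d where "d = M rD 0"
  have d2: "d < 2" and st: "static M" using M(2) by (auto simp: ready_def d_def)
  have uv: "u \<in> visited M" using M(3) by (auto simp: u_def)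
  then have un: "u < n" using M(1) by (auto simp: explored_def)
  have qi: "M rQI 0 < n" using explored_QN_le[OF M(1)] M(3) by simp
  \<comment> \<open>Common to both branches: \<open>M1\<close> is the memory after the reversed path
    edge at \<open>u\<close>, if there is one, has been followed.\<close>
  have mid: "wp w (rJ \<leftarrow> FST\<lbrakk>arc_at rU rD\<rbrakk> ;; scan ;; rQI \<leftarrow> $rQI [+] C 1) (step_post b M) b1 M1"
    if M1: "explored (res M) M1" "extends M M1" "\<And>s. s \<notin> writes explore_step - {rQI} \<Longrightarrow> M1 s = M s"
      "M1 rU 0 = u" and b1: "b1 \<le> b + 70"
      and par: "M1 rWT 0 \<le> M rLIM 0 \<Longrightarrow> M ONP u \<noteq> 0 \<Longrightarrow> M PA u \<in> visited M1"
    for b1 M1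
  proof -
    note M1s = M1(3)[unfolded writes_explore_step]
    define M2 where "M2 = M1(rJ := (M1 rJ)(0 := M FST (u + u + d)))"
    have av: "expr_val w M1 (arc_at rU rD) = u + u + d"
      using arc_at_val[of M1 rD rU] d2 un by (simp add: M1s M1(4) d_def)
    have res: "res M2 = res M" "ready M2 = ready M" by (rule ready_cong; simp add: M2_def M1s)+
    have "wp w scan (scan_post (adj d u) (b1 + 11) M2) (b1 + 11) M2"
    proof (rule scan_spec)
      show "explored (res M2) M2"
        unfolding res using M1(1) explored_cong[of M2 M1] by (simp add: M2_def)
      show "ready M2" using M(2) by (simp add: res)
      show "linked (M2 NXT) (M2 rD 0) (M2 rJ 0) (adj d u)"
        using st un d2 by (simp add: M2_def M1s static_def d_def)
      show "set (adj d u) \<subseteq> set (adj (M2 rD 0) (M2 rU 0))" by (simp add: M2_def M1(4) M1s d_def)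
      show "M2 rU 0 \<in> visited M2"
        using uv extends_visited[OF M1(2)] by (auto simp: M2_def M1(4))
    qed
    then have "wp w scan (wp w (rQI \<leftarrow> $rQI [+] C 1) (step_post b M)) (b1 + 11) M2"
    proof (rule wp_conseq)
      fix b' M' assume p: "scan_post (adj d u) (b1 + 11) M2 b' M'" and "unchanged scan M2 M'"
      note M's = unchangedD[OF this(2), unfolded writes_scan]
      have "M' rQI 0 + 1 \<le> 100 * lim" using qi lim_bounds by (simp add: M's M2_def M1s)
      then have v: "expr_val w M' ($rQI [+] C 1) = Suc (M rQI 0)" by (simp add: mod_word M's M2_def M1s)
      define M3 where "M3 = M'(rQI := (M' rQI)(0 := Suc (M rQI 0)))"
      have ext: "extends M2 M'" "explored (res M) M'" using p by (simp_all add: scan_post_def res)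
      have e3: "extends M M3" using M1(2) ext(1) by (simp add: extends_def M2_def M3_def)
      have "x \<in> visited M3" if xr: "(u, x) \<in> res M" and xw: "M3 rWT 0 \<le> M rLIM 0" for x
      proof -
        have wt: "M' rWT 0 \<le> M2 rLIM 0" "M1 rWT 0 \<le> M rLIM 0"
          using xw ext(1) by (auto simp: M3_def M2_def M1s extends_def)
        consider "M ONP u \<noteq> 0" "x = M PA u"
          | "(u, x) \<in> dir_rel d (alive M)" "\<not> (M ONP x \<noteq> 0 \<and> M PA x = u)"
          using xr unfolding res_def resid_def d_def by blast
        then have "x \<in> visited M'"
        proof cases
          case 1
          then show ?thesis using par[OF wt(2)] extends_visited[OF ext(1)] by (auto simp: M2_def)
        next
          case 2
          then obtain e where "e \<in> set (adj d u)" "M DEAD e = 0" "dst d (es ! e) = x"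
            by (auto simp: dir_alive_iff set_adj)
          then show ?thesis using p wt(1) 2(2)
            by (auto simp: scan_post_def M2_def M1s M1(4) d_def)
        qed
        then show ?thesis by (simp add: M3_def)
      qed
      moreover have "explored (res M) M3"
        using ext(2) explored_cong[of M3 M'] by (simp add: M3_def)
      moreover have "b' + 6 \<le> b + 250 + 100 * deg u"
        using p b1 length_adj_le[OF d2, of u] by (simp add: scan_post_def)
      ultimately have "step_post b M (b' + 6) M3"
        using e3 unfolding step_post_def u_def[symmetric] by (simp add: M3_def)
      then show "wp w (rQI \<leftarrow> $rQI [+] C 1) (step_post b M) b' M'"
        unfolding wp_Assign v by (simp add: M3_def numeral_eq_Suc)
    qed
    then show ?thesis
      by (simp add: wp_Seq wp_Assign av M2_def M1s)
  qed
  define M0 where "M0 = M(rU := (M rU)(0 := u))"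
  show ?thesis
  proof (cases "M ONP u = 0")
    case True
    have "wp w (rJ \<leftarrow> FST\<lbrakk>arc_at rU rD\<rbrakk> ;; scan ;; rQI \<leftarrow> $rQI [+] C 1) (step_post b M) (b + 10) M0"
      using M(1) explored_cong[of M0 M] True
      by (intro mid) (auto simp: M0_def extends_def writes_explore_step)
    then show ?thesis
      using True by (simp add: explore_step_def wp_simps M0_def flip: u_def)
  next
    case False
    define M1 where "M1 = M0(rX := (M0 rX)(0 := M PA u))"
    have r: "(u, M PA u) \<in> res M" using False by (auto simp: res_def resid_def)
    have M1res: "res M1 = res M" "ready M1 = ready M" by (rule ready_cong; simp add: M1_def M0_def)+
    have "wp w visit (wp w (rJ \<leftarrow> FST\<lbrakk>arc_at rU rD\<rbrakk> ;; scan ;; rQI \<leftarrow> $rQI [+] C 1) (step_post b M)) b1 M1"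
      if b1: "b1 \<le> b + 30" for b1
    proof (rule visit_spec)
      show "explored (res M) M1" using M(1) explored_cong[of M1 M] by (simp add: M1_def M0_def)
      show "static M1" using M1res M(2) by (simp add: ready_def)
      show "M1 rX 0 < n" using res_bound[OF M(2) r] by (simp add: M1_def)
      show "(M1 rU 0, M1 rX 0) \<in> res M" using r by (simp add: M1_def M0_def)
      show "0 < deg x" if "(u, x) \<in> res M" for u x using res_bound[OF M(2) that] by simp
      show "M1 rU 0 \<in> visited M1" using uv by (simp add: M1_def M0_def)
      fix b' M' assume M': "explored (res M) M'" "extends M1 M'"
        "M' rWT 0 \<le> M1 rLIM 0 \<Longrightarrow> M1 rX 0 \<in> visited M'" "unchanged visit M1 M'" "b' \<le> b1 + 40"
      note M's = unchangedD[OF M'(4), unfolded writes_visit]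
      show "wp w (rJ \<leftarrow> FST\<lbrakk>arc_at rU rD\<rbrakk> ;; scan ;; rQI \<leftarrow> $rQI [+] C 1) (step_post b M) b' M'"
        using M' b1 by (intro mid) (auto simp: M1_def M0_def extends_def writes_explore_step M's)
    qed
    from this[unfolded M1_def M0_def] show ?thesis
      using False by (simp add: explore_step_def wp_Seq wp_Assign wp_Cond flip: u_def)
  qed
qed

text \<open>The limit bounds the time even if the last vertex overshoots it: a vertex is scanned
  only while the total weight, its own included, is within the limit.\<close>

definition explore_post :: "nat \<Rightarrow> memory \<Rightarrow> nat \<Rightarrow> memory \<Rightarrow> bool" where
  "explore_post b M b' M' \<longleftrightarrow> explored (res M) M' \<and>
    (M' rWT 0 \<le> M rLIM 0 \<longrightarrow>
      (\<forall>u x. u \<in> visited M' \<longrightarrow> (u, x) \<in> res M \<longrightarrow> x \<in> visited M')) \<and>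
    b' \<le> b + 400 * (1 + min (M rLIM 0) (M' rWT 0))"

lemma explored_deg_pos:
  assumes "explored (res M) M'" "ready M" "0 < j" "j < M' rQN 0"
  shows "0 < deg (M' QB j)"
proof -
  obtain i where "(M' QB i, M' QB j) \<in> res M"
    using assms(1,3,4) unfolding explored_def tree_def by blast
  then show ?thesis using res_bound[OF assms(2)] by blast
qed

lemma explore_spec:
  assumes M: "ready M" "M rROOT 0 < n" "\<And>v. M MB v = 0"
  shows "wp w explore (explore_post b M) b M"
proof -
  define r where "r = M rROOT 0"
  define M1 where "M1 = M(QB := (M QB)(0 := r), MB := (M MB)(r := 1), PB := (M PB)(r := r),
     rQN := (M rQN)(0 := 1), rWT := (M rWT)(0 := deg r), rQI := (M rQI)(0 := 0))"
  have dg: "M DEG r = deg r" using M(1,2) by (simp add: ready_def static_def r_def)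
  have M1: "explored (res M) M1"
    using M by (auto simp: explored_def M1_def tree_def r_def vol_def lessThan_Suc)
  define I where "I = (\<lambda>b' M'. explored (res M) M' \<and> M' rQI 0 \<le> M' rQN 0 \<and>
    (\<forall>i<M' rQI 0. M' rWT 0 \<le> M rLIM 0 \<longrightarrow> (\<forall>x. (M' QB i, x) \<in> res M \<longrightarrow> x \<in> visited M')) \<and>
    vol (M' QB ` {..<M' rQI 0}) \<le> M rLIM 0 \<and>
    b' \<le> b + 30 + 270 * M' rQI 0 + 100 * vol (M' QB ` {..<M' rQI 0}))"
  have inj: "inj_on (M' QB) {..<M' rQN 0}" if "explored (res M) M'" for M'
    using that by (simp add: explored_def tree_def)
  have vq: "vol (M' QB ` {..<i}) \<le> M' rWT 0" if "explored (res M) M'" "i \<le> M' rQN 0" for M' i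
  proof -
    have "M' QB ` {..<i} \<subseteq> visited M'" using that(2) by auto
    then show ?thesis using that(1) vol_mono by (auto simp: explored_def)
  qed
  have wt: "M' rWT 0 \<le> 2 * m" if "explored (res M) M'" for M'
    using that vol_le by (simp add: explored_def)
  have "wp w (While (($rQN [-] $rQI) [div] (C 1 [-] ($rWT [-] $rLIM))) explore_step)
    (explore_post b M) b1 M1" if b1: "b1 \<le> b + 30" for b1
  proof (rule wp_While[where I = I and N = "b + 30 + 270 * n + 100 * (2 * m)"])
    show "I b1 M1" using M1 b1 by (simp add: I_def M1_def vol_def)
    show "b' \<le> b + 30 + 270 * n + 100 * (2 * m)" if "I b' M'" for b' M'
    proof -
      have "explored (res M) M'" "M' rQI 0 \<le> M' rQN 0" using that by (simp_all add: I_def)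
      then have "M' rQI 0 \<le> n" "vol (M' QB ` {..<M' rQI 0}) \<le> 2 * m"
        using explored_QN_le[of "res M" M'] vq[of M' "M' rQI 0"] wt[of M'] by simp_all
      then show ?thesis using that by (simp add: I_def)
    qed
    fix b' M' assume I: "I b' M'" and un: "unchanged explore_step M1 M'"
    note M's = unchangedD[OF un, unfolded writes_explore_step]
    have res: "res M' = res M" "ready M' = ready M" by (rule ready_cong; simp add: M's M1_def)+
    have ex: "explored (res M) M'" and lim': "M' rLIM 0 = M rLIM 0" using I by (simp_all add: I_def M's M1_def)
    have cnd: "expr_val w M' (($rQN [-] $rQI) [div] (C 1 [-] ($rWT [-] $rLIM))) \<noteq> 0 \<longleftrightarrow>
      M' rQI 0 < M' rQN 0 \<and> M' rWT 0 \<le> M' rLIM 0"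
      by (cases "M' rWT 0 \<le> M' rLIM 0") (auto simp: not_le)
    {
      assume "expr_val w M' (($rQN [-] $rQI) [div] (C 1 [-] ($rWT [-] $rLIM))) \<noteq> 0"
      then have c: "M' rQI 0 < M' rQN 0" "M' rWT 0 \<le> M rLIM 0" unfolding cnd lim' by auto
      let ?b = "b' + (1 + expr_cost (($rQN [-] $rQI) [div] (C 1 [-] ($rWT [-] $rLIM))))"
      have "wp w explore_step (step_post ?b M') ?b M'"
        using explore_step_spec[of M' ?b] ex M(1) c(1) by (simp add: res)
      then show "wp w explore_step I ?b M'"
      proof (rule wp_conseq)
        fix b2 M2 assume p: "step_post ?b M' b2 M2" and "unchanged explore_step M' M2"
        define i where "i = M' rQI 0"
        have p': "explored (res M) M2" "extends M' M2" "M2 rQI 0 = Suc i" "b2 \<le> b' + 14 + 250 + 100 * deg (M' QB i)"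
          and x: "M2 rWT 0 \<le> M rLIM 0 \<Longrightarrow> (M' QB i, x) \<in> res M \<Longrightarrow> x \<in> visited M2" for x
          using p by (simp_all add: step_post_def res i_def lim')
        have q: "M2 QB j = M' QB j" if "j \<le> i" for j
          using p'(2) that c(1) by (simp add: extends_def i_def)
        have "M2 QB ` {..<Suc i} = M' QB ` {..<Suc i}" "M2 QB ` {..<i} = M' QB ` {..<i}" using q by auto
        moreover have "inj_on (M' QB) {..i}" using inj[OF ex] c(1) by (auto simp: inj_on_def i_def)
        ultimately have v: "vol (M2 QB ` {..<Suc i}) = vol (M' QB ` {..<i}) + deg (M' QB i)"
          "vol (M2 QB ` {..<Suc i}) \<le> M' rWT 0"
          using vol_queue_Suc vq[OF ex, of "Suc i"] c(1) by (simp_all add: i_def Suc_le_eq)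
        have "x \<in> visited M2"
          if "j < Suc i" "M2 rWT 0 \<le> M rLIM 0" "(M2 QB j, x) \<in> res M" for j x
        proof (cases "j = i")
          case True
          then show ?thesis using x that q[of j] by simp
        next
          case False
          have "M' rWT 0 \<le> M2 rWT 0" using p'(2) by (simp add: extends_def)
          moreover have "j < i" using that(1) False by simp
          ultimately have "x \<in> visited M'"
            using I that(2,3) q[of j] by (simp add: I_def flip: i_def)
          then show ?thesis using extends_visited[OF p'(2)] by blast
        qed
        moreover have "Suc i \<le> M2 rQN 0" using p'(2) c(1) by (simp add: extends_def i_def)
        moreover have "b2 \<le> b + 30 + 270 * Suc i + 100 * vol (M2 QB ` {..<Suc i})"
          using I p'(4) v(1) by (simp add: I_def i_def)
        ultimately show "I b2 M2"
          using p'(1) v(2) c(2) unfolding I_def p'(3) by auto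
      qed
    next
      assume "expr_val w M' (($rQN [-] $rQI) [div] (C 1 [-] ($rWT [-] $rLIM))) = 0"
      then have c: "M' rQI 0 = M' rQN 0 \<or> M rLIM 0 < M' rWT 0"
        using cnd I unfolding lim' by (auto simp: I_def)
      let ?S = "vol (M' QB ` {..<M' rQI 0})"
      have "M' rQI 0 \<le> 1 + ?S"
        using queue_le_vol[of "M' rQN 0" "M' QB" "M' rQI 0"] explored_deg_pos[OF ex M(1)] inj[OF ex] I
        by (simp add: I_def)
      moreover have "?S \<le> min (M rLIM 0) (M' rWT 0)" using vq[OF ex] I by (simp add: I_def)
      moreover have "b' \<le> b + 30 + 270 * M' rQI 0 + 100 * ?S" using I by (simp add: I_def)
      moreover have "y + 14 \<le> b + 400 * (1 + s)"
        if "q \<le> 1 + S" "S \<le> s" "y \<le> b + 30 + 270 * q + 100 * S" for y q S s :: nat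
        using that by simp
      ultimately have "b' + 14 \<le> b + 400 * (1 + min (M rLIM 0) (M' rWT 0))" by blast
      moreover have "x \<in> visited M'"
        if "M' rWT 0 \<le> M rLIM 0" "u \<in> visited M'" "(u, x) \<in> res M" for u x
        using I c that by (auto simp: I_def)
      ultimately show "explore_post b M (b' + (1 + expr_cost (($rQN [-] $rQI) [div] (C 1 [-] ($rWT [-] $rLIM))))) M'"
        using ex by (simp add: explore_post_def)
    }
  qed
  from this[unfolded M1_def] show ?thesis
    unfolding explore_def wp_simps by (simp add: dg flip: r_def)
qed

end

section \<open>Removal of all edges across the reached set\<close>

section \<open>Deleting a cut\<close>

text \<open>The tail in direction 0 and the head in direction 1 are the only new candidates
  required, by \<open>covers_delete\<close>.\<close>

definition cut_step :: prog where
  "cut_step =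
      rE \<leftarrow> $rJ [-] C 1 ;; rX \<leftarrow> DST\<lbrakk>arc_at rE rDD\<rbrakk> ;;
      Cond (DEAD\<lbrakk>$rE\<rbrakk>) Skip
        (Cond (MB\<lbrakk>$rX\<rbrakk>) Skip
          (DEAD\<langle>$rE\<rangle> \<leftarrow> C 1 ;; rFOUND \<leftarrow> C 1 ;;
           STK\<langle>$rSP\<rangle> \<leftarrow> TAIL\<lbrakk>$rE\<rbrakk> [+] TAIL\<lbrakk>$rE\<rbrakk> ;;
           STK\<langle>$rSP [+] C 1\<rangle> \<leftarrow> HEAD\<lbrakk>$rE\<rbrakk> [+] HEAD\<lbrakk>$rE\<rbrakk> [+] C 1 ;;
           rSP \<leftarrow> $rSP [+] C 2)) ;;
      rJ \<leftarrow> NXT\<lbrakk>arc_at rE rDD\<rbrakk>"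

definition cut_scan :: prog where
  "cut_scan = While ($rJ) cut_step"

definition cut_vertex :: prog where
  "cut_vertex =
     rU \<leftarrow> QB\<lbrakk>$rQI\<rbrakk> ;;
     rDD \<leftarrow> C 0 ;; rJ \<leftarrow> FST\<lbrakk>arc_at rU rDD\<rbrakk> ;; cut_scan ;;
     rDD \<leftarrow> C 1 ;; rJ \<leftarrow> FST\<lbrakk>arc_at rU rDD\<rbrakk> ;; cut_scan ;;
     rQI \<leftarrow> $rQI [+] C 1"

definition cut :: prog where
  "cut = rQI \<leftarrow> C 0 ;; While ($rQN [-] $rQI) cut_vertex"

lemma writes_cut_scan: "writes cut_scan = {DEAD, STK, rFOUND, rSP, rE, rX, rJ}"
  by (auto simp: cut_scan_def cut_step_def)

lemma writes_cut_vertex: "writes cut_vertex = {DEAD, STK, rFOUND, rSP, rE, rX, rJ, rU, rDD, rQI}"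
  by (auto simp: cut_vertex_def writes_cut_scan)

lemma writes_cut: "writes cut = {DEAD, STK, rFOUND, rSP, rE, rX, rJ, rU, rDD, rQI}"
  by (auto simp: cut_def writes_cut_vertex)

lemma cut_scan_unfold: "wp w cut_scan Q b M \<longleftrightarrow>
    (if M rJ 0 \<noteq> 0 then wp w cut_step (wp w cut_scan Q) (b + 3) M else Q (b + 3) M)"
  unfolding cut_scan_def by (subst wp_While_unfold) (simp add: numeral_3_eq_3)

context input
begin

definition stack :: "memory \<Rightarrow> nat set" where
  "stack M = M STK ` {..<M rSP 0}"

text \<open>Deleting an edge pushes two entries, so \<open>credit\<close> is unchanged by deletions; it bounds
  the height of the stack.\<close>

definition credit :: "memory \<Rightarrow> nat" where
  "credit M = M rSP 0 + 2 * card (alive M)"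

definition pushed :: "memory \<Rightarrow> memory \<Rightarrow> bool" where
  "pushed M M' \<longleftrightarrow> M rSP 0 \<le> M' rSP 0 \<and> (\<forall>i<M rSP 0. M' STK i = M STK i) \<and> stack M' \<subseteq> {..<2 * n} \<and>
    (\<forall>a b. (a, b) \<in> alive M - alive M' \<longrightarrow> 2 * a \<in> stack M' \<and> 2 * b + 1 \<in> stack M')"

text \<open>\<open>X\<close> collects the edges scanned so far, so the relation describes a deletion
  in progress; it is complete when \<open>X\<close> contains all edges with an end in
  \<open>R\<close>.\<close>

definition cut_rel :: "nat set \<Rightarrow> nat set \<Rightarrow> memory \<Rightarrow> memory \<Rightarrow> bool" where
  "cut_rel R X M M' \<longleftrightarrow>
    (\<forall>e<m. M' DEAD e = 0 \<longleftrightarrow> M DEAD e = 0 \<and> \<not> (e \<in> X \<and> es ! e \<in> crossing R)) \<and>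
    credit M' = credit M \<and> pushed M M' \<and>
    (M' rFOUND 0 = 0 \<longleftrightarrow> M rFOUND 0 = 0 \<and> alive M' = alive M)"

lemma finite_alive [simp]: "finite (alive M)"
  using alive_subset finite_subset by blast

lemma stack_mono: "pushed M M' \<Longrightarrow> stack M \<subseteq> stack M'"
  by (auto simp: pushed_def stack_def) (metis imageI lessThan_iff order_less_le_trans)

lemma cut_rel_skip:
  assumes "cut_rel R X M0 M" "M DEAD e \<noteq> 0 \<or> es ! e \<notin> crossing R" "e < m"
    and "M' DEAD = M DEAD" "M' rSP = M rSP" "M' STK = M STK" "M' rFOUND = M rFOUND"
  shows "cut_rel R (insert e X) M0 M'"
proof -
  have "alive M' = alive M" using assms(4) by (rule alive_cong)
  moreover have "stack M' = stack M" using assms by (simp add: stack_def)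
  ultimately show ?thesis
    using assms by (auto simp: cut_rel_def credit_def pushed_def)
qed

lemma cut_rel_delete:
  assumes "cut_rel R X M0 M" "M DEAD e = 0" "es ! e \<in> crossing R" "e < m"
    and "M' DEAD = (M DEAD)(e := 1)" "M' rSP 0 = M rSP 0 + 2"
      "M' STK = (M STK)(M rSP 0 := 2 * fst (es ! e), Suc (M rSP 0) := 2 * snd (es ! e) + 1)" "M' rFOUND 0 = 1"
  shows "cut_rel R (insert e X) M0 M'"
proof -
  \<comment> \<open>By distinctness of \<open>es\<close>, no other index keeps the deleted edge
    alive.\<close>
  have inj: "es ! e' = es ! e \<longleftrightarrow> e' = e" if "e' < m" for e'
    using distinct_es assms(4) that by (simp add: m_def nth_eq_iff_index_eq)
  have e: "es ! e \<in> alive M" using assms(2,4) by (simp add: alive_nth)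
  have al: "alive M' = alive M - {es ! e}"
    by (auto simp: alive_def assms(5)) (metis inj)+
  have sub: "alive M \<subseteq> alive M0" using assms(1) by (auto simp: alive_def cut_rel_def)
  have st: "stack M' = stack M \<union> {2 * fst (es ! e), 2 * snd (es ! e) + 1}"
  proof -
    have "{..<M rSP 0 + 2} = {..<M rSP 0} \<union> {M rSP 0, Suc (M rSP 0)}" by auto
    then have "stack M' = M' STK ` {..<M rSP 0} \<union> M' STK ` {M rSP 0, Suc (M rSP 0)}"
      unfolding stack_def assms(6) by (metis image_Un)
    moreover have "M' STK ` {..<M rSP 0} = M STK ` {..<M rSP 0}" by (auto simp: assms(7))
    ultimately show ?thesis by (simp add: stack_def assms(7))
  qed
  have "card (alive M) = Suc (card (alive M - {es ! e}))"
    using e by (metis finite_alive card.remove)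
  then have "credit M' = credit M0" using assms(1,6) by (simp add: cut_rel_def credit_def al)
  moreover have "alive M' \<noteq> alive M0" using al sub e by auto
  moreover have "pushed M0 M'"
  proof -
    have "pushed M0 M" using assms(1) by (simp add: cut_rel_def)
    moreover obtain a b where ab: "es ! e = (a, b)" by (cases "es ! e")
    ultimately show ?thesis using nth_bound[OF assms(4)]
      by (auto simp: pushed_def st al assms(6,7) ab)
  qed
  moreover have "M' DEAD e' = 0 \<longleftrightarrow> M0 DEAD e' = 0 \<and> \<not> (e' \<in> insert e X \<and> es ! e' \<in> crossing R)"
    if "e' < m" for e'
    using assms(1,3,5) that by (auto simp: cut_rel_def)
  ultimately show ?thesis
    using assms(8) unfolding cut_rel_def by simp
qed

definition cut_scan_post :: "nat set \<Rightarrow> nat set \<Rightarrow> memory \<Rightarrow> nat list \<Rightarrow> nat \<Rightarrow> nat \<Rightarrow> memory \<Rightarrow> bool" where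
  "cut_scan_post R X M0 js b b' M' \<longleftrightarrow> cut_rel R (set js \<union> X) M0 M' \<and> b' \<le> b + 100 * (length js + 1)"

lemma cut_scan_spec:
  assumes "cut_rel R X M0 M" "static M" "credit M0 \<le> 6 * m" "M rDD 0 < 2"
    "linked (M NXT) (M rDD 0) (M rJ 0) js" "set js \<subseteq> set (adj (M rDD 0) u)" "u \<in> R"
    "\<And>v. M MB v = of_bool (v \<in> R)"
  shows "wp w cut_scan (cut_scan_post R X M0 js b) b M"
  using assms
proof (induction js arbitrary: b M X)
  case Nil
  then show ?case by (simp add: cut_scan_unfold cut_scan_post_def)
next
  case (Cons e js)
  define d where "d = M rDD 0"
  define x where "x = dst d (es ! e)"
  have d2: "d < 2" and st: "static M" using Cons.prems by (auto simp: d_def)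
  have em: "e < m" "src d (es ! e) = u" using Cons.prems(6) by (auto simp: set_adj d_def)
  have J: "M rJ 0 = Suc e" "linked (M NXT) d (M NXT (e + e + d)) js"
    using Cons.prems(5) by (simp_all add: d_def)
  have dst: "M DST (e + e + d) = x" using st em d2 by (simp add: static_def x_def)
  have cr: "es ! e \<in> crossing R \<longleftrightarrow> x \<notin> R"
    using em(2) Cons.prems(7) by (cases "es ! e") (auto simp: crossing_def x_def src_def dst_def split: if_splits)
  have av: "expr_val w M' (arc_at rE rDD) = e + e + d" if "M' rE 0 = e" "M' rDD 0 = d" for M'
    using arc_at_val[of M' rDD rE] that d2 em by simp
  have th: "M TAIL e = fst (es ! e)" "M HEAD e = snd (es ! e)" using st em by (simp_all add: static_def)
  note th' = th[unfolded One_nat_def]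
  have sp: "M rSP 0 \<le> 6 * m" using Cons.prems(1,3) by (simp add: cut_rel_def credit_def)
  have md: "(fst (es ! e) + fst (es ! e)) mod 2 ^ w = 2 * fst (es ! e)"
    "(snd (es ! e) + snd (es ! e)) mod 2 ^ w = 2 * snd (es ! e)"
    "Suc (2 * snd (es ! e)) mod 2 ^ w = Suc (2 * snd (es ! e))"
    "(M rSP 0 + 2) mod 2 ^ w = M rSP 0 + 2" "Suc (M rSP 0) mod 2 ^ w = Suc (M rSP 0)"
    "Suc (Suc (M rSP 0)) mod 2 ^ w = Suc (Suc (M rSP 0))"
    using nth_bound[OF em(1)] sp lim_bounds by (auto intro!: mod_word[THEN trans])
  have rest: "wp w cut_scan (cut_scan_post R X M0 (e # js) b) b2 M2"
    if M2: "cut_rel R (insert e X) M0 M2" "\<And>s. s \<notin> writes cut_scan \<Longrightarrow> M2 s = M s"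
      "M2 rJ 0 = M NXT (e + e + d)" "b2 \<le> b + 100"
    for M2 b2
  proof (rule wp_conseq)
    note M2s = M2(2)[unfolded writes_cut_scan]
    have "static M2" using st static_cong[of M2 M] by (simp add: M2s)
    then show "wp w cut_scan (cut_scan_post R (insert e X) M0 js b2) b2 M2"
      using Cons.IH[of "insert e X" M2 b2] Cons.prems M2(1,3) J(2)
      by (auto simp: M2s d_def)
    fix b' M' assume "cut_scan_post R (insert e X) M0 js b2 b' M'"
    then show "cut_scan_post R X M0 (e # js) b b' M'"
      using M2(4) by (simp add: cut_scan_post_def)
  qed
  show ?case
  proof (cases "M DEAD e = 0 \<and> x \<notin> R")
    case True
    show ?thesis
      apply (subst cut_scan_unfold)
      apply (simp add: cut_step_def wp_simps J(1) av dst th' md d_def[symmetric] True Cons.prems(8))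
      apply (intro rest cut_rel_delete[OF Cons.prems(1)])
      apply (auto simp: em True writes_cut_scan cr)
      done
  next
    case False
    then have "M DEAD e \<noteq> 0 \<or> es ! e \<notin> crossing R" by (simp add: cr)
    with False show ?thesis
      apply (subst cut_scan_unfold)
      apply (simp add: cut_step_def wp_simps J(1) av dst d_def[symmetric] Cons.prems(8))
      apply (intro conjI impI rest cut_rel_skip[OF Cons.prems(1)])
      apply (auto simp: em writes_cut_scan)
      done
  qed
qed

definition cut_post :: "nat \<Rightarrow> memory \<Rightarrow> nat \<Rightarrow> memory \<Rightarrow> bool" where
  "cut_post b M b' M' \<longleftrightarrow> alive M' = alive M - crossing (visited M) \<and> credit M' = credit M \<and>
    pushed M M' \<and> (M' rFOUND 0 = 0 \<longleftrightarrow> M rFOUND 0 = 0 \<and> alive M' = alive M) \<and>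
    b' \<le> b + 1000 * (1 + M rWT 0)"

lemma deg_eq: "deg u = length (adj 0 u) + length (adj 1 u)"
  by (simp add: deg_def)

lemma cut_spec:
  assumes M: "static M" "credit M \<le> 6 * m" "visited M \<subseteq> {..<n}" "inj_on (M QB) {..<M rQN 0}"
      "\<And>v. M MB v = of_bool (v \<in> visited M)" "M rWT 0 = vol (visited M)"
      "M rQN 0 \<le> M rWT 0 + 1" "stack M \<subseteq> {..<2 * n}"
  shows "wp w cut (cut_post b M) b M"
proof -
  define k where "k = M rQN 0"
  define q where "q = M QB"
  define R where "R = q ` {..<k}"
  define X where "X i = (\<Union>j<i. set (adj 0 (q j)) \<union> set (adj 1 (q j)))" for i
  have kn: "k \<le> n" using M(3,4) card_mono[of "{..<n}" "visited M"] by (simp add: k_def card_image)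
  define I where "I = (\<lambda>b' M'. cut_rel R (X (M' rQI 0)) M M' \<and> M' rQI 0 \<le> k \<and>
    b' \<le> b + 4 + 300 * M' rQI 0 + 100 * vol (q ` {..<M' rQI 0}))"
  have R0: "cut_rel R {} M M" using M(8) by (simp add: cut_rel_def pushed_def)
  have "wp w (While ($rQN [-] $rQI) cut_vertex) (cut_post b M) b1 (M(rQI := (M rQI)(0 := 0)))"
    if b1: "b1 \<le> b + 4" for b1
  proof (rule wp_While[where I = I and N = "b + 4 + 300 * k + 100 * vol R"])
    have "cut_rel R {} M (M(rQI := (M rQI)(0 := 0)))"
      using R0 by (simp add: cut_rel_def alive_def credit_def pushed_def stack_def)
    then show "I b1 (M(rQI := (M rQI)(0 := 0)))"
      using b1 by (simp add: I_def X_def vol_def)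
    fix b' M' assume I: "I b' M'"
    have "vol (q ` {..<M' rQI 0}) \<le> vol R"
      using I M(3) by (intro vol_mono) (auto simp: I_def R_def k_def q_def)
    then show "b' \<le> b + 4 + 300 * k + 100 * vol R" using I by (simp add: I_def)
  next
    fix b' M' assume I: "I b' M'" and "unchanged cut_vertex (M(rQI := (M rQI)(0 := 0))) M'"
    note M's = unchangedD[OF this(2), unfolded writes_cut_vertex, simplified]
    define i where "i = M' rQI 0"
    {
      assume "expr_val w M' ($rQN [-] $rQI) \<noteq> 0"
      then have ik: "i < k" by (simp add: M's i_def k_def)
      define u where "u = q i"
      have uR: "u \<in> R" using ik by (auto simp: u_def R_def)
      then have un: "u < n" using M(3) by (auto simp: R_def q_def k_def)
      have st: "static M'" using M(1) static_cong[of M' M] by (simp add: M's)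
      have av: "expr_val w M'' (arc_at rU rDD) = u + u + d" if "d < 2" "M'' rU 0 = u" "M'' rDD 0 = d" for M'' d
        using arc_at_val[of M'' rDD rU] that un by simp
      have scan: "wp w cut_scan (cut_scan_post R Y M (adj d u) b2) b2 M2"
        if "d < 2" "cut_rel R Y M M2" "\<And>s. s \<notin> writes cut_vertex - {rQI} \<Longrightarrow> M2 s = M' s" "M2 rDD 0 = d"
          "M2 rJ 0 = M' FST (u + u + d)" for d Y M2 b2
      proof (rule cut_scan_spec[where u = u])
        note M2s = that(3)[unfolded writes_cut_vertex, simplified]
        show "cut_rel R Y M M2" by (rule that(2))
        show "static M2" using st static_cong[of M2 M'] by (simp add: M2s)
        show "credit M \<le> 6 * m" by (rule M(2))
        show "M2 rDD 0 < 2" using that by simp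
        show "linked (M2 NXT) (M2 rDD 0) (M2 rJ 0) (adj d u)"
          using st un that(1) by (simp add: static_def that(4,5) M2s)
        show "set (adj d u) \<subseteq> set (adj (M2 rDD 0) u)" by (simp add: that)
        show "u \<in> R" by (rule uR)
        show "M2 MB v = of_bool (v \<in> R)" for v using M(5) by (simp add: M2s M's R_def q_def k_def)
      qed
      have rel': "cut_rel R (X i) M M2" if "M2 DEAD = M' DEAD" "M2 STK = M' STK" "M2 rSP = M' rSP" "M2 rFOUND = M' rFOUND" for M2
        using I that by (simp add: I_def cut_rel_def alive_def credit_def pushed_def stack_def i_def)
      have q2: "wp w (rQI \<leftarrow> $rQI [+] C 1) I b2 M2"
        if "cut_scan_post R (set (adj 0 u) \<union> X i) M (adj 1 u) b1 b2 M2" "M2 rQI 0 = i"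
          "b1 \<le> b' + 140 + 100 * length (adj 0 u)" for b1 b2 M2
      proof -
        have "(i + 1) mod 2 ^ w = i + 1" using ik kn lim_bounds by (intro mod_word) linarith
        then have v: "expr_val w M2 ($rQI [+] C 1) = Suc i" using that(2) by simp
        have "set (adj 1 u) \<union> (set (adj 0 u) \<union> X i) = X (Suc i)" by (auto simp: X_def lessThan_Suc u_def)
        then have "cut_rel R (X (Suc i)) M M2" using that(1) by (simp add: cut_scan_post_def)
        moreover have "inj_on q {..i}" using M(4) ik by (auto simp: inj_on_def k_def q_def)
        then have "vol (q ` {..<Suc i}) = vol (q ` {..<i}) + deg u" unfolding u_def by (rule vol_queue_Suc)
        moreover have "b2 \<le> b' + 240 + 100 * deg u"
          using that(1,3) by (simp add: cut_scan_post_def deg_eq)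
        ultimately have "I (b2 + 6) (M2(rQI := (M2 rQI)(0 := Suc i)))"
          using I ik by (simp add: I_def i_def cut_rel_def alive_def credit_def pushed_def stack_def)
        then show ?thesis unfolding wp_Assign v by (simp add: numeral_eq_Suc)
      qed
      have q1: "wp w (rDD \<leftarrow> C 1 ;; rJ \<leftarrow> FST\<lbrakk>arc_at rU rDD\<rbrakk> ;; cut_scan ;; rQI \<leftarrow> $rQI [+] C 1) I b2 M2"
        if p: "cut_scan_post R (X i) M (adj 0 u) b1 b2 M2" and M2: "\<And>s. s \<notin> writes cut_vertex - {rQI} \<Longrightarrow> M2 s = M' s"
          "M2 rU 0 = u" and b1: "b1 \<le> b' + 25" for b1 b2 M2
      proof -
        note M2s = M2(1)[unfolded writes_cut_vertex, simplified]
        have "wp w cut_scan (wp w (rQI \<leftarrow> $rQI [+] C 1) I) b3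
          (M2(rDD := (M2 rDD)(0 := Suc 0), rJ := (M2 rJ)(0 := M2 FST (u + u + Suc 0))))" (is "wp w _ _ _ ?M3")
          if "b3 \<le> b2 + 15" for b3
        proof (rule wp_conseq)
          have "cut_rel R (set (adj 0 u) \<union> X i) M ?M3"
            using p by (simp add: cut_scan_post_def cut_rel_def alive_def credit_def pushed_def stack_def)
          then show "wp w cut_scan (cut_scan_post R (set (adj 0 u) \<union> X i) M (adj 1 u) b3) b3 ?M3"
            by (rule scan[rotated]) (auto simp: M2s writes_cut_vertex)
          fix b4 M4 assume p4: "cut_scan_post R (set (adj 0 u) \<union> X i) M (adj 1 u) b3 b4 M4"
            and "unchanged cut_scan ?M3 M4"
          note M4s = unchangedD[OF this(2), unfolded writes_cut_scan, simplified]
          show "wp w (rQI \<leftarrow> $rQI [+] C 1) I b4 M4"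
            by (rule q2[OF p4]) (use p b1 that in \<open>auto simp: M4s M2s i_def cut_scan_post_def\<close>)
        qed
        then show ?thesis
          using av[of 1 "M2(rDD := (M2 rDD)(0 := Suc 0))"] by (simp add: wp_Seq wp_Assign M2(2))
      qed
      have "wp w cut_scan (wp w (rDD \<leftarrow> C 1 ;; rJ \<leftarrow> FST\<lbrakk>arc_at rU rDD\<rbrakk> ;; cut_scan ;; rQI \<leftarrow> $rQI [+] C 1) I) b3
          (M'(rU := (M' rU)(0 := u), rDD := (M' rDD)(0 := 0), rJ := (M' rJ)(0 := M' FST (u + u))))" (is "wp w _ _ _ ?M3")
          if "b3 \<le> b' + 25" for b3
      proof (rule wp_conseq)
        have "cut_rel R (X i) M ?M3" by (rule rel') simp_all
        then show "wp w cut_scan (cut_scan_post R (X i) M (adj 0 u) b3) b3 ?M3"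
          by (rule scan[rotated]) (auto simp: writes_cut_vertex)
        fix b4 M4 assume p4: "cut_scan_post R (X i) M (adj 0 u) b3 b4 M4"
          and "unchanged cut_scan ?M3 M4"
        note M4s = unchangedD[OF this(2), unfolded writes_cut_scan, simplified]
        show "wp w (rDD \<leftarrow> C 1 ;; rJ \<leftarrow> FST\<lbrakk>arc_at rU rDD\<rbrakk> ;; cut_scan ;; rQI \<leftarrow> $rQI [+] C 1) I b4 M4"
          by (rule q1[OF p4]) (use that in \<open>auto simp: M4s writes_cut_vertex\<close>)
      qed
      moreover have "M' QB (M' rQI 0) = u" by (simp add: u_def q_def M's i_def)
      ultimately show "wp w cut_vertex I (b' + (1 + expr_cost ($rQN [-] $rQI))) M'"
        using av[of 0 "M'(rU := (M' rU)(0 := u), rDD := (M' rDD)(0 := 0))"]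
        unfolding cut_vertex_def wp_Seq wp_Assign by simp
    next
      assume "expr_val w M' ($rQN [-] $rQI) = 0"
      then have ik: "i = k" using I by (simp add: M's i_def k_def I_def)
      have al: "alive M' = alive M - crossing R"
      proof -
        have "e \<in> X k" if "e < m" "es ! e \<in> crossing R" for e
        proof -
          have "fst (es ! e) \<in> R \<or> snd (es ! e) \<in> R" using that(2) by (cases "es ! e") (auto simp: crossing_def)
          then show ?thesis using that(1) by (auto simp: X_def R_def set_adj src_def)
        qed
        then have "M' DEAD e = 0 \<longleftrightarrow> M DEAD e = 0 \<and> es ! e \<notin> crossing R" if "e < m" for e
          using I that ik by (auto simp: I_def cut_rel_def i_def)
        then show ?thesis by (auto simp: alive_def)
      qed
      have "k \<le> vol R + 1" "M rWT 0 = vol R" using M(6,7) by (simp_all add: k_def R_def q_def)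
      then have "b' + 6 \<le> b + 1000 * (1 + M rWT 0)"
        using I ik by (simp add: I_def i_def R_def)
      then show "cut_post b M (b' + (1 + expr_cost ($rQN [-] $rQI))) M'"
        using I al by (simp add: cut_post_def I_def cut_rel_def R_def q_def k_def)
    }
  qed
  then show ?thesis unfolding cut_def wp_simps by simp
qed

end

section \<open>One test: path marks, residual search, deletion and clean-up\<close>

section \<open>Residual search\<close>

definition mark_step :: "nat \<Rightarrow> prog" where
  "mark_step c = ONP\<langle>$rZ\<rangle> \<leftarrow> C c ;; rZ \<leftarrow> PA\<lbrakk>$rZ\<rbrakk>"

text \<open>Subtraction is truncated, so the sum of both differences is nonzero iff the two
  registers differ.\<close>

definition mark_loop :: "nat \<Rightarrow> prog" where
  "mark_loop c = While (($rZ [-] $rROOT) [+] ($rROOT [-] $rZ)) (mark_step c)"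

text \<open>With argument 1 the path is marked, with 0 the marks are erased. Erasing along the path,
  as \<open>clear\<close> does along the queue, keeps the cost of a test within the limit instead of
  order \<open>n\<close>.\<close>

definition mark :: "nat \<Rightarrow> prog" where
  "mark c = rZ \<leftarrow> $rV ;; mark_loop c"

definition clear_step :: prog where
  "clear_step = MB\<langle>QB\<lbrakk>$rQI\<rbrakk>\<rangle> \<leftarrow> C 0 ;; rQI \<leftarrow> $rQI [+] C 1"

definition clear :: prog where
  "clear = rQI \<leftarrow> C 0 ;; While ($rQN [-] $rQI) clear_step"

definition copy_step :: prog where
  "copy_step = rV \<leftarrow> QB\<lbrakk>$rI\<rbrakk> ;; QA\<langle>$rI\<rangle> \<leftarrow> $rV ;; PA\<langle>$rV\<rangle> \<leftarrow> PB\<lbrakk>$rV\<rbrakk> ;;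
     ACC\<langle>$rV\<rangle> \<leftarrow> DEG\<lbrakk>$rV\<rbrakk> ;; MB\<langle>$rV\<rangle> \<leftarrow> C 0 ;; rI \<leftarrow> $rI [+] C 1"

text \<open>Residual searches reuse \<open>QB\<close>, \<open>PB\<close> and \<open>MB\<close>, so
  the tree is saved and its marks are erased on the way. \<open>ACC\<close> starts with the weights
  that \<open>search_step\<close> accumulates.\<close>

definition copy :: prog where
  "copy = rI \<leftarrow> C 0 ;; While ($rQN [-] $rI) copy_step"

definition test :: prog where
  "test = mark 1 ;; explore ;; Cond ($rWT [-] $rLIM) Skip cut ;; clear ;; mark 0"

lemma writes_mark: "writes (mark c) = {ONP, rZ}"
  by (auto simp: mark_def mark_loop_def mark_step_def)

lemma writes_clear_step: "writes clear_step = {MB, rQI}"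
  by (auto simp: clear_step_def)

lemma writes_clear: "writes clear = {MB, rQI}"
  by (auto simp: clear_def clear_step_def)

lemma writes_copy_step: "writes copy_step = {QA, PA, ACC, MB, rV, rI}"
  by (auto simp: copy_step_def)

lemma writes_copy: "writes copy = {QA, PA, ACC, MB, rV, rI}"
  by (auto simp: copy_def copy_step_def)

lemma writes_test: "writes test = {ONP, rZ, MB, QB, PB, rQN, rWT, rE, rX, rJ, rU, rQI, DEAD, STK, rFOUND, rSP, rDD}"
  by (auto simp: test_def writes_mark writes_explore writes_cut writes_clear)

lemma mark_loop_unfold: "wp w (mark_loop c) Q b M \<longleftrightarrow>
    (if expr_val w M (($rZ [-] $rROOT) [+] ($rROOT [-] $rZ)) \<noteq> 0
     then wp w (mark_step c) (wp w (mark_loop c) Q) (b + 12) M else Q (b + 12) M)"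
  unfolding mark_loop_def by (subst wp_While_unfold) (simp add: numeral_eq_Suc)

lemma tree_path_root:
  assumes "par (q 0) = q 0"
  shows "tree_path q par (q 0) = {}"
proof -
  have "(par ^^ i) (q 0) = q 0" for i by (induction i) (simp_all add: assms)
  then show ?thesis by (auto simp: tree_path_def)
qed

lemma tree_path_step:
  assumes "z \<noteq> q 0"
  shows "tree_path q par z = insert z (tree_path q par (par z))"
proof -
  have "{(par ^^ i) z | i. True} = insert z {(par ^^ i) (par z) | i. True}"
  proof (intro equalityI subsetI)
    fix y assume "y \<in> {(par ^^ i) z | i. True}"
    then obtain i where "y = (par ^^ i) z" by blast
    then show "y \<in> insert z {(par ^^ i) (par z) | i. True}"
      by (cases i) (auto simp: funpow_swap1)
  next
    fix y assume "y \<in> insert z {(par ^^ i) (par z) | i. True}"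
    then consider "y = z" | i where "y = (par ^^ i) (par z)" by blast
    then show "y \<in> {(par ^^ i) z | i. True}"
    proof cases
      case 1
      then have "y = (par ^^ 0) z" by simp
      then show ?thesis by blast
    next
      case 2
      then have "y = (par ^^ Suc i) z" by (simp add: funpow_swap1)
      then show ?thesis by blast
    qed
  qed
  then show ?thesis using assms by (auto simp: tree_path_def)
qed

lemma tree_path_edge:
  assumes "tree E q k par" "p < k" "v \<in> tree_path q par (q p)"
  shows "(par v, v) \<in> E" "v \<in> q ` {..<k}"
proof -
  obtain i where i: "v = (par ^^ i) (q p)" "v \<noteq> q 0" using assms(3) by (auto simp: tree_path_def)
  obtain p' where p': "p' \<le> p - i" "v = q p'" using tree_anc[OF assms(1,2)] i(1) by metis
  then have "p' < k" "0 < p'" using assms(2) i(2) by (auto intro: gr0I)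
  then show "(par v, v) \<in> E" "v \<in> q ` {..<k}" using assms(1) p'(2) unfolding tree_def by auto
qed

lemma weak_comp_refl [simp]: "v \<in> weak_comp E v"
  by (simp add: weak_comp_def)

lemma weak_comp_closed: "u \<in> weak_comp E v \<Longrightarrow> (u, x) \<in> E \<or> (x, u) \<in> E \<Longrightarrow> x \<in> weak_comp E v"
  unfolding weak_comp_def by (auto intro: rtrancl_into_rtrancl)

lemma weak_comp_least:
  assumes "v \<in> R" "E \<inter> crossing R = {}"
  shows "weak_comp E v \<subseteq> R"
proof
  fix x assume "x \<in> weak_comp E v"
  then have "(v, x) \<in> (E \<union> E\<inverse>)\<^sup>*" by (simp add: weak_comp_def)
  then show "x \<in> R"
  proof (induction rule: rtrancl_induct)
    case (step y z)
    then show ?case using assms(2) by (auto simp: crossing_def)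
  qed (rule assms(1))
qed

lemma weak_comp_dir_closed: "u \<in> weak_comp E v \<Longrightarrow> (u, x) \<in> dir_rel d E \<or> (x, u) \<in> dir_rel d E \<Longrightarrow> x \<in> weak_comp E v"
  using weak_comp_closed[of u E v x] by (auto simp: dir_rel_def split: if_splits)

lemma resid_no_path [simp]: "resid E {} par = E"
  by (auto simp: resid_def)

context input
begin

lemma mark_loop_spec:
  assumes "tree E (M QA) k (M PA)" "M rROOT 0 = M QA 0" "M QA ` {..<k} \<subseteq> {..<n}" "p < k" "M rZ 0 = M QA p" "c < 2"
  shows "wp w (mark_loop c) (\<lambda>b' M'. M' ONP = (\<lambda>v. if v \<in> tree_path (M QA) (M PA) (M QA p) then c else M ONP v) \<and>
    b' \<le> b + 30 * (p + 1)) b M"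
  using assms(1-5)
proof (induction p arbitrary: b M rule: less_induct)
  case (less p)
  have zn: "M rZ 0 < n" "M rROOT 0 < n"
    using less.prems(2-5) by (auto simp: image_subset_iff)
  have "(M rZ 0 - M rROOT 0) + (M rROOT 0 - M rZ 0) \<le> 100 * lim" using zn lim_bounds by linarith
  then have ev: "expr_val w M (($rZ [-] $rROOT) [+] ($rROOT [-] $rZ)) = (M rZ 0 - M rROOT 0) + (M rROOT 0 - M rZ 0)"
    by (simp add: mod_word)
  have cm: "c mod 2 ^ w = c" using \<open>c < 2\<close> by (auto simp: less_2_cases_iff)
  have inj: "M QA i = M QA j \<longleftrightarrow> i = j" if "i < k" "j < k" for i j
    using less.prems(1) that by (auto simp: tree_def inj_on_def)
  show ?case
  proof (cases "p = 0")
    case True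
    then have "M rZ 0 = M rROOT 0" using less.prems by simp
    moreover have "tree_path (M QA) (M PA) (M QA p) = {}"
      using True less.prems(1) by (simp add: tree_path_root tree_def)
    ultimately show ?thesis by (subst mark_loop_unfold) (simp add: ev)
  next
    case False
    then have ne: "M QA p \<noteq> M QA 0" using inj less.prems(4) by auto
    obtain j where j: "j < p" "M PA (M QA p) = M QA j"
      using less.prems(1,4) False unfolding tree_def by blast
    define M1 where "M1 = M(ONP := (M ONP)(M QA p := c), rZ := (M rZ)(0 := M QA j))"
    have "wp w (mark_loop c) (\<lambda>b' M'. M' ONP = (\<lambda>v. if v \<in> tree_path (M1 QA) (M1 PA) (M1 QA j) then c else M1 ONP v) \<and>
      b' \<le> b1 + 30 * (j + 1)) b1 M1" for b1
      using less.prems j by (intro less.IH) (auto simp: M1_def)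
    then have "wp w (mark_loop c) (\<lambda>b' M'. M' ONP = (\<lambda>v. if v \<in> tree_path (M QA) (M PA) (M QA p) then c else M ONP v) \<and>
      b' \<le> b + 30 * (p + 1)) b1 M1" if "b1 \<le> b + 25" for b1
      by (rule wp_conseq) (use j(1) that in \<open>auto simp: M1_def tree_path_step[where q = "M QA" and z = "M QA p", OF ne] j(2) fun_eq_iff\<close>)
    moreover have "expr_val w M (($rZ [-] $rROOT) [+] ($rROOT [-] $rZ)) \<noteq> 0"
      unfolding ev using ne less.prems(2,5) by linarith
    ultimately show ?thesis
      using less.prems(5) unfolding M1_def
      by (subst mark_loop_unfold, subst if_P) (simp_all add: mark_step_def wp_simps cm j(2))
  qed
qed

lemma mark_spec:
  assumes "tree E (M QA) k (M PA)" "M rROOT 0 = M QA 0" "M QA ` {..<k} \<subseteq> {..<n}" "M rV 0 \<in> M QA ` {..<k}" "c < 2"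
  shows "wp w (mark c) (\<lambda>b' M'. M' ONP = (\<lambda>v. if v \<in> tree_path (M QA) (M PA) (M rV 0) then c else M ONP v) \<and>
    b' \<le> b + 5 + 30 * k) b M"
proof -
  obtain p where p: "p < k" "M rV 0 = M QA p" using assms(4) by auto
  have "wp w (mark_loop c) (\<lambda>b' M'. M' ONP = (\<lambda>v. if v \<in> tree_path (M QA) (M PA) (M rV 0) then c else M ONP v) \<and>
    b' \<le> b + 5 + 30 * k) b1 (M(rZ := (M rZ)(0 := M QA p)))" if "b1 \<le> b + 5" for b1
    by (rule wp_conseq[OF mark_loop_spec[where p = p and k = k and E = E]])
       (use assms p that in auto)
  then show ?thesis by (simp add: mark_def wp_simps p(2))
qed

lemma clear_spec:
  assumes "\<And>v. M MB v = of_bool (v \<in> visited M)" "M rQN 0 \<le> n"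
  shows "wp w clear (\<lambda>b' M'. (\<forall>v. M' MB v = 0) \<and> b' \<le> b + 10 + 30 * M rQN 0) b M"
proof -
  define q where "q = M QB"
  define k where "k = M rQN 0"
  define I where "I = (\<lambda>b' M'. M' rQI 0 \<le> k \<and> (\<forall>v. v \<notin> q ` {M' rQI 0..<k} \<longrightarrow> M' MB v = 0) \<and>
    b' \<le> b + 4 + 30 * M' rQI 0)"
  have "wp w (While ($rQN [-] $rQI) clear_step) (\<lambda>b' M'. (\<forall>v. M' MB v = 0) \<and> b' \<le> b + 10 + 30 * M rQN 0) b1
    (M(rQI := (M rQI)(0 := 0)))" if "b1 \<le> b + 4" for b1
  proof (rule wp_While[where I = I and N = "b + 4 + 30 * k"])
    show "I b1 (M(rQI := (M rQI)(0 := 0)))"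
      using that assms(1) by (auto simp: I_def k_def q_def atLeast0LessThan)
    show "b' \<le> b + 4 + 30 * k" if "I b' M'" for b' M' using that by (simp add: I_def)
    fix b' M' assume I: "I b' M'" and "unchanged clear_step (M(rQI := (M rQI)(0 := 0))) M'"
    note M's = unchangedD[OF this(2), unfolded writes_clear_step, simplified]
    define i where "i = M' rQI 0"
    {
      assume "expr_val w M' ($rQN [-] $rQI) \<noteq> 0"
      then have ik: "i < k" by (simp add: M's k_def i_def)
      have "Suc i mod 2 ^ w = Suc i" using ik assms(2) lim_bounds by (intro mod_word) (simp add: k_def)
      moreover have "{i..<k} = insert i {Suc i..<k}" using ik by auto
      ultimately show "wp w clear_step I (b' + (1 + expr_cost ($rQN [-] $rQI))) M'"
        using I ik by (auto simp: clear_step_def wp_simps I_def M's q_def[symmetric] i_def[symmetric])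
    next
      assume "expr_val w M' ($rQN [-] $rQI) = 0"
      then have "i = k" using I by (simp add: M's k_def i_def I_def)
      then show "(\<forall>v. M' MB v = 0) \<and> b' + (1 + expr_cost ($rQN [-] $rQI)) \<le> b + 10 + 30 * M rQN 0"
        using I by (simp add: I_def i_def k_def)
    }
  qed
  then show ?thesis by (simp add: clear_def wp_simps)
qed

lemma copy_spec:
  assumes "\<And>v. M MB v = of_bool (v \<in> visited M)" "M rQN 0 \<le> n" "static M"
    "visited M \<subseteq> {..<n}"
  shows "wp w copy (\<lambda>b' M'. (\<forall>v. M' MB v = 0) \<and> (\<forall>i<M rQN 0. M' QA i = M QB i \<and>
    M' PA (M QB i) = M PB (M QB i) \<and> M' ACC (M QB i) = deg (M QB i)) \<and> b' \<le> b + 10 + 60 * M rQN 0) b M"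
proof -
  define q where "q = M QB"
  define k where "k = M rQN 0"
  define I where "I = (\<lambda>b' M'. M' rI 0 \<le> k \<and> (\<forall>v. v \<notin> q ` {M' rI 0..<k} \<longrightarrow> M' MB v = 0) \<and>
    (\<forall>i<M' rI 0. M' QA i = q i \<and> M' PA (q i) = M PB (q i) \<and> M' ACC (q i) = deg (q i)) \<and>
    b' \<le> b + 4 + 60 * M' rI 0)"
  have "wp w (While ($rQN [-] $rI) copy_step) (\<lambda>b' M'. (\<forall>v. M' MB v = 0) \<and> (\<forall>i<M rQN 0. M' QA i = M QB i \<and>
    M' PA (M QB i) = M PB (M QB i) \<and> M' ACC (M QB i) = deg (M QB i)) \<and> b' \<le> b + 10 + 60 * M rQN 0) b1
    (M(rI := (M rI)(0 := 0)))" if "b1 \<le> b + 4" for b1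
  proof (rule wp_While[where I = I and N = "b + 4 + 60 * k"])
    show "I b1 (M(rI := (M rI)(0 := 0)))"
      using that assms(1) by (auto simp: I_def k_def q_def atLeast0LessThan)
    show "b' \<le> b + 4 + 60 * k" if "I b' M'" for b' M' using that by (simp add: I_def)
    fix b' M' assume I: "I b' M'" and "unchanged copy_step (M(rI := (M rI)(0 := 0))) M'"
    note M's = unchangedD[OF this(2), unfolded writes_copy_step, simplified]
    define i where "i = M' rI 0"
    {
      assume "expr_val w M' ($rQN [-] $rI) \<noteq> 0"
      then have ik: "i < k" by (simp add: M's k_def i_def)
      have "Suc i mod 2 ^ w = Suc i" using ik assms(2) lim_bounds by (intro mod_word) (simp add: k_def)
      moreover have "{i..<k} = insert i {Suc i..<k}" using ik by auto
      moreover have "q i < n" using assms(4) ik by (auto simp: q_def k_def)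
      then have "M DEG (q i) = deg (q i)" using assms(3) by (simp add: static_def)
      ultimately show "wp w copy_step I (b' + (1 + expr_cost ($rQN [-] $rI))) M'"
        using I ik by (auto simp: copy_step_def wp_simps I_def M's q_def[symmetric] i_def[symmetric] less_Suc_eq)
    next
      assume "expr_val w M' ($rQN [-] $rI) = 0"
      then have "i = k" using I by (simp add: M's k_def i_def I_def)
      then show "(\<forall>v. M' MB v = 0) \<and> (\<forall>i<M rQN 0. M' QA i = M QB i \<and>
        M' PA (M QB i) = M PB (M QB i) \<and> M' ACC (M QB i) = deg (M QB i)) \<and>
        b' + (1 + expr_cost ($rQN [-] $rI)) \<le> b + 10 + 60 * M rQN 0"
        using I by (simp add: I_def i_def k_def q_def)
    }
  qed
  then show ?thesis by (simp add: copy_def wp_simps)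
qed

text \<open>A search deletes the edges across at most one set. The witness \<open>R\<close> is
  requested in every case; if nothing is deleted, the weak component qualifies, being left by no
  edge.\<close>

definition outcome :: "memory \<Rightarrow> memory \<Rightarrow> bool" where
  "outcome M M' \<longleftrightarrow> credit M' = credit M \<and> pushed M M' \<and>
    (M' rFOUND 0 = 0 \<longleftrightarrow> alive M' = alive M) \<and>
    (\<exists>R. R \<subseteq> weak_comp (alive M) (M rROOT 0) \<and> M rROOT 0 \<in> R \<and> one_out (dir_rel (M rD 0) (alive M)) R \<and>
      (alive M' = alive M \<or> alive M' = alive M - crossing R))"

definition searching :: "memory \<Rightarrow> bool" where
  "searching M \<longleftrightarrow> static M \<and> M rD 0 < 2 \<and> (\<forall>v. M ONP v = 0) \<and> (\<forall>v. M MB v = 0) \<and>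
    tree (dir_rel (M rD 0) (alive M)) (M QA) (M rAN 0) (M PA) \<and> M QA 0 = M rROOT 0 \<and>
    M QA ` {..<M rAN 0} \<subseteq> {..<n} \<and> credit M \<le> 6 * m \<and> stack M \<subseteq> {..<2 * n} \<and> M rAN 0 \<le> M rLIM 0 + 2"

definition test_post :: "nat \<Rightarrow> memory \<Rightarrow> nat \<Rightarrow> memory \<Rightarrow> bool" where
  "test_post b M b' M' \<longleftrightarrow> outcome M M' \<and> (\<forall>v. M' ONP v = 0) \<and> (\<forall>v. M' MB v = 0) \<and>
    b' \<le> b + 4000 * (1 + M rLIM 0) \<and>
    (M' rFOUND 0 = 0 \<longrightarrow> (\<forall>S. M rROOT 0 \<in> S \<longrightarrow> S \<subseteq> {..<n} \<longrightarrow>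
      (\<forall>u x. u \<in> S \<longrightarrow> (u, x) \<in> resid (dir_rel (M rD 0) (alive M)) (tree_path (M QA) (M PA) (M rV 0)) (M PA) \<longrightarrow> x \<in> S) \<longrightarrow>
      vol S \<le> M rLIM 0 \<longrightarrow> weak_comp (alive M) (M rROOT 0) \<subseteq> S))"

text \<open>For the last part of \<open>test_post\<close>: the residual search stays inside every
  closed set \<open>S\<close> around the root, so a light \<open>S\<close> lets it finish, and the
  edges across the reached set are deleted. If there were none, the reached set contains the weak
  component, and so does \<open>S\<close>.\<close>

lemma test_spec:
  assumes M: "searching M" "M rFOUND 0 = 0" "M rV 0 \<in> M QA ` {..<M rAN 0}"
  shows "wp w test (test_post b M) b M"
proof -
  define E where "E = dir_rel (M rD 0) (alive M)"
  define P where "P = tree_path (M QA) (M PA) (M rV 0)"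
  define k where "k = M rAN 0"
  define r where "r = M rROOT 0"
  define G where "G = resid E P (M PA)"
  have t: "tree E (M QA) k (M PA)" and q0: "M QA 0 = r" and qn: "M QA ` {..<k} \<subseteq> {..<n}"
    and st: "static M" and d2: "M rD 0 < 2" and kl: "k \<le> M rLIM 0 + 2"
    and onp: "\<And>v. M ONP v = 0" and mb: "\<And>v. M MB v = 0"
    and cm: "credit M \<le> 6 * m" "stack M \<subseteq> {..<2 * n}"
    using M(1) by (simp_all add: searching_def E_def k_def r_def)
  have k0: "0 < k" and rn: "r < n" using t qn q0 by (auto simp: tree_def)
  obtain p where p: "p < k" "M rV 0 = M QA p" using M(3) by (auto simp: k_def)
  have Pe: "(M PA v, v) \<in> E" if "v \<in> P" for v
    using tree_path_edge[OF t p(1)] that by (simp add: P_def p(2))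
  have mk: "wp w (mark c) (\<lambda>b' M'. M' ONP = (\<lambda>v. if v \<in> P then c else M1 ONP v) \<and> b' \<le> b1 + 5 + 30 * k) b1 M1"
    if "c < 2" "M1 QA = M QA" "M1 PA = M PA" "M1 rROOT = M rROOT" "M1 rV = M rV" for c b1 M1
    using mark_spec[of E M1 k c b1] t q0 qn M(3) that by (simp add: r_def k_def P_def)
  show ?thesis
    unfolding test_def wp_Seq
  proof (rule wp_conseq[OF mk])
    fix b1 M1 assume 1: "M1 ONP = (\<lambda>v. if v \<in> P then 1 else M ONP v) \<and> b1 \<le> b + 5 + 30 * k"
      and "unchanged (mark 1) M M1"
    note M1s = unchangedD[OF this(2), unfolded writes_mark, simplified]
    have al1: "alive M1 = alive M" by (rule alive_cong) (simp add: M1s)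
    have onp1: "{v. M1 ONP v \<noteq> 0} = P" using 1 onp by auto
    have res1: "res M1 = G"
      unfolding res_def onp1 al1 G_def E_def by (simp add: M1s)
    have st1: "static M1" using st static_cong[of M1 M] by (simp add: M1s)
    have ready1: "ready M1"
      using st1 d2 Pe 1 onp by (auto simp: ready_def M1s al1 E_def)
    have "wp w explore (explore_post b1 M1) b1 M1"
      using ready1 rn mb by (intro explore_spec) (auto simp: M1s r_def)
    then show "wp w explore (wp w (Cond ($rWT [-] $rLIM) Skip cut) (wp w clear (wp w (mark 0) (test_post b M)))) b1 M1"
    proof (rule wp_conseq)
      fix b2 M2 assume 2: "explore_post b1 M1 b2 M2" and "unchanged explore M1 M2"
      note M2s = unchangedD[OF this(2), unfolded writes_explore, simplified]
      define R where "R = visited M2"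
      have ex: "explored G M2" using 2 by (simp add: explore_post_def res1)
      have R: "R \<subseteq> {..<n}" "r \<in> R" "M2 QB 0 = r" "M2 rWT 0 = vol R" "M2 rQN 0 \<le> M rLIM 0 + 2"
        "\<And>v. M2 MB v = of_bool (v \<in> R)" "tree G (M2 QB) (M2 rQN 0) (M2 PB)"
      proof -
        have "0 < M2 rQN 0" using ex by (simp add: explored_def tree_def)
        then have "M2 QB 0 \<in> R" unfolding R_def by blast
        then show "R \<subseteq> {..<n}" "r \<in> R" "M2 QB 0 = r" "M2 rWT 0 = vol R" "M2 rQN 0 \<le> M rLIM 0 + 2"
          "\<And>v. M2 MB v = of_bool (v \<in> R)" "tree G (M2 QB) (M2 rQN 0) (M2 PB)"
          using ex by (simp_all add: explored_def R_def M2s M1s r_def)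
      qed
      have QNn: "M2 rQN 0 \<le> n" using explored_QN_le[OF ex] .
      have Rw: "R \<subseteq> weak_comp (alive M) r"
      proof -
        have "x \<in> weak_comp (alive M) r" if "u \<in> weak_comp (alive M) r" "(u, x) \<in> G" for u x
        proof -
          have "(u, x) \<in> E \<or> (x, u) \<in> E" using that(2) Pe by (auto simp: G_def resid_def)
          then show ?thesis unfolding E_def by (rule weak_comp_dir_closed[OF that(1)])
        qed
        then have "M2 QB i \<in> weak_comp (alive M) r" if "i < M2 rQN 0" for i
          using tree_subset[OF R(7) _ _ that] R(3) by simp
        then show ?thesis by (auto simp: R_def)
      qed
      have al2: "alive M2 = alive M" using alive_cong[of M2 M1] by (simp add: M2s al1)
      have b2: "b2 \<le> b + 5 + 30 * k + 400 * (1 + M rLIM 0)"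
        using 2 1 by (simp add: explore_post_def M1s min_def split: if_splits)
      have clos: "x \<in> R" if "vol R \<le> M rLIM 0" "u \<in> R" "(u, x) \<in> G" for u x
        using 2 that R(4) by (auto simp: explore_post_def R_def res1 M1s)
      have Rs: "R \<subseteq> S" if "r \<in> S" "\<forall>u x. u \<in> S \<longrightarrow> (u, x) \<in> G \<longrightarrow> x \<in> S" for S
        using tree_subset[OF R(7), of S] that R(3) by (auto simp: R_def)
      \<comment> \<open>The clean-up is the same whether the search overran the limit or a deletion
        was attempted; \<open>nf\<close> records what an unsuccessful attempt proves.\<close>
      have fin: "wp w clear (wp w (mark 0) (test_post b M)) b3 M3"
        if M3s: "\<And>s. s \<notin> writes cut \<Longrightarrow> M3 s = M2 s" and b3: "b3 \<le> b2 + 10 + 1000 * (1 + M rLIM 0)"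
          and oc: "outcome M M3"
          and nf: "M3 rFOUND 0 = 0 \<Longrightarrow> vol R \<le> M rLIM 0 \<Longrightarrow> alive M \<inter> crossing R = {}"
        for b3 M3
      proof (rule wp_conseq[OF clear_spec])
        note M3s = M3s[unfolded writes_cut, simplified]
        show "M3 MB v = of_bool (v \<in> visited M3)" for v using R(6) by (simp add: M3s R_def)
        show "M3 rQN 0 \<le> n" using QNn by (simp add: M3s)
        fix b4 M4 assume 4: "(\<forall>v. M4 MB v = 0) \<and> b4 \<le> b3 + 10 + 30 * M3 rQN 0" and "unchanged clear M3 M4"
        note M4s = unchangedD[OF this(2), unfolded writes_clear, simplified]
        show "wp w (mark 0) (test_post b M) b4 M4"
        proof (rule wp_conseq[OF mk])
          fix b5 M5 assume 5: "M5 ONP = (\<lambda>v. if v \<in> P then 0 else M4 ONP v) \<and> b5 \<le> b4 + 5 + 30 * k"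
            and "unchanged (mark 0) M4 M5"
          note M5s = unchangedD[OF this(2), unfolded writes_mark, simplified]
          have al5: "alive M5 = alive M3" by (rule alive_cong) (simp add: M5s M4s)
          have "outcome M M5"
            using oc by (simp add: outcome_def credit_def pushed_def stack_def al5 M5s M4s)
          moreover have "M5 ONP v = 0" for v using 5 1 onp by (simp add: M4s M3s M2s)
          moreover have "M5 MB v = 0" for v using 4 by (simp add: M5s)
          moreover have "b5 \<le> b + 4000 * (1 + M rLIM 0)"
            using 5 4 b3 b2 kl R(5) by (simp add: M3s)
          moreover have "weak_comp (alive M) r \<subseteq> S"
            if "M5 rFOUND 0 = 0" "r \<in> S" "S \<subseteq> {..<n}" "\<forall>u x. u \<in> S \<longrightarrow> (u, x) \<in> G \<longrightarrow> x \<in> S" "vol S \<le> M rLIM 0" for S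
          proof -
            have "R \<subseteq> S" using Rs that(2,4) by blast
            then have "vol R \<le> M rLIM 0" using vol_mono[OF _ that(3)] that(5) by (meson le_trans)
            then have "alive M \<inter> crossing R = {}" using nf that(1) by (simp add: M5s M4s)
            then show ?thesis using weak_comp_least[OF R(2)] \<open>R \<subseteq> S\<close> by blast
          qed
          ultimately show "test_post b M b5 M5"
            unfolding test_post_def r_def[symmetric] G_def[unfolded E_def P_def, symmetric] by blast
        qed (simp_all add: M4s M3s M2s M1s)
      qed
      have oc: "outcome M M3"
        if "credit M3 = credit M2" "pushed M2 M3" "M3 rFOUND 0 = 0 \<longleftrightarrow> alive M3 = alive M"
          "alive M3 = alive M \<or> (alive M3 = alive M - crossing R \<and> vol R \<le> M rLIM 0)" for M3
      proof -
        have "credit M3 = credit M" "pushed M M3"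
          using that(1,2) by (simp_all add: credit_def pushed_def stack_def M2s M1s al2)
        moreover have "\<exists>R. R \<subseteq> weak_comp (alive M) r \<and> r \<in> R \<and> one_out E R \<and>
          (alive M3 = alive M \<or> alive M3 = alive M - crossing R)"
        proof (cases "alive M3 = alive M")
          case True
          have "b \<in> weak_comp (alive M) r" if "(a, b) \<in> E" "a \<in> weak_comp (alive M) r" for a b
            using weak_comp_dir_closed[OF that(2)] that(1) unfolding E_def by blast
          then have "one_out E (weak_comp (alive M) r)" unfolding one_out_def by blast
          then show ?thesis using True by (intro exI[of _ "weak_comp (alive M) r"]) simp
        next
          case False
          then have "vol R \<le> M rLIM 0" using that(4) by blast
          note clos = clos[OF this]
          have "one_out E R"
          proof (rule resid_closed_one_out)
            show "P = tree_path (M QA) (M PA) (M rV 0)" by (rule P_def)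
            show "M PA (M QA 0) = M QA 0" using t by (simp add: tree_def)
            show "M QA 0 \<in> R" using R(2) q0 by simp
            show "x \<in> R" if "u \<in> R" "(u, x) \<in> resid E P (M PA)" for u x
              using clos[OF that(1)] that(2) by (simp only: G_def)
          qed
          then show ?thesis using False that(4) Rw R(2) by blast
        qed
        ultimately show ?thesis using that(3) by (simp add: outcome_def r_def E_def)
      qed
      have found2: "M2 rFOUND 0 = 0" using M(2) by (simp add: M2s M1s)
      have st2: "static M2" using st1 static_cong[of M2 M1] by (simp add: M2s)
      show "wp w (Cond ($rWT [-] $rLIM) Skip cut) (wp w clear (wp w (mark 0) (test_post b M))) b2 M2"
      proof (cases "M2 rWT 0 \<le> M rLIM 0")
        case False
        have "outcome M M2"
          using oc[of M2] cm(2) found2 al2 by (simp add: pushed_def stack_def M2s M1s)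
        then show ?thesis
          using False by (simp add: wp_simps M2s M1s, intro fin) (auto simp: R(4))
      next
        case True
        have "wp w cut (wp w clear (wp w (mark 0) (test_post b M))) b3 M2" if "b3 \<le> b2 + 10" for b3
        proof (rule wp_conseq[OF cut_spec])
          show "static M2" by (rule st2)
          show "credit M2 \<le> 6 * m" using cm(1) by (simp add: credit_def M2s M1s al2)
          show "visited M2 \<subseteq> {..<n}" using R(1) by (simp add: R_def)
          show "inj_on (M2 QB) {..<M2 rQN 0}" using R(7) by (simp add: tree_def)
          show "M2 MB v = of_bool (v \<in> visited M2)" for v using R(6) by (simp add: R_def)
          show "M2 rWT 0 = vol (visited M2)" using R(4) by (simp add: R_def)
          have "M2 rQN 0 \<le> 1 + vol (visited M2)"
          proof (rule queue_le_vol)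
            show "0 < deg (M2 QB j)" if "0 < j" "j < M2 rQN 0" for j
              using explored_deg_pos[of M1 M2 j] ex ready1 that by (simp add: res1)
          qed (use R(7) in \<open>simp_all add: tree_def\<close>)
          then show "M2 rQN 0 \<le> M2 rWT 0 + 1" using R(4) by (simp add: R_def)
          show "stack M2 \<subseteq> {..<2 * n}" using cm(2) by (simp add: stack_def M2s M1s)
          fix b' M' assume c: "cut_post b3 M2 b' M'" and un: "unchanged cut M2 M'"
          have al: "alive M' = alive M - crossing R" using c by (simp add: cut_post_def R_def al2)
          show "wp w clear (wp w (mark 0) (test_post b M)) b' M'"
          proof (rule fin)
            show "M' s = M2 s" if "s \<notin> writes cut" for s using unchangedD[OF un that] .
            show "b' \<le> b2 + 10 + 1000 * (1 + M rLIM 0)"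
              using c True \<open>b3 \<le> b2 + 10\<close> by (simp add: cut_post_def)
            show "outcome M M'"
              using c found2 al True R(4) by (intro oc) (auto simp: cut_post_def al2)
            show "alive M \<inter> crossing R = {}" if "M' rFOUND 0 = 0"
              using c that al by (auto simp: cut_post_def al2)
          qed
        qed
        then show ?thesis using True by (simp add: wp_simps M2s M1s)
      qed
    qed
  qed simp_all
qed

end

section \<open>Choice of the tested vertices by accumulated tree weight\<close>

section \<open>Searching for a cut\<close>

text \<open>Nonzero iff \<open>I > 0\<close> and \<open>W > K * ACC\<lbrakk>V\<rbrakk>\<close>.\<close>

definition pass :: expr where
  "pass = $rI [div] (C 1 [-] (C 1 [-] ($rW [-] $rK [*] ACC\<lbrakk>$rV\<rbrakk>)))"

text \<open>Positions run downwards, so children come before their parents. A vertex with less than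
  a fraction \<open>1 / rK\<close> of the tree weight passes its share on; any other is tested and
  keeps it. The root is always tested: its path is empty, so this test splits off a tree that no
  edge leaves.\<close>

definition search_step :: prog where
  "search_step = rI \<leftarrow> $rI [-] C 1 ;; rV \<leftarrow> QA\<lbrakk>$rI\<rbrakk> ;;
     Cond ($rFOUND) Skip
       (Cond pass (ACC\<langle>PA\<lbrakk>$rV\<rbrakk>\<rangle> \<leftarrow> ACC\<lbrakk>PA\<lbrakk>$rV\<rbrakk>\<rbrakk> [+] ACC\<lbrakk>$rV\<rbrakk>) test)"

text \<open>Lowering the limit to the tree weight loses no relevant cut (see
  \<open>local_complete\<close> and \<open>global_complete\<close>) and makes a global search pay
  for its component instead of the whole graph.\<close>

definition search :: prog where
  "search = explore ;; copy ;; rAN \<leftarrow> $rQN ;; rW \<leftarrow> $rWT ;;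
     Cond ($rLIM [-] $rW) (rLIM \<leftarrow> $rW) Skip ;; rFOUND \<leftarrow> C 0 ;; rI \<leftarrow> $rAN ;;
     While ($rI) search_step"

lemma writes_search_step: "writes search_step = writes test \<union> {rI, rV, ACC}"
  by (auto simp: search_step_def)

lemma writes_search: "writes search = writes test \<union> {rI, rV, ACC, QA, PA, rAN, rW, rLIM}"
  by (auto simp: search_def writes_search_step writes_explore writes_copy writes_test)

lemma expr_cost_pass [simp]: "expr_cost pass = 16"
  by (simp add: pass_def)

lemma tree_parent:
  "tree E q k par \<Longrightarrow> 0 < i \<Longrightarrow> i < k \<Longrightarrow> \<exists>j<i. par (q i) = q j \<and> (q j, q i) \<in> E"
  unfolding tree_def by blast

lemma tree_cong:
  assumes "tree E q k par" "\<And>i. i < k \<Longrightarrow> q' i = q i" "\<And>i. i < k \<Longrightarrow> par' (q i) = par (q i)"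
  shows "tree E q' k par'"
  unfolding tree_def
proof (intro conjI allI impI)
  show k: "0 < k" using assms(1) by (simp add: tree_def)
  show "inj_on q' {..<k}" using assms(1,2) by (simp add: tree_def inj_on_def)
  show "par' (q' 0) = q' 0" using assms k by (simp add: tree_def)
  fix i assume i: "0 < i \<and> i < k"
  then obtain j where "j < i" "par (q i) = q j" "(q j, q i) \<in> E" using assms(1) unfolding tree_def by blast
  then show "\<exists>j<i. par' (q' i) = q' j \<and> (q' j, q' i) \<in> E" using assms(2,3) i by (intro exI[of _ j]) auto
qed

lemma acc_pass_total:
  assumes "tree E q k par" "0 < i" "i < k"
  shows "(\<Sum>p<i. (A(par (q i) := A (par (q i)) + A (q i))) (q p)) = (\<Sum>p<Suc i. A (q p) :: nat)"
proof -
  obtain j where j: "j < i" "par (q i) = q j" using assms unfolding tree_def by blast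
  have inj: "q p = q j \<longleftrightarrow> p = j" if "p < i" for p
    using assms j(1) that by (auto simp: tree_def inj_on_def)
  have "(\<Sum>p<i. (A(par (q i) := A (par (q i)) + A (q i))) (q p)) = (\<Sum>p<i. A (q p) + (if p = j then A (q i) else 0))"
    by (intro sum.cong refl) (auto simp: j(2) inj)
  also have "\<dots> = (\<Sum>p<i. A (q p)) + A (q i)" using j(1) by (simp add: sum.distrib)
  finally show ?thesis by simp
qed

text \<open>The weight outside \<open>S\<close> is carried towards the root along the tree; since only one tree edge
  leaves \<open>S\<close>, it cannot leak into \<open>S\<close> before some vertex outside \<open>S\<close> has collected all of it.\<close>

lemma acc_pass:
  fixes A :: "'a \<Rightarrow> nat"
  assumes t: "tree E q k par" and i: "0 < i" "i < k" and S: "one_out E S" "q 0 \<in> S"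
    and Y: "Y \<le> (\<Sum>p\<in>{p. p < Suc i \<and> q p \<notin> S}. A (q p))" and W: "K * A (q i) < W" "W \<le> K * Y"
  shows "Y \<le> (\<Sum>p\<in>{p. p < i \<and> q p \<notin> S}. (A(par (q i) := A (par (q i)) + A (q i))) (q p))"
proof -
  let ?A = "A(par (q i) := A (par (q i)) + A (q i))"
  obtain j where j: "j < i" "par (q i) = q j" "(q j, q i) \<in> E" using t i unfolding tree_def by blast
  have inj: "q p = q j \<longleftrightarrow> p = j" if "p < i" for p
    using t i j(1) that by (auto simp: tree_def inj_on_def)
  have le: "(\<Sum>p\<in>{p. p < i \<and> q p \<notin> S}. A (q p)) \<le> (\<Sum>p\<in>{p. p < i \<and> q p \<notin> S}. ?A (q p))"
    by (intro sum_mono) simp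
  show ?thesis
  proof (cases "q i \<in> S")
    case True
    then have "{p. p < Suc i \<and> q p \<notin> S} = {p. p < i \<and> q p \<notin> S}" by (auto simp: less_Suc_eq)
    then show ?thesis using Y le by simp
  next
    case False
    then have eq: "{p. p < Suc i \<and> q p \<notin> S} = insert i {p. p < i \<and> q p \<notin> S}" by (auto simp: less_Suc_eq)
    then have Y': "Y \<le> A (q i) + (\<Sum>p\<in>{p. p < i \<and> q p \<notin> S}. A (q p))" using Y by simp
    show ?thesis
    proof (cases "q j \<in> S")
      case True
      \<comment> \<open>The edge from \<open>q j\<close> to \<open>q i\<close> is the only one
        leaving \<open>S\<close>; an earlier tree vertex outside \<open>S\<close> would have an
        ancestor entered by another such edge.\<close>
      have "q p \<in> S" if pi: "p < i" for p
      proof (rule ccontr)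
        assume "q p \<notin> S"
        then obtain p' where p': "p' \<le> p" "0 < p'" "q p' \<notin> S" "par (q p') \<in> S" "(par (q p'), q p') \<in> E"
          using tree_first_outside[OF t S(2), of p] i(2) pi by auto
        have "q p' = q i" using S(1) p'(3,4,5) j(3) True False unfolding one_out_def by blast
        then have "p' = i" using t i(2) p'(1) pi by (auto simp: tree_def inj_on_def)
        then show False using p'(1) pi by simp
      qed
      then have none: "{p. p < i \<and> q p \<notin> S} = {}" by blast
      \<comment> \<open>So \<open>q i\<close> alone has collected all the weight outside
        \<open>S\<close>, which contradicts that it is too light to be tested.\<close>
      have "Y \<le> A (q i)" using Y' unfolding none by simp
      then have "K * Y \<le> K * A (q i)" by (rule mult_le_mono2)
      then show ?thesis using W by linarith
    next
      case jS: False
      have "(\<Sum>p\<in>{p. p < i \<and> q p \<notin> S}. ?A (q p)) = (\<Sum>p\<in>{p. p < i \<and> q p \<notin> S}. A (q p) + (if p = j then A (q i) else 0))"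
        by (intro sum.cong refl) (auto simp: j(2) inj)
      also have "\<dots> = (\<Sum>p\<in>{p. p < i \<and> q p \<notin> S}. A (q p)) + A (q i)"
        using j(1) jS by (simp add: sum.distrib)
      finally show ?thesis using Y' by simp
    qed
  qed
qed

context input
begin

text \<open>A failed search leaves open only light cuts \<open>S\<close> with too small a share of
  the tree outside. The premise \<open>0 < vol (X - S)\<close> makes the accumulation argument end
  in a contradiction, when no position is left and the weight outside \<open>S\<close> is bounded by
  an empty sum.\<close>

definition search_post :: "nat \<Rightarrow> memory \<Rightarrow> nat \<Rightarrow> memory \<Rightarrow> bool" where
  "search_post b M b' M' \<longleftrightarrow> (let X = M' QA ` {..<M' rAN 0}; W = M' rW 0; r = M rROOT 0; L = min (M rLIM 0) W in
     outcome M M' \<and> (\<forall>v. M' ONP v = 0) \<and> (\<forall>v. M' MB v = 0) \<and>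
     X \<subseteq> {..<n} \<and> W = vol X \<and> X \<subseteq> weak_comp (alive M) r \<and> r \<in> X \<and>
     (M' rFOUND 0 = 0 \<longrightarrow> W \<le> M rLIM 0 \<longrightarrow> X = weak_comp (alive M) r) \<and>
     (M' rFOUND 0 = 0 \<longrightarrow> (\<forall>S. r \<in> S \<longrightarrow> S \<subseteq> {..<n} \<longrightarrow> one_out (dir_rel (M rD 0) (alive M)) S \<longrightarrow>
       vol S \<le> L \<longrightarrow> 0 < vol (X - S) \<longrightarrow> \<not> W \<le> M rK 0 * vol (X - S))) \<and>
     M' rAN 0 \<le> 1 + W \<and>
     b' \<le> b + 20000 * (1 + (M rK 0 + 1) * L))"

lemma pushed_trans:
  assumes "pushed M M'" "alive M' = alive M" "pushed M' M''"
  shows "pushed M M''"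
  using assms by (auto simp: pushed_def)

lemma outcome_trans:
  assumes "outcome M M'" "alive M' = alive M" "M' rROOT 0 = M rROOT 0" "M' rD 0 = M rD 0" "outcome M' M''"
  shows "outcome M M''"
proof -
  have "pushed M M''" using assms pushed_trans by (auto simp: outcome_def)
  then show ?thesis using assms unfolding outcome_def by simp
qed

lemma vol_queue: "inj_on q {..<k} \<Longrightarrow> vol (q ` {..<k}) = (\<Sum>p<k. deg (q p))"
  by (simp add: vol_def sum.reindex)

lemma search_spec:
  assumes M: "static M" "M rD 0 < 2" "M rROOT 0 < n" "\<And>v. M ONP v = 0" "\<And>v. M MB v = 0"
    "credit M \<le> 6 * m" "stack M \<subseteq> {..<2 * n}" "M rK 0 * (2 * m) \<le> 50 * lim" "m = 0 \<or> 0 < M rLIM 0"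
  shows "wp w search (search_post b M) b M"
proof -
  define r where "r = M rROOT 0"
  define E where "E = dir_rel (M rD 0) (alive M)"
  define L0 where "L0 = M rLIM 0"
  define K where "K = M rK 0"
  have ready: "ready M" using M by (simp add: ready_def)
  have res: "res M = E" using M(4) by (simp add: res_def E_def)
  show ?thesis
    unfolding search_def wp_Seq
  proof (rule wp_conseq[OF explore_spec[OF ready M(3,5)]])
    fix b1 M1 assume 1: "explore_post b M b1 M1" and "unchanged explore M M1"
    note M1s = unchangedD[OF this(2), unfolded writes_explore, simplified]
    define k where "k = M1 rQN 0"
    define q where "q = M1 QB"
    define X where "X = q ` {..<k}"
    define W where "W = vol X"
    define L where "L = min L0 W"
    have ex: "explored E M1" using 1 by (simp add: explore_post_def res)
    have t1: "tree E q k (M1 PB)" and q0: "q 0 = r" and Xn: "X \<subseteq> {..<n}" and mb1: "\<And>v. M1 MB v = of_bool (v \<in> X)"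
      and wt: "M1 rWT 0 = W" and kL0: "k \<le> L0 + 2"
      using ex by (simp_all add: explored_def k_def q_def X_def W_def M1s r_def L0_def)
    have k0: "0 < k" and inj: "inj_on q {..<k}" using t1 by (simp_all add: tree_def)
    have rX: "r \<in> X" using q0 k0 unfolding X_def by blast
    have kn: "k \<le> n" using explored_QN_le[OF ex] by (simp add: k_def)
    have dpos: "0 < deg (q j)" if "0 < j" "j < k" for j
      using explored_deg_pos[of M M1 j] ex ready that by (simp add: res k_def q_def)
    have kW: "k \<le> 1 + W" using queue_le_vol[OF dpos inj, of k] by (simp add: W_def X_def)
    have Wm: "W \<le> 2 * m" unfolding W_def by (rule vol_le[OF Xn])
    have KW: "K * W \<le> 50 * lim" using le_trans[OF mult_le_mono2[OF Wm] M(8)] by (simp only: K_def)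
    have Xw: "X \<subseteq> weak_comp (alive M) r"
    proof -
      have "x \<in> weak_comp (alive M) r" if "u \<in> weak_comp (alive M) r" "(u, x) \<in> E" for u x
        using weak_comp_dir_closed[OF that(1)] that(2) unfolding E_def by blast
      then have "q i \<in> weak_comp (alive M) r" if "i < k" for i
        using tree_subset[OF t1 _ _ that] q0 by simp
      then show ?thesis by (auto simp: X_def)
    qed
    have clos: "x \<in> X" if "W \<le> L0" "u \<in> X" "(u, x) \<in> E" for u x
      using 1 that wt by (auto simp: explore_post_def X_def k_def q_def res L0_def)
    have b1: "b1 \<le> b + 400 * (1 + L)" using 1 wt by (simp add: explore_post_def L_def L0_def)
    have st1: "static M1" using M(1) static_cong[of M1 M] by (simp add: M1s)
    let ?rest = "wp w (rAN \<leftarrow> $rQN) (wp w (rW \<leftarrow> $rWT) (wp w (Cond ($rLIM [-] $rW) (rLIM \<leftarrow> $rW) Skip)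
      (wp w (rFOUND \<leftarrow> C 0) (wp w (rI \<leftarrow> $rAN) (wp w (While ($rI) search_step) (search_post b M))))))"
    have "wp w copy ?rest b1 M1"
    proof (rule wp_conseq[OF copy_spec])
      show "M1 MB v = of_bool (v \<in> visited M1)" for v using mb1 by (simp add: X_def q_def k_def)
      show "M1 rQN 0 \<le> n" using kn by (simp add: k_def)
      show "static M1" by (rule st1)
      show "visited M1 \<subseteq> {..<n}" using Xn by (simp add: X_def q_def k_def)
      fix b2 M2 assume 2: "(\<forall>v. M2 MB v = 0) \<and> (\<forall>i<M1 rQN 0. M2 QA i = M1 QB i \<and>
        M2 PA (M1 QB i) = M1 PB (M1 QB i) \<and> M2 ACC (M1 QB i) = deg (M1 QB i)) \<and> b2 \<le> b1 + 10 + 60 * M1 rQN 0"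
        and "unchanged copy M1 M2"
      note M2s = unchangedD[OF this(2), unfolded writes_copy, simplified]
      have qa: "M2 QA i = q i" and pa: "M2 PA (q i) = M1 PB (q i)" and acc: "M2 ACC (q i) = deg (q i)" if "i < k" for i
        using 2 that by (simp_all add: q_def k_def)
      define q' where "q' = M2 QA"
      define par where "par = M2 PA"
      have t: "tree E q' k par" unfolding q'_def par_def using tree_cong[OF t1] qa pa by blast
      have X': "q' ` {..<k} = X" using qa by (auto simp: X_def q'_def)
      have q'0: "q' 0 = r" using qa[OF k0] q0 by (simp add: q'_def)
      have inj': "inj_on q' {..<k}" using t by (simp add: tree_def)
      have loop: "wp w (While ($rI) search_step) (search_post b M) b3 M3"
        if M3s: "\<And>s. s \<notin> {rAN, rW, rLIM, rFOUND, rI} \<Longrightarrow> M3 s = M2 s"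
          "M3 rAN 0 = k" "M3 rW 0 = W" "M3 rLIM 0 = L" "M3 rFOUND 0 = 0" "M3 rI 0 = k"
          and b3: "b3 \<le> b2 + 40" for b3 M3
      proof -
        have M3v: "M3 rD = M rD" "M3 rROOT = M rROOT" "M3 rK = M rK" "M3 DEAD = M DEAD" "M3 rSP = M rSP"
          "M3 STK = M STK" "M3 ONP = M ONP" "M3 QA = q'" "M3 PA = par" "M3 ACC = M2 ACC" "M3 MB = M2 MB"
          using M3s(1) by (simp_all add: M2s M1s q'_def par_def)
        have al3: "alive M3 = alive M" by (rule alive_cong) (simp add: M3v)
        have st3: "static M3" using M(1) static_cong[of M3 M] M3s(1) by (simp add: M2s M1s)
        \<comment> \<open>The cuts that the search must not miss; a failure is shown to leave this
          family empty.\<close>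
        define G where "G = {S. r \<in> S \<and> S \<subseteq> {..<n} \<and> one_out E S \<and> vol S \<le> L \<and> 0 < vol (X - S) \<and> W \<le> K * vol (X - S)}"
        \<comment> \<open>Bounds the number of tests to come: each removes at least
          \<open>W / K\<close> from the weight still carried, and the root needs one more.\<close>
        define rp where "rp M' = (if M' rFOUND 0 \<noteq> 0 then 0
          else (K * (\<Sum>p<M' rI 0. M' ACC (q' p))) div W + of_bool (M' rI 0 > 0))" for M' :: memory
        define N where "N = b3 + 60 * k + 4100 * (1 + L) * ((K * W) div W + 1)"
        define I where "I = (\<lambda>b' M'. outcome M3 M' \<and> (\<forall>v. M' ONP v = 0) \<and> (\<forall>v. M' MB v = 0) \<and> M' rI 0 \<le> k \<and>
          (M' rFOUND 0 = 0 \<longrightarrow> (\<Sum>p<M' rI 0. M' ACC (q' p)) \<le> W \<and>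
            (\<forall>S\<in>G. vol (X - S) \<le> (\<Sum>p\<in>{p. p < M' rI 0 \<and> q' p \<notin> S}. M' ACC (q' p))) \<and>
            (M' rI 0 = 0 \<longrightarrow> W \<le> L0 \<longrightarrow> weak_comp (alive M) r \<subseteq> X)) \<and>
          b' + 60 * M' rI 0 + 4100 * (1 + L) * rp M' \<le> N)"
        show ?thesis
        proof (rule wp_While[where I = I and N = N])
          have "outcome M3 M3"
          proof -
            have "b \<in> weak_comp (alive M) r" if "(a, b) \<in> E" "a \<in> weak_comp (alive M) r" for a b
              using weak_comp_dir_closed[OF that(2)] that(1) unfolding E_def by blast
            then have "one_out E (weak_comp (alive M) r)" unfolding one_out_def by blast
            then show ?thesis using M(7) M3s(5)
              unfolding outcome_def pushed_def stack_def al3 M3v E_def r_def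
              by (auto intro!: exI[of _ "weak_comp (alive M) (M rROOT 0)"])
          qed
          moreover have "(\<Sum>p<k. M3 ACC (q' p)) = W"
          proof -
            have "(\<Sum>p<k. M3 ACC (q' p)) = (\<Sum>p<k. deg (q p))"
              using acc qa by (intro sum.cong) (simp_all add: M3v q'_def)
            then show ?thesis using vol_queue[OF inj] by (simp add: W_def X_def)
          qed
          moreover have "vol (X - S) \<le> (\<Sum>p\<in>{p. p < k \<and> q' p \<notin> S}. M3 ACC (q' p))" for S
          proof -
            have "X - S = q' ` {p. p < k \<and> q' p \<notin> S}" using X' by auto
            moreover have "inj_on q' {p. p < k \<and> q' p \<notin> S}" using inj' by (auto simp: inj_on_def)
            ultimately have "vol (X - S) = (\<Sum>p\<in>{p. p < k \<and> q' p \<notin> S}. deg (q' p))"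
              by (simp add: vol_def sum.reindex)
            also have "\<dots> = (\<Sum>p\<in>{p. p < k \<and> q' p \<notin> S}. M3 ACC (q' p))"
              using acc qa by (intro sum.cong) (simp_all add: M3v q'_def)
            finally show ?thesis by simp
          qed
          ultimately show "I b3 M3"
            using M(4) 2 k0 M3s by (simp add: I_def M3v rp_def N_def)
          show "b' \<le> N" if "I b' M'" for b' M' using that by (simp add: I_def)
          fix b' M' assume I: "I b' M'" and un: "unchanged search_step M3 M'"
          note M's = unchangedD[OF un, unfolded writes_search_step writes_test, simplified]
          have M'v: "M' rAN 0 = k" "M' rW 0 = W" "M' rLIM 0 = L" "M' QA = q'" "M' PA = par"
            "M' rD = M rD" "M' rROOT = M rROOT" "M' rK = M rK"
            by (simp_all add: M's M3s M3v)
          have st': "static M'" using st3 static_cong[of M' M3] by (simp add: M's)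
          {
            assume "expr_val w M' ($rI) \<noteq> 0"
            then obtain i where i: "M' rI 0 = Suc i" by (cases "M' rI 0") auto
            have ik: "i < k" using I i by (simp add: I_def)
            define v where "v = q' i"
            have vX: "v \<in> X" using ik X' unfolding v_def by blast
            define M4 where "M4 = M'(rI := (M' rI)(0 := i), rV := (M' rV)(0 := v))"
            show "wp w search_step I (b' + (1 + expr_cost ($rI))) M'"
            proof (cases "M' rFOUND 0 = 0")
              case False
              have "outcome M3 M4" using I by (simp add: I_def M4_def outcome_def credit_def pushed_def stack_def alive_def)
              then have "I b4 M4" if "b4 \<le> b' + 40" for b4
                using I False ik that by (simp add: I_def M4_def rp_def i)
              from this[unfolded M4_def v_def] show ?thesis
                using False by (simp add: search_step_def wp_simps i M'v)
            next
              case True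
              have al': "alive M' = alive M" using I True al3 by (simp add: I_def outcome_def)
              have al4: "alive M4 = alive M" using al' alive_cong[of M4 M'] by (simp add: M4_def)
              have oc4: "outcome M3 M4" using I by (simp add: I_def M4_def outcome_def credit_def pushed_def stack_def alive_def)
              let ?A = "M' ACC"
              have sm: "(\<Sum>p<Suc i. ?A (q' p)) \<le> W" using I True i by (simp add: I_def)
              then have Av: "?A v \<le> W" by (simp add: v_def)
              have gd: "vol (X - S) \<le> (\<Sum>p\<in>{p. p < Suc i \<and> q' p \<notin> S}. ?A (q' p))" if "S \<in> G" for S
                using I True i that by (simp add: I_def)
              have tm: "b' + 60 * Suc i + 4100 * (1 + L) * ((K * (\<Sum>p<Suc i. ?A (q' p))) div W + 1) \<le> N"
                using I True i by (simp add: I_def rp_def)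
              have "K * ?A v \<le> 100 * lim" using le_trans[OF mult_le_mono2[OF Av] KW] by (rule le_trans) simp
              then have KA: "(K * ?A v) mod 2 ^ w = K * ?A v" by (rule mod_word)
              have psv: "expr_val w M4 pass = 0 \<longleftrightarrow> i = 0 \<or> W \<le> K * ?A v"
                by (cases "W \<le> K * ?A v") (simp_all add: pass_def M4_def M'v KA K_def[symmetric])
              show ?thesis
              proof (cases "i = 0 \<or> W \<le> K * ?A v")
                case False
                define A' where "A' = ?A(par v := ?A (par v) + ?A v)"
                define M5 where "M5 = M4(ACC := A')"
                obtain j where j: "j < i" "par v = q' j" using tree_parent[OF t _ ik] False unfolding v_def by auto
                have "?A (q' j) + ?A (q' i) \<le> (\<Sum>p\<in>{j, i}. ?A (q' p))" using j(1) by simp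
                also have "\<dots> \<le> (\<Sum>p<Suc i. ?A (q' p))" using j(1) by (intro sum_mono2) auto
                finally have "?A (par v) + ?A v \<le> 100 * lim" using sm Wm lim_bounds j(2) by (simp add: v_def)
                then have md: "(?A (par v) + ?A v) mod 2 ^ w = ?A (par v) + ?A v" by (rule mod_word)
                have tot: "(\<Sum>p<i. A' (q' p)) = (\<Sum>p<Suc i. ?A (q' p))"
                  unfolding A'_def v_def by (rule acc_pass_total[OF t]) (use ik False in auto)
                have "vol (X - S) \<le> (\<Sum>p\<in>{p. p < i \<and> q' p \<notin> S}. A' (q' p))" if "S \<in> G" for S
                  unfolding A'_def v_def
                proof (rule acc_pass[OF t])
                  show "one_out E S" "q' 0 \<in> S" "W \<le> K * vol (X - S)" using that q'0 by (simp_all add: G_def)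
                qed (use ik False gd[OF that] in \<open>auto simp: v_def\<close>)
                moreover have "outcome M3 M5" using oc4 by (simp add: M5_def outcome_def credit_def pushed_def stack_def alive_def)
                moreover have "rp M5 = (K * (\<Sum>p<Suc i. ?A (q' p))) div W + 1"
                  using True False tot by (simp add: rp_def M5_def M4_def)
                ultimately have "I b5 M5" if "b5 \<le> b' + 60" for b5
                  using I True ik that tot sm False tm
                  by (simp add: I_def M5_def M4_def)
                from this[unfolded M5_def M4_def A'_def] show ?thesis
                  using psv False True unfolding M4_def
                  by (simp add: search_step_def wp_simps i M'v md v_def[symmetric])
              next
                case pick: True
                have "searching M4"
                  unfolding searching_def
                proof (intro conjI)
                  show "static M4" using st' static_cong[of M4 M'] by (simp add: M4_def)
                  show "M4 rD 0 < 2" using M(2) by (simp add: M4_def M'v)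
                  show "\<forall>v. M4 ONP v = 0" "\<forall>v. M4 MB v = 0" using I by (simp_all add: I_def M4_def)
                  show "tree (dir_rel (M4 rD 0) (alive M4)) (M4 QA) (M4 rAN 0) (M4 PA)"
                    using t by (simp add: al4) (simp add: M4_def M'v E_def)
                  show "M4 QA 0 = M4 rROOT 0" using q'0 by (simp add: M4_def M'v r_def)
                  show "M4 QA ` {..<M4 rAN 0} \<subseteq> {..<n}" using Xn X' by (simp add: M4_def M'v)
                  have "credit M4 = credit M" using oc4 by (simp add: outcome_def credit_def al3 M3v)
                  then show "credit M4 \<le> 6 * m" using M(6) by simp
                  show "stack M4 \<subseteq> {..<2 * n}" using oc4 by (simp add: outcome_def pushed_def)
                  show "M4 rAN 0 \<le> M4 rLIM 0 + 2" using kL0 kW by (simp add: M4_def M'v L_def)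
                qed
                moreover have "M4 rFOUND 0 = 0" "M4 rV 0 \<in> M4 QA ` {..<M4 rAN 0}"
                  using True vX X' by (simp_all add: M4_def M'v)
                ultimately have tst: "wp w test (test_post b4 M4) b4 M4" for b4 by (rule test_spec)
                have "wp w test I b4 M4" if b4: "b4 \<le> b' + 40" for b4
                proof (rule wp_conseq[OF tst])
                  fix b5 M5 assume p: "test_post b4 M4 b5 M5" and "unchanged test M4 M5"
                  note M5s = unchangedD[OF this(2), unfolded writes_test, simplified]
                  have oc5: "outcome M3 M5"
                    using outcome_trans[OF oc4, of M5] p al4 al3 by (simp add: test_post_def M4_def M'v M3v)
                  have cmp: "weak_comp (alive M) r \<subseteq> S"
                    if "M5 rFOUND 0 = 0" "r \<in> S" "S \<subseteq> {..<n}" "vol S \<le> L"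
                      "\<And>u x. u \<in> S \<Longrightarrow> (u, x) \<in> resid E (tree_path q' par v) par \<Longrightarrow> x \<in> S" for S
                    using p that unfolding test_post_def al4 by (auto simp: M4_def M'v r_def E_def)
                  \<comment> \<open>A test at a vertex outside \<open>S\<close> would have found an
                    edge to delete. So \<open>v\<close> lies in \<open>S\<close>, and dropping its
                    weight takes nothing from the weight outside \<open>S\<close>.\<close>
                  have vS: "v \<in> S" if "S \<in> G" "M5 rFOUND 0 = 0" for S
                  proof (rule ccontr)
                    assume nv: "v \<notin> S"
                    have S: "r \<in> S" "S \<subseteq> {..<n}" "one_out E S" "vol S \<le> L" using that(1) by (simp_all add: G_def)
                    have "x \<in> S" if "u \<in> S" "(u, x) \<in> resid E (tree_path q' par v) par" for u x
                      using one_out_resid_closed[OF t _ nv refl S(3) _ that] vX X' S(1) q'0 by simp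
                    then have "weak_comp (alive M) r \<subseteq> S" using cmp[OF that(2) S(1,2,4)] by blast
                    then show False using vX Xw nv by blast
                  qed
                  have "(\<Sum>p<i. M5 ACC (q' p)) \<le> W" using sm by (simp add: M5s M4_def)
                  moreover have "vol (X - S) \<le> (\<Sum>p\<in>{p. p < i \<and> q' p \<notin> S}. M5 ACC (q' p))"
                    if "S \<in> G" "M5 rFOUND 0 = 0" for S
                  proof -
                    have "{p. p < Suc i \<and> q' p \<notin> S} = {p. p < i \<and> q' p \<notin> S}"
                      using vS[OF that] by (auto simp: v_def less_Suc_eq)
                    then show ?thesis using gd[OF that(1)] by (simp add: M5s M4_def)
                  qed
                  \<comment> \<open>At the root the residual graph is the graph itself, and a
                    completed tree is closed in it.\<close>
                  moreover have "weak_comp (alive M) r \<subseteq> X" if "i = 0" "W \<le> L0" "M5 rFOUND 0 = 0"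
                  proof (rule cmp[OF that(3) rX Xn])
                    show "vol X \<le> L" using that(2) by (simp add: L_def W_def)
                    have "tree_path q' par v = {}"
                      using that(1) t by (simp add: v_def tree_path_root tree_def)
                    then show "x \<in> X" if "u \<in> X" "(u, x) \<in> resid E (tree_path q' par v) par" for u x
                      using clos[OF \<open>W \<le> L0\<close> that(1)] that(2) by simp
                  qed
                  moreover have "b5 + 60 * i + 4100 * (1 + L) * rp M5 \<le> N"
                  proof -
                    have "rp M5 \<le> (K * (\<Sum>p<Suc i. ?A (q' p))) div W"
                    proof (cases "M5 rFOUND 0 = 0 \<and> 0 < i")
                      case True
                      then have "1 < k" using ik by simp
                      then have "0 < W" using kW by simp
                      \<comment> \<open>The tested vertex holds at least \<open>W / K\<close>, so
                        the quotient in \<open>rp\<close> drops by one and pays for the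
                        test.\<close>
                      have "K * (\<Sum>p<i. ?A (q' p)) + W \<le> K * (\<Sum>p<Suc i. ?A (q' p))"
                        using pick True by (simp add: v_def algebra_simps)
                      then have "(K * (\<Sum>p<i. ?A (q' p)) + W) div W \<le> (K * (\<Sum>p<Suc i. ?A (q' p))) div W"
                        by (rule div_le_mono)
                      then show ?thesis using True \<open>0 < W\<close> by (simp add: rp_def M5s M4_def)
                    next
                      case False
                      then show ?thesis by (auto simp: rp_def M5s M4_def)
                    qed
                    then have "4100 * (1 + L) * (rp M5 + 1) \<le> 4100 * (1 + L) * ((K * (\<Sum>p<Suc i. ?A (q' p))) div W + 1)"
                      by (intro mult_le_mono2) simp
                    moreover have "b5 \<le> b' + 40 + 4000 * (1 + L)"
                      using p b4 by (simp add: test_post_def M4_def M'v)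
                    ultimately show ?thesis using tm by (simp add: algebra_simps)
                  qed
                  ultimately show "I b5 M5"
                    using oc5 p ik unfolding I_def by (simp add: test_post_def M5s M4_def)
                qed
                from this[unfolded M4_def] show ?thesis
                  using psv pick True unfolding M4_def
                  by (simp add: search_step_def wp_simps i M'v v_def[symmetric])
              qed
            qed
          next
            assume "expr_val w M' ($rI) = 0"
            then have i0: "M' rI 0 = 0" by simp
            have oc: "outcome M M'"
              using I unfolding I_def outcome_def
              by (simp add: al3 credit_def pushed_def stack_def M3v)
            have "X = weak_comp (alive M) r" if "M' rFOUND 0 = 0" "W \<le> L0"
              using I i0 that Xw by (auto simp: I_def)
            moreover have "S \<notin> G" if "M' rFOUND 0 = 0" for S
            proof
              assume "S \<in> G"
              then have "vol (X - S) \<le> 0" "0 < vol (X - S)" using I i0 that by (auto simp: I_def G_def)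
              then show False by simp
            qed
            then have "M' rFOUND 0 = 0 \<longrightarrow> (\<forall>S. r \<in> S \<longrightarrow> S \<subseteq> {..<n} \<longrightarrow> one_out E S \<longrightarrow> vol S \<le> L \<longrightarrow>
                0 < vol (X - S) \<longrightarrow> \<not> W \<le> K * vol (X - S))"
              unfolding G_def by blast
            moreover have "b' + 3 \<le> b + 20000 * (1 + (K + 1) * L)"
            proof -
              \<comment> \<open>The positive limit gives \<open>L \<ge> 1\<close>, so
                \<open>1 + L\<close> is at most \<open>2 * L\<close>. The case \<open>W = 0\<close>
                stands apart because its quotient is a division by 0.\<close>
              have "(1 + L) * ((K * W) div W + 1) \<le> 1 + 2 * ((K + 1) * L)"
              proof (cases "W = 0")
                case False
                then have "m \<noteq> 0" using Wm by auto
                then have "1 \<le> L" using M(9) False by (simp add: L_def L0_def)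
                then have "(1 + L) * (K + 1) \<le> (2 * L) * (K + 1)" by (intro mult_le_mono1) simp
                then show ?thesis using False by (simp add: algebra_simps)
              qed (simp add: L_def)
              moreover have "b' \<le> b3 + 60 * k + 4100 * ((1 + L) * ((K * W) div W + 1))"
              proof -
                have "b' \<le> N" using I by (simp add: I_def)
                then show ?thesis unfolding N_def by (simp only: mult.assoc)
              qed
              moreover have "k \<le> L + 2" using kL0 kW by (simp add: L_def)
              moreover have "b3 \<le> b + 400 * (1 + L) + 60 * k + 50"
                using b3 2 b1 by (simp add: k_def)
              moreover have "L \<le> (K + 1) * L" by simp
              moreover have "y + 3 \<le> b + 20000 * (1 + T)"
                if "x \<le> 1 + 2 * T" "y \<le> z + 60 * k + 4100 * x" "k \<le> L + 2"
                  "z \<le> b + 400 * (1 + L) + 60 * k + 50" "L \<le> T" for x y z T :: nat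
                using that by simp
              ultimately show ?thesis by blast
            qed
            ultimately show "search_post b M (b' + (1 + expr_cost ($rI))) M'"
              using oc I Xn Xw rX kW unfolding search_post_def Let_def M'v
              by (simp add: I_def X' W_def[symmetric] flip: r_def L0_def L_def K_def E_def)
          }
        qed
      qed
      show "?rest b2 M2"
      proof (cases "W < L0")
        case True
        then have "L = W" by (simp add: L_def)
        with True show ?thesis
          by (simp add: wp_simps M2s M1s wt flip: k_def L0_def) (rule loop; simp add: M2s M1s flip: k_def)
      next
        case False
        then have "L = L0" by (simp add: L_def)
        with False show ?thesis
          by (simp add: wp_simps M2s M1s wt flip: k_def L0_def) (rule loop; simp add: M2s M1s flip: k_def L0_def)
      qed
    qed
    then show "wp w copy ?rest b1 M1" .
  qed
qed

end

section \<open>Cuts still to be found, and pairs in a common component\<close>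

section \<open>The worklist invariant and the potential\<close>

text \<open>No edge crosses \<open>X\<close>, so the edges entering \<open>X - S\<close> are exactly
  those of \<open>X\<close> leaving \<open>S\<close>.\<close>

lemma one_out_diff:
  assumes "one_out E S" "S \<subseteq> X" "\<And>a b. (a, b) \<in> E \<Longrightarrow> a \<in> X \<longleftrightarrow> b \<in> X"
  shows "one_out (E\<inverse>) (X - S)"
  unfolding one_out_def using assms(1,2) assms(3)
  by (auto simp: one_out_def)

lemma weak_comp_mono: "E \<subseteq> F \<Longrightarrow> weak_comp E v \<subseteq> weak_comp F v"
  unfolding weak_comp_def using rtrancl_mono[of "E \<union> E\<inverse>" "F \<union> F\<inverse>"] by blast

lemma weak_comp_eq: "x \<in> weak_comp E v \<Longrightarrow> weak_comp E x = weak_comp E v"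
proof -
  have sym: "sym ((E \<union> E\<inverse>)\<^sup>*)" by (intro sym_rtrancl) (auto simp: sym_def)
  assume "x \<in> weak_comp E v"
  then have "(v, x) \<in> (E \<union> E\<inverse>)\<^sup>*" by (simp add: weak_comp_def)
  moreover from this have "(x, v) \<in> (E \<union> E\<inverse>)\<^sup>*" using sym by (auto dest: symD)
  ultimately show ?thesis unfolding weak_comp_def by (auto intro: rtrancl_trans)
qed

lemma weak_comp_subset: "E \<subseteq> X \<times> X \<Longrightarrow> v \<in> X \<Longrightarrow> weak_comp E v \<subseteq> X"
  by (rule weak_comp_least) (auto simp: crossing_def)

lemma dir_rel_flip: "d < 2 \<Longrightarrow> dir_rel (1 - d) E = (dir_rel d E)\<inverse>"
  by (auto simp: dir_rel_def less_2_cases_iff)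

context input
begin

text \<open>Restricting to the lighter side makes \<open>K = 2\<close> sufficient in
  \<open>local_complete\<close> when the search tree fills the whole component.\<close>

definition small :: "nat \<Rightarrow> nat \<Rightarrow> (nat \<times> nat) set \<Rightarrow> nat set \<Rightarrow> nat \<Rightarrow> bool" where
  "small \<Delta> d E S x \<longleftrightarrow> x \<in> S \<and> S \<subset> weak_comp E x \<and> one_out (dir_rel d E) S \<and> vol S \<le> \<Delta> \<and>
    2 * vol S \<le> vol (weak_comp E x)"

text \<open>Every cut whose lighter side \<open>S\<close> weighs at most \<open>\<Delta>\<close> contains a candidate of the worklist.\<close>

definition covers :: "nat set \<Rightarrow> nat \<Rightarrow> (nat \<times> nat) set \<Rightarrow> bool" where
  "covers K \<Delta> E \<longleftrightarrow> (\<forall>d<2. \<forall>S x. x < n \<longrightarrow> small \<Delta> d E S x \<longrightarrow> (\<exists>v\<in>S. 2 * v + d \<in> K))"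

lemma es_bound: "E \<subseteq> set es \<Longrightarrow> E \<subseteq> {..<n} \<times> {..<n}"
  using edge_bound by auto

lemma weak_comp_bound: "E \<subseteq> set es \<Longrightarrow> x < n \<Longrightarrow> weak_comp E x \<subseteq> {..<n}"
  using weak_comp_subset[OF es_bound] by simp

text \<open>A set that was already a cut stays covered, as components only shrink. A set becomes a
  cut only when an edge leaving it is deleted, and then the end of this edge inside the set has been
  pushed for the direction in question.\<close>

lemma covers_delete:
  assumes cov: "covers K \<Delta> E" and E: "E' \<subseteq> E" "E \<subseteq> set es" and K: "K \<subseteq> K'"
    and new: "\<And>a b. (a, b) \<in> E - E' \<Longrightarrow> 2 * a \<in> K' \<and> 2 * b + 1 \<in> K'"
  shows "covers K' \<Delta> E'"
  unfolding covers_def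
proof (intro allI impI)
  fix d S x assume d: "d < (2::nat)" and x: "x < n" and s: "small \<Delta> d E' S x"
  have wc: "weak_comp E' x \<subseteq> weak_comp E x" by (rule weak_comp_mono[OF E(1)])
  then have "vol (weak_comp E' x) \<le> vol (weak_comp E x)"
    using weak_comp_bound[OF E(2) x] by (rule vol_mono)
  show "\<exists>v\<in>S. 2 * v + d \<in> K'"
  proof (cases "one_out (dir_rel d E) S")
    case True
    then have "small \<Delta> d E S x" using s wc \<open>vol (weak_comp E' x) \<le> _\<close> by (auto simp: small_def)
    then show ?thesis using cov d x K unfolding covers_def by blast
  next
    case False
    then obtain a b a' b' where ab: "(a, b) \<in> dir_rel d E" "(a', b') \<in> dir_rel d E" "a \<in> S" "a' \<in> S"
      "b \<notin> S" "b' \<notin> S" "\<not> (a = a' \<and> b = b')"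
      unfolding one_out_def by blast
    have "\<not> ((a, b) \<in> dir_rel d E' \<and> (a', b') \<in> dir_rel d E')"
      using s ab unfolding small_def one_out_def by blast
    then obtain u v where uv: "(u, v) \<in> dir_rel d E" "(u, v) \<notin> dir_rel d E'" "u \<in> S" using ab by blast
    then show ?thesis using new[of u v] new[of v u] d
      by (intro bexI[of _ u]) (auto simp: dir_rel_def less_2_cases_iff)
  qed
qed

lemma covers_pop:
  assumes "covers (insert (2 * v + d) K) \<Delta> E" "d < 2" "\<And>S. v \<in> S \<Longrightarrow> \<not> small \<Delta> d E S v"
  shows "covers K \<Delta> E"
  unfolding covers_def
proof (intro allI impI)
  fix d' S x assume d': "d' < (2::nat)" and x: "x < n" and s: "small \<Delta> d' E S x"
  then obtain u where u: "u \<in> S" "2 * u + d' = 2 * v + d \<or> 2 * u + d' \<in> K"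
    using assms(1) unfolding covers_def by blast
  show "\<exists>v\<in>S. 2 * v + d' \<in> K"
  proof (cases "2 * u + d' = 2 * v + d")
    case True
    then have "u = v" "d' = d" using d' assms(2) by presburger+
    then have "weak_comp E v = weak_comp E x" using s u(1) by (intro weak_comp_eq) (auto simp: small_def)
    then have "small \<Delta> d E S v" using s u(1) \<open>u = v\<close> \<open>d' = d\<close> by (simp add: small_def)
    then show ?thesis using assms(3) u(1) \<open>u = v\<close> by blast
  qed (use u in blast)
qed

lemma vol_diff: "S \<subseteq> X \<Longrightarrow> X \<subseteq> {..<n} \<Longrightarrow> vol (X - S) + vol S = vol X"
  by (simp add: vol_def sum.subset_diff[of S X])

text \<open>The complement of \<open>S\<close> in the component is a cut in the other direction. If
  one side weighed at most \<open>\<Delta>\<close>, then so would the lighter side, which would be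
  \<open>small\<close> and need a candidate.\<close>

lemma covers_empty_large:
  assumes cov: "covers {} \<Delta> E" and E: "E \<subseteq> set es" and x: "x < n" "d < 2"
    and S: "x \<in> S" "S \<subset> weak_comp E x" "one_out (dir_rel d E) S"
  shows "\<Delta> < vol S" "\<Delta> < vol (weak_comp E x - S)"
proof -
  define C where "C = weak_comp E x"
  have Cn: "C \<subseteq> {..<n}" unfolding C_def by (rule weak_comp_bound[OF E x(1)])
  have sum: "vol (C - S) + vol S = vol C" using S(2) Cn by (intro vol_diff) (auto simp: C_def)
  obtain y where y: "y \<in> C - S" using S(2) by (auto simp: C_def)
  have yC: "weak_comp E y = C" using y unfolding C_def by (intro weak_comp_eq) simp
  have yn: "y < n" using y Cn by auto
  have clo: "a \<in> C \<longleftrightarrow> b \<in> C" if "(a, b) \<in> dir_rel d E" for a b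
    using weak_comp_dir_closed[of _ E x] that unfolding C_def by blast
  have none: False if "d' < 2" "x' < n" "small \<Delta> d' E S' x'" for d' x' S'
    using cov that unfolding covers_def by blast
  have "one_out (dir_rel (1 - d) E) (C - S)"
    unfolding dir_rel_flip[OF x(2)] by (rule one_out_diff[OF S(3) _ clo]) (use S(2) in \<open>auto simp: C_def\<close>)
  moreover have "Suc 0 - d < 2" by simp
  moreover have "C - S \<subset> C" using S(1,2) by (auto simp: C_def)
  ultimately have 1: "\<not> (vol (C - S) \<le> \<Delta> \<and> 2 * vol (C - S) \<le> vol C)"
    using none[of "1 - d" y "C - S"] yn y x(2) unfolding small_def yC by auto
  have 2: "\<not> (vol S \<le> \<Delta> \<and> 2 * vol S \<le> vol C)"
    using none[of d x S] x S unfolding small_def C_def by auto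
  show "\<Delta> < vol S" "\<Delta> < vol (weak_comp E x - S)"
    using 1 2 sum unfolding C_def by linarith+
qed

text \<open>The number of ordered pairs of edge ends in a common weak component.\<close>

definition psi :: "(nat \<times> nat) set \<Rightarrow> nat" where
  "psi E = (\<Sum>u<n. deg u * vol (weak_comp E u))"

lemma psi_mono: "E' \<subseteq> E \<Longrightarrow> E \<subseteq> set es \<Longrightarrow> psi E' \<le> psi E"
  unfolding psi_def by (intro sum_mono mult_le_mono2 vol_mono weak_comp_mono weak_comp_bound) auto

lemma psi_le: "E \<subseteq> set es \<Longrightarrow> psi E \<le> 4 * (m * m)"
proof -
  assume E: "E \<subseteq> set es"
  have "psi E \<le> (\<Sum>u<n. deg u * (2 * m))"
    unfolding psi_def using weak_comp_bound[OF E] by (intro sum_mono mult_le_mono2 vol_le) auto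
  also have "\<dots> = 4 * (m * m)" using sum_deg by (simp flip: sum_distrib_right)
  finally show ?thesis .
qed

text \<open>The pairs with first end in \<open>R\<close> and second end in the rest of the component
  are separated by the deletion.\<close>

lemma psi_split:
  assumes E: "E \<subseteq> set es" and r: "r < n" and R: "R \<subseteq> weak_comp E r"
  shows "psi (E - crossing R) + vol R * vol (weak_comp E r - R) \<le> psi E"
proof -
  let ?E = "E - crossing R"
  have Rn: "R \<subseteq> {..<n}" using R weak_comp_bound[OF E r] by blast
  have le: "deg u * vol (weak_comp ?E u) + (if u \<in> R then deg u * vol (weak_comp E r - R) else 0)
    \<le> deg u * vol (weak_comp E u)" if "u < n" for u
  proof (cases "u \<in> R")
    case True
    have "weak_comp ?E u \<subseteq> R" using True by (intro weak_comp_least) auto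
    then have "vol (weak_comp ?E u) \<le> vol R" using Rn by (rule vol_mono)
    moreover have "weak_comp E u = weak_comp E r" using True R by (intro weak_comp_eq) auto
    moreover have "vol (weak_comp E r - R) + vol R = vol (weak_comp E r)"
      using R weak_comp_bound[OF E r] by (rule vol_diff)
    ultimately have "vol (weak_comp ?E u) + vol (weak_comp E r - R) \<le> vol (weak_comp E u)" by simp
    then have "deg u * (vol (weak_comp ?E u) + vol (weak_comp E r - R)) \<le> deg u * vol (weak_comp E u)"
      by (rule mult_le_mono2)
    then show ?thesis using True by (simp add: algebra_simps)
  next
    case False
    have "vol (weak_comp ?E u) \<le> vol (weak_comp E u)"
      using that by (intro vol_mono weak_comp_mono weak_comp_bound[OF E]) auto
    then show ?thesis using False by simp
  qed
  have "(\<Sum>u<n. if u \<in> R then deg u * vol (weak_comp E r - R) else 0) = (\<Sum>u\<in>R. deg u * vol (weak_comp E r - R))"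
    using Rn by (subst sum.inter_restrict[symmetric]) (auto simp: Int_absorb1)
  also have "\<dots> = vol R * vol (weak_comp E r - R)" by (simp add: vol_def sum_distrib_right)
  finally have "psi ?E + vol R * vol (weak_comp E r - R) =
    (\<Sum>u<n. deg u * vol (weak_comp ?E u) + (if u \<in> R then deg u * vol (weak_comp E r - R) else 0))"
    by (simp add: psi_def sum.distrib)
  also have "\<dots> \<le> psi E" unfolding psi_def using le by (intro sum_mono) auto
  finally show ?thesis .
qed

end

section \<open>An integral fourth root and the adjacency lists\<close>

section \<open>Initialization\<close>

definition root_step :: prog where
  "root_step = rQ \<leftarrow> $rQ [+] C 1"

definition root_loop :: prog where
  "root_loop = While (0\<lbrakk>C 1\<rbrakk> [-] ($rQ [*] $rQ) [*] ($rQ [*] $rQ)) root_step"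

text \<open>Initially every end of an edge is a candidate in both directions. An isolated vertex
  needs no entry, since it is a whole component.\<close>

definition build_step :: prog where
  "build_step =
     rU \<leftarrow> TAIL\<lbrakk>$rI\<rbrakk> ;; rV \<leftarrow> HEAD\<lbrakk>$rI\<rbrakk> ;;
     DST\<langle>$rI [+] $rI\<rangle> \<leftarrow> $rV ;; DST\<langle>$rI [+] $rI [+] C 1\<rangle> \<leftarrow> $rU ;;
     NXT\<langle>$rI [+] $rI\<rangle> \<leftarrow> FST\<lbrakk>$rU [+] $rU\<rbrakk> ;; FST\<langle>$rU [+] $rU\<rangle> \<leftarrow> $rI [+] C 1 ;;
     NXT\<langle>$rI [+] $rI [+] C 1\<rangle> \<leftarrow> FST\<lbrakk>$rV [+] $rV [+] C 1\<rbrakk> ;; FST\<langle>$rV [+] $rV [+] C 1\<rangle> \<leftarrow> $rI [+] C 1 ;;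
     DEG\<langle>$rU\<rangle> \<leftarrow> DEG\<lbrakk>$rU\<rbrakk> [+] C 1 ;; DEG\<langle>$rV\<rangle> \<leftarrow> DEG\<lbrakk>$rV\<rbrakk> [+] C 1 ;;
     STK\<langle>$rSP\<rangle> \<leftarrow> $rU [+] $rU ;; STK\<langle>$rSP [+] C 1\<rangle> \<leftarrow> $rU [+] $rU [+] C 1 ;;
     STK\<langle>$rSP [+] C 2\<rangle> \<leftarrow> $rV [+] $rV ;; STK\<langle>$rSP [+] C 2 [+] C 1\<rangle> \<leftarrow> $rV [+] $rV [+] C 1 ;;
     rSP \<leftarrow> $rSP [+] C 2 [+] C 2 ;; rI \<leftarrow> $rI [+] C 1"

definition init :: prog where
  "init = root_loop ;; rDELTA \<leftarrow> $rQ [*] $rQ [*] $rQ ;; While (0\<lbrakk>C 1\<rbrakk> [-] $rI) build_step"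

lemma writes_build_step: "writes build_step = {rU, rV, DST, NXT, FST, DEG, STK, rSP, rI}"
  by (auto simp: build_step_def)

lemma linked_cong: "(\<And>e. e \<in> set js \<Longrightarrow> N' (e + e + d) = N (e + e + d)) \<Longrightarrow> linked N' d j js = linked N d j js"
  by (induction js arbitrary: j) auto

context input
begin

definition start :: memory where
  "start = input_memory n es"

definition adj_upto :: "nat \<Rightarrow> nat \<Rightarrow> nat \<Rightarrow> nat list" where
  "adj_upto i d u = rev (filter (\<lambda>e. src d (es ! e) = u) [0..<i])"

lemma adj_upto_Suc: "adj_upto (Suc i) d u = (if src d (es ! i) = u then i # adj_upto i d u else adj_upto i d u)"
  by (simp add: adj_upto_def)

text \<open>Counting stops at the first \<open>q\<close> with \<open>m \<le> q ^ 4\<close>. The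
  factor 16 comes from \<open>Suc q \<le> 2 * q\<close>, the summand 1 from \<open>q = 0\<close>. As
  \<open>q \<le> q ^ 4\<close>, the time is linear in \<open>m\<close>.\<close>

lemma root_loop_spec:
  assumes "M 0 1 = m" "M rQ 0 = 0"
  shows "wp w root_loop (\<lambda>b' M'. m \<le> (M' rQ 0) ^ 4 \<and> (M' rQ 0) ^ 4 \<le> 16 * m + 1 \<and> b' \<le> b + 30 * (16 * m + 2)) b M"
  unfolding root_loop_def
proof (rule wp_While[where I = "\<lambda>b' M'. (M' rQ 0) ^ 4 \<le> 16 * m + 1 \<and> b' \<le> b + 30 * M' rQ 0"
      and N = "b + 30 * (16 * m + 1)"])
  have le4: "x \<le> x ^ 4" for x :: nat by (cases x) (simp_all add: numeral_eq_Suc)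
  show "(M rQ 0) ^ 4 \<le> 16 * m + 1 \<and> b \<le> b + 30 * M rQ 0" by (simp add: assms)
  show "b' \<le> b + 30 * (16 * m + 1)" if "(M' rQ 0) ^ 4 \<le> 16 * m + 1 \<and> b' \<le> b + 30 * M' rQ 0" for b' M'
    using that[THEN conjunct1] that[THEN conjunct2] le4[of "M' rQ 0"] by simp
  fix b' M' assume I: "(M' rQ 0) ^ 4 \<le> 16 * m + 1 \<and> b' \<le> b + 30 * M' rQ 0" and "unchanged root_step M M'"
  then have M0: "M' 0 1 = m" using assms by (simp add: unchanged_def root_step_def)
  define q where "q = M' rQ 0"
  have "q * q \<le> q ^ 4" by (cases q) (simp_all add: numeral_eq_Suc)
  moreover have q4: "(q * q) * (q * q) = q ^ 4" by (simp add: numeral_eq_Suc)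
  moreover have "16 * m + 1 \<le> 100 * lim" using lim_bounds by linarith
  ultimately have "(q * q) mod 2 ^ w = q * q" "q ^ 4 mod 2 ^ w = q ^ 4"
    using I by (auto intro!: mod_word simp: q_def)
  then have ev: "expr_val w M' (0\<lbrakk>C 1\<rbrakk> [-] ($rQ [*] $rQ) [*] ($rQ [*] $rQ)) = m - q ^ 4"
    using M0 by (simp add: q_def[symmetric] q4)
  {
    assume "expr_val w M' (0\<lbrakk>C 1\<rbrakk> [-] ($rQ [*] $rQ) [*] ($rQ [*] $rQ)) \<noteq> 0"
    then have qm: "q ^ 4 < m" unfolding ev by simp
    have "q + 1 \<le> 100 * lim" using le4[of q] qm lim_bounds by linarith
    then have md: "Suc q mod 2 ^ w = Suc q" using mod_word[of "q + 1"] by simp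
    have "Suc q ^ 4 \<le> 16 * m + 1"
    proof (cases "q = 0")
      case False
      then have "Suc q ^ 4 \<le> (2 * q) ^ 4" by (intro power_mono) auto
      then show ?thesis using qm by (simp add: power_mult_distrib)
    qed simp
    then show "wp w root_step (\<lambda>b' M'. (M' rQ 0) ^ 4 \<le> 16 * m + 1 \<and> b' \<le> b + 30 * M' rQ 0)
      (b' + (1 + expr_cost (0\<lbrakk>C 1\<rbrakk> [-] ($rQ [*] $rQ) [*] ($rQ [*] $rQ)))) M'"
      using I by (simp add: root_step_def wp_simps md q_def[symmetric])
  next
    assume "expr_val w M' (0\<lbrakk>C 1\<rbrakk> [-] ($rQ [*] $rQ) [*] ($rQ [*] $rQ)) = 0"
    then have "m \<le> q ^ 4" unfolding ev by simp
    then show "m \<le> (M' rQ 0) ^ 4 \<and> (M' rQ 0) ^ 4 \<le> 16 * m + 1 \<and>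
      b' + (1 + expr_cost (0\<lbrakk>C 1\<rbrakk> [-] ($rQ [*] $rQ) [*] ($rQ [*] $rQ))) \<le> b + 30 * (16 * m + 2)"
      using I le4[of q] by (simp add: q_def)
  }
qed

definition built :: "nat \<Rightarrow> memory \<Rightarrow> bool" where
  "built i M \<longleftrightarrow> (\<forall>e<i. \<forall>d<2. M DST (e + e + d) = dst d (es ! e)) \<and>
    (\<forall>u<n. \<forall>d<2. linked (M NXT) d (M FST (u + u + d)) (adj_upto i d u)) \<and>
    (\<forall>u<n. M DEG u = length (adj_upto i 0 u) + length (adj_upto i 1 u)) \<and>
    M rSP 0 = 4 * i \<and> stack M \<subseteq> {..<2 * n} \<and>
    (\<forall>e<i. \<forall>d<2. 2 * fst (es ! e) + d \<in> stack M \<and> 2 * snd (es ! e) + d \<in> stack M)"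

lemma build_step_spec:
  assumes M: "built i M" "M rI 0 = i" "i < m" "M TAIL i = fst (es ! i)" "M HEAD i = snd (es ! i)"
  shows "wp w build_step (\<lambda>b' M'. built (Suc i) M' \<and> M' rI 0 = Suc i \<and> b' \<le> b + 300) b M"
proof -
  obtain u v where uv: "es ! i = (u, v)" by (cases "es ! i")
  have b: "u < n" "v < n" "u \<noteq> v" using nth_bound[OF M(3)] uv by auto
  have sp: "M rSP 0 = 4 * i" using M(1) by (simp add: built_def)
  have len: "length (adj_upto i d x) \<le> m" for d x
    using M(3) length_filter_le[of "\<lambda>e. src d (es ! e) = x" "[0..<i]"] by (simp add: adj_upto_def)
  have dg: "M DEG x + 1 \<le> 100 * lim" if "x < n" for x
    using M(1) that len[of 0 x] len[of 1 x] lim_bounds by (simp add: built_def)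
  define D where "D = M DEG"
  have md: "(i + i) mod 2 ^ w = i + i" "Suc (i + i) mod 2 ^ w = Suc (i + i)" "Suc i mod 2 ^ w = Suc i"
    "(u + u) mod 2 ^ w = u + u" "Suc (u + u) mod 2 ^ w = Suc (u + u)"
    "(v + v) mod 2 ^ w = v + v" "Suc (v + v) mod 2 ^ w = Suc (v + v)"
    "Suc (4 * i) mod 2 ^ w = Suc (4 * i)" "Suc (Suc (4 * i)) mod 2 ^ w = Suc (Suc (4 * i))"
    "Suc (Suc (Suc (4 * i))) mod 2 ^ w = Suc (Suc (Suc (4 * i)))"
    "Suc (Suc (Suc (Suc (4 * i)))) mod 2 ^ w = Suc (Suc (Suc (Suc (4 * i))))"
    "Suc (M DEG u) mod 2 ^ w = Suc (M DEG u)" "Suc (M DEG v) mod 2 ^ w = Suc (M DEG v)"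
    using b M(3) lim_bounds dg[OF b(1)] dg[OF b(2)] by (intro mod_word; simp)+
  define M' where "M' = M(rU := (M rU)(0 := u), rV := (M rV)(0 := v),
     DST := (M DST)(i + i := v, Suc (i + i) := u),
     NXT := (M NXT)(i + i := M FST (u + u), Suc (i + i) := M FST (Suc (v + v))),
     FST := (M FST)(u + u := Suc i, Suc (v + v) := Suc i),
     DEG := (M DEG)(u := Suc (M DEG u), v := Suc (M DEG v)),
     STK := (M STK)(4 * i := u + u, Suc (4 * i) := Suc (u + u), 4 * i + 2 := v + v, Suc (4 * i + 2) := Suc (v + v)),
     rSP := (M rSP)(0 := 4 * i + 2 + 2), rI := (M rI)(0 := Suc i))"
  have par: "Suc (x + x) \<noteq> y + y" "y + y \<noteq> Suc (x + x)" for x y :: nat by presburger+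
  have st: "stack M' = stack M \<union> {2 * u, 2 * u + 1, 2 * v, 2 * v + 1}"
  proof -
    have "{..<4 * i + 2 + 2} = {..<4 * i} \<union> {4 * i, Suc (4 * i), 4 * i + 2, Suc (4 * i + 2)}" by auto
    moreover have "M' rSP 0 = 4 * i + 2 + 2" by (simp add: M'_def)
    ultimately have "stack M' = M' STK ` {..<4 * i} \<union> M' STK ` {4 * i, Suc (4 * i), 4 * i + 2, Suc (4 * i + 2)}"
      unfolding stack_def by (simp only: image_Un)
    moreover have "M' STK ` {..<4 * i} = M STK ` {..<4 * i}" by (auto simp: M'_def)
    moreover have "M' STK ` {4 * i, Suc (4 * i), 4 * i + 2, Suc (4 * i + 2)} = {2 * u, 2 * u + 1, 2 * v, 2 * v + 1}"
      by (simp add: M'_def mult_2)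
    moreover have "stack M = M STK ` {..<4 * i}" by (simp add: stack_def sp)
    ultimately show ?thesis by (simp only:)
  qed
  have "built (Suc i) M'"
    unfolding built_def
  proof (intro conjI allI impI)
    show "M' rSP 0 = 4 * Suc i" by (simp add: M'_def)
    show "stack M' \<subseteq> {..<2 * n}" using M(1) b by (auto simp: st built_def)
    fix e d assume "e < Suc i" "d < (2::nat)"
    then show "M' DST (e + e + d) = dst d (es ! e)"
      using M(1) by (cases "e = i") (auto simp: M'_def built_def less_2_cases_iff par dst_def uv)
    show "2 * fst (es ! e) + d \<in> stack M'" "2 * snd (es ! e) + d \<in> stack M'"
      using M(1) \<open>e < Suc i\<close> \<open>d < 2\<close> by (cases "e = i"; auto simp: st built_def less_2_cases_iff uv)+
  next
    fix x assume x: "x < n"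
    show "M' DEG x = length (adj_upto (Suc i) 0 x) + length (adj_upto (Suc i) 1 x)"
      using M(1) x b(3) by (simp add: M'_def built_def adj_upto_Suc src_def uv)
    fix d assume d: "d < (2::nat)"
    have c: "linked (M' NXT) d j (adj_upto i d x) = linked (M NXT) d j (adj_upto i d x)" for j
    proof (rule linked_cong)
      fix e assume "e \<in> set (adj_upto i d x)"
      then have "e < i" by (simp add: adj_upto_def)
      then show "M' NXT (e + e + d) = M NXT (e + e + d)"
        using d by (auto simp: M'_def less_2_cases_iff par)
    qed
    have l: "linked (M NXT) d (M FST (x + x + d)) (adj_upto i d x)" using M(1) x d by (simp add: built_def)
    show "linked (M' NXT) d (M' FST (x + x + d)) (adj_upto (Suc i) d x)"
    proof (cases "src d (es ! i) = x")
      case True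
      then have "M' FST (x + x + d) = Suc i" "M' NXT (i + i + d) = M FST (x + x + d)"
        using d by (auto simp: M'_def less_2_cases_iff par src_def uv)
      then show ?thesis using True c l by (simp add: adj_upto_Suc)
    next
      case False
      then have "M' FST (x + x + d) = M FST (x + x + d)"
        using d by (auto simp: M'_def less_2_cases_iff par src_def uv)
      then show ?thesis using False c l by (simp add: adj_upto_Suc)
    qed
  qed
  moreover have "M' rI 0 = Suc i" by (simp add: M'_def)
  ultimately show ?thesis
    using M(2,4,5)[unfolded One_nat_def] b(3) unfolding M'_def
    by (simp add: build_step_def wp_simps md sp par uv)
qed

lemma init_spec:
  "wp w init (\<lambda>b' M'. static M' \<and> M' rDELTA 0 = (M' rQ 0) ^ 3 \<and> m \<le> (M' rQ 0) ^ 4 \<and> (M' rQ 0) ^ 4 \<le> 16 * m + 1 \<and>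
    M' rSP 0 = 4 * m \<and> stack M' \<subseteq> {..<2 * n} \<and>
    (\<forall>e<m. \<forall>d<2. 2 * fst (es ! e) + d \<in> stack M' \<and> 2 * snd (es ! e) + d \<in> stack M') \<and>
    b' \<le> 1000 * (m + 1)) 0 start"
proof -
  have s0: "start 0 0 = n" "start 0 1 = m" "\<And>s i. 3 \<le> s \<Longrightarrow> start s i = 0"
    "\<And>e. e < m \<Longrightarrow> start TAIL e = fst (es ! e)" "\<And>e. e < m \<Longrightarrow> start HEAD e = snd (es ! e)"
    by (simp_all add: start_def input_memory_def m_def)
  show ?thesis
    unfolding init_def wp_Seq
  proof (rule wp_conseq[OF root_loop_spec])
    show "start 0 1 = m" by (rule s0(2))
    show "start rQ 0 = 0" by (simp add: s0)
    fix b1 M1 assume 1: "m \<le> (M1 rQ 0) ^ 4 \<and> (M1 rQ 0) ^ 4 \<le> 16 * m + 1 \<and> b1 \<le> 0 + 30 * (16 * m + 2)"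
      and "unchanged root_loop start M1"
    then have M1s: "M1 s = start s" if "s \<noteq> rQ" for s using that by (simp add: unchanged_def root_loop_def root_step_def)
    define q where "q = M1 rQ 0"
    have "q * q \<le> q ^ 4" "q * q * q \<le> q ^ 4" by (cases q; simp add: numeral_eq_Suc)+
    moreover have "16 * m + 1 \<le> 100 * lim" using lim_bounds by linarith
    ultimately have md: "(q * q) mod 2 ^ w = q * q" "(q * q * q) mod 2 ^ w = q ^ 3"
      using 1 by (auto intro!: mod_word simp: q_def power3_eq_cube)
    define M2 where "M2 = M1(rDELTA := (M1 rDELTA)(0 := q ^ 3))"
    have M2s: "M2 s = start s" if "s \<noteq> rQ" "s \<noteq> rDELTA" for s using that by (simp add: M2_def M1s)
    let ?Q = "\<lambda>b' M'. static M' \<and> M' rDELTA 0 = (M' rQ 0) ^ 3 \<and> m \<le> (M' rQ 0) ^ 4 \<and> (M' rQ 0) ^ 4 \<le> 16 * m + 1 \<and>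
      M' rSP 0 = 4 * m \<and> stack M' \<subseteq> {..<2 * n} \<and>
      (\<forall>e<m. \<forall>d<2. 2 * fst (es ! e) + d \<in> stack M' \<and> 2 * snd (es ! e) + d \<in> stack M') \<and> b' \<le> 1000 * (m + 1)"
    have "wp w (While (0\<lbrakk>C 1\<rbrakk> [-] $rI) build_step) ?Q b2 M2" if b2: "b2 \<le> b1 + 20" for b2
    proof (rule wp_While[where I = "\<lambda>b' M'. built (M' rI 0) M' \<and> M' rI 0 \<le> m \<and> b' \<le> b1 + 20 + 320 * M' rI 0"
          and N = "b1 + 20 + 320 * m"])
      show "built (M2 rI 0) M2 \<and> M2 rI 0 \<le> m \<and> b2 \<le> b1 + 20 + 320 * M2 rI 0"
        using b2 by (simp add: built_def M2s s0 stack_def adj_upto_def)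
      show "b' \<le> b1 + 20 + 320 * m" if "built (M' rI 0) M' \<and> M' rI 0 \<le> m \<and> b' \<le> b1 + 20 + 320 * M' rI 0" for b' M'
        using that by linarith
      fix b' M' assume I: "built (M' rI 0) M' \<and> M' rI 0 \<le> m \<and> b' \<le> b1 + 20 + 320 * M' rI 0"
        and "unchanged build_step M2 M'"
      note M's = unchangedD[OF this(2), unfolded writes_build_step, simplified]
      have ev: "expr_val w M' (0\<lbrakk>C 1\<rbrakk> [-] $rI) = m - M' rI 0" using s0(2) by (simp add: M's M2s)
      {
        assume "expr_val w M' (0\<lbrakk>C 1\<rbrakk> [-] $rI) \<noteq> 0"
        then have i: "M' rI 0 < m" unfolding ev by simp
        have th: "M' TAIL (M' rI 0) = fst (es ! M' rI 0)" "M' HEAD (M' rI 0) = snd (es ! M' rI 0)"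
          using s0(4)[OF i] s0(5)[OF i] by (simp_all add: M's M2s)
        show "wp w build_step (\<lambda>b' M'. built (M' rI 0) M' \<and> M' rI 0 \<le> m \<and> b' \<le> b1 + 20 + 320 * M' rI 0)
          (b' + (1 + expr_cost (0\<lbrakk>C 1\<rbrakk> [-] $rI))) M'"
          by (rule wp_conseq[OF build_step_spec[OF _ refl i th]]) (use I i in auto)
      next
        assume "expr_val w M' (0\<lbrakk>C 1\<rbrakk> [-] $rI) = 0"
        then have i: "M' rI 0 = m" using I unfolding ev by simp
        have "adj_upto m = adj" by (simp add: adj_upto_def adj_def fun_eq_iff)
        then have "static M'" using I i s0 by (simp add: static_def built_def deg_def M's M2s)
        moreover have "M' rQ = M1 rQ" "M' rDELTA 0 = q ^ 3" by (simp_all add: M's M2_def)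
        ultimately show "?Q (b' + (1 + expr_cost (0\<lbrakk>C 1\<rbrakk> [-] $rI))) M'"
          using I i 1 by (simp add: built_def q_def)
      }
    qed
    from this[unfolded M2_def] show "wp w (rDELTA \<leftarrow> $rQ [*] $rQ [*] $rQ)
      (wp w (While (0\<lbrakk>C 1\<rbrakk> [-] $rI) build_step) ?Q) b1 M1"
      unfolding wp_Assign using md by (simp add: q_def[symmetric])
  qed
qed

end

section \<open>Local and global searches with amortized cost\<close>

section \<open>Rounds\<close>

text \<open>Global searches start only when the worklist is empty. Their limit is the total weight,
  so the first tree is never cut off; \<open>rGD\<close> counts the directions that have failed for
  \<open>rR\<close> since the last deletion.\<close>

definition select_root :: prog where
  "select_root = Cond ($rSP)
     (rROOT \<leftarrow> STK\<lbrakk>$rSP [-] C 1\<rbrakk> [div] C 2 ;; rD \<leftarrow> STK\<lbrakk>$rSP [-] C 1\<rbrakk> [-] ($rROOT [+] $rROOT) ;;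
      rLIM \<leftarrow> $rDELTA [+] $rDELTA ;; rK \<leftarrow> C 2)
     (rROOT \<leftarrow> $rR ;; rD \<leftarrow> $rGD ;; rLIM \<leftarrow> 0\<lbrakk>C 1\<rbrakk> [+] 0\<lbrakk>C 1\<rbrakk> ;; rK \<leftarrow> $rQ [+] $rQ)"

text \<open>An entry is popped only after a failed search, as its vertex may lie in further cuts. A
  deletion invalidates an earlier global failure, so both directions start anew.\<close>

definition conclude :: prog where
  "conclude = Cond ($rFOUND) (rGD \<leftarrow> C 0)
     (Cond ($rSP) (rSP \<leftarrow> $rSP [-] C 1) (rGD \<leftarrow> $rGD [+] C 1))"

definition search_round :: prog where
  "search_round = select_root ;; search ;; conclude"

text \<open>Labels are shifted by one because 0 means unlabelled.\<close>

definition label_step :: prog where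
  "label_step = LAB\<langle>QA\<lbrakk>$rI\<rbrakk>\<rangle> \<leftarrow> $rR [+] C 1 ;; rI \<leftarrow> $rI [+] C 1"

definition label :: prog where
  "label = rI \<leftarrow> C 0 ;; While ($rAN [-] $rI) label_step"

definition main_step :: prog where
  "main_step =
     Cond (LAB\<lbrakk>$rR\<rbrakk>) Skip (rGD \<leftarrow> C 0 ;; While (C 2 [-] $rGD) search_round ;; label) ;;
     rR \<leftarrow> $rR [+] C 1"

definition main :: prog where
  "main = init ;; rR \<leftarrow> C 0 ;; While (0\<lbrakk>C 0\<rbrakk> [-] $rR) main_step"

lemma writes_search_round: "writes search_round = writes search \<union> {rROOT, rD, rK, rGD}"
  by (auto simp: search_round_def select_root_def conclude_def writes_search writes_test)

lemma writes_label_step: "writes label_step = {LAB, rI}"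
  by (auto simp: label_step_def)

lemma writes_label: "writes label = {LAB, rI}"
  by (auto simp: label_def label_step_def)

definition fails :: "nat \<Rightarrow> (nat \<times> nat) set \<Rightarrow> nat \<Rightarrow> bool" where
  "fails d E r \<longleftrightarrow> (\<forall>S. r \<in> S \<longrightarrow> S \<subset> weak_comp E r \<longrightarrow> \<not> one_out (dir_rel d E) S)"

context input
begin

text \<open>At least half of the weight of \<open>X\<close> lies outside a small set
  \<open>S\<close>: either \<open>X\<close> outgrew \<open>2 * \<Delta>\<close> while
  \<open>S\<close> weighs at most \<open>\<Delta>\<close>, or \<open>X\<close> is the component and
  \<open>S\<close> its lighter side.\<close>

lemma local_complete:
  assumes E: "E \<subseteq> set es" "v < n" and X: "X \<subseteq> weak_comp E v" "v \<in> X" "card X \<le> 1 + vol X"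
    "vol X \<le> 2 * \<Delta> \<Longrightarrow> X = weak_comp E v"
    and no: "\<And>S. v \<in> S \<Longrightarrow> S \<subseteq> {..<n} \<Longrightarrow> one_out (dir_rel d E) S \<Longrightarrow> vol S \<le> min (2 * \<Delta>) (vol X) \<Longrightarrow>
      0 < vol (X - S) \<Longrightarrow> \<not> vol X \<le> 2 * vol (X - S)"
  shows "\<not> small \<Delta> d E S v"
proof
  assume "small \<Delta> d E S v"
  then have S: "v \<in> S" "S \<subset> weak_comp E v" "one_out (dir_rel d E) S" "vol S \<le> \<Delta>" "2 * vol S \<le> vol (weak_comp E v)"
    by (simp_all add: small_def)
  have Cn: "weak_comp E v \<subseteq> {..<n}" by (rule weak_comp_bound[OF E])
  then have Xn: "X \<subseteq> {..<n}" and Sn: "S \<subseteq> {..<n}" using X(1) S(2) by auto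
  have "vol (X - S) + vol (X \<inter> S) = vol X" 
    using vol_diff[of "X \<inter> S" X] Xn by (simp add: Diff_Int)
  moreover have "vol (X \<inter> S) \<le> vol S" using Sn by (intro vol_mono) auto
  ultimately have d: "vol X \<le> vol (X - S) + vol S" by linarith
  show False
  proof (cases "vol X \<le> 2 * \<Delta>")
    case True
    then have XC: "X = weak_comp E v" by (rule X(4))
    \<comment> \<open>A tree of weight 0 is a single vertex, and a one-vertex component has no
      proper subset containing \<open>v\<close>.\<close>
    have "vol X \<noteq> 0"
    proof
      assume "vol X = 0"
      then have "card X \<le> 1" using X(3) by simp
      moreover have "finite X" using Xn by simp
      ultimately have "X = {v}" using X(2) by (metis card_le_Suc0_iff_eq One_nat_def singletonI singleton_iff subsetI subset_antisym)
      then show False using S(1,2) XC by auto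
    qed
    moreover have s5: "2 * vol S \<le> vol X" using S(5) XC by simp
    ultimately have "0 < vol (X - S)" "vol X \<le> 2 * vol (X - S)" using d by linarith+
    moreover have "vol S \<le> min (2 * \<Delta>) (vol X)" using S(4) s5 by simp
    ultimately show False using no[OF S(1) Sn S(3)] by blast
  next
    case False
    then have "0 < vol (X - S)" "vol X \<le> 2 * vol (X - S)" using d S(4) by linarith+
    moreover have "vol S \<le> min (2 * \<Delta>) (vol X)" using S(4) False by simp
    ultimately show False using no[OF S(1) Sn S(3)] by blast
  qed
qed

text \<open>With an empty worklist the far side of any cut weighs more than \<open>\<Delta>\<close>,
  while the tree weighs at most \<open>2 * m\<close>; hence a fraction \<open>1 / K\<close> of it
  lies outside \<open>S\<close>.\<close>

lemma global_complete:
  assumes E: "E \<subseteq> set es" "r < n" "d < 2" "covers {} \<Delta> E" and K: "2 * m \<le> K * \<Delta>"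
    and X: "X = weak_comp E r"
    and no: "\<And>S. r \<in> S \<Longrightarrow> S \<subseteq> {..<n} \<Longrightarrow> one_out (dir_rel d E) S \<Longrightarrow> vol S \<le> min (2 * m) (vol X) \<Longrightarrow>
      0 < vol (X - S) \<Longrightarrow> \<not> vol X \<le> K * vol (X - S)"
  shows "fails d E r"
  unfolding fails_def
proof (intro allI impI notI)
  fix S assume S: "r \<in> S" "S \<subset> weak_comp E r" "one_out (dir_rel d E) S"
  have Xn: "X \<subseteq> {..<n}" unfolding X by (rule weak_comp_bound[OF E(1,2)])
  have large: "\<Delta> < vol (X - S)" using covers_empty_large(2)[OF E(4,1,2,3) S] by (simp add: X)
  have "vol X \<le> 2 * m" by (rule vol_le[OF Xn])
  also have "\<dots> \<le> K * vol (X - S)" using K large by (meson le_trans less_imp_le mult_le_mono2)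
  finally have "vol X \<le> K * vol (X - S)" .
  moreover have "vol S \<le> min (2 * m) (vol X)"
    using vol_mono[of S X] vol_le[of S] S(2) Xn by (auto simp: X)
  ultimately show False using no[OF S(1) _ S(3)] S(2) Xn large by (auto simp: X)
qed

text \<open>Searches from the single root \<open>r\<close> suffice: a cut that misses
  \<open>r\<close> has a complement in the component that contains \<open>r\<close> and is a cut in
  the other direction.\<close>

lemma verified:
  assumes E: "E \<subseteq> set es" "r < n" and f: "fails 0 E r" "fails 1 E r"
    and kept: "\<And>T. two_edge_sc_set (graph_of n es) T \<Longrightarrow> set es \<inter> T \<times> T \<subseteq> E"
  shows "two_edge_sc_set (graph_of n es) (weak_comp E r)"
    "two_edge_sc_set (graph_of n es) T \<Longrightarrow> T \<inter> weak_comp E r \<noteq> {} \<Longrightarrow> T \<subseteq> weak_comp E r"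
proof -
  let ?C = "weak_comp E r"
  have clo: "a \<in> ?C \<longleftrightarrow> b \<in> ?C" if "(a, b) \<in> E" for a b
    using weak_comp_closed[of _ E r] that by blast
  show "two_edge_sc_set (graph_of n es) ?C"
  proof (rule uncut_two_edge_sc_set[OF weak_comp_bound[OF E] _ E(1)])
    show "?C \<noteq> {}" using weak_comp_refl[of r E] by blast
    show "b \<in> ?C" if "(a, b) \<in> E" "a \<in> ?C" for a b using clo that by blast
    fix S assume S: "S \<subset> ?C" "S \<noteq> {}"
    show "\<not> one_out E S"
    proof (cases "r \<in> S")
      case True
      then show ?thesis using f(1) S(1) by (simp add: fails_def dir_rel_def)
    next
      case False
      show ?thesis
      proof
        assume "one_out E S"
        then have "one_out (E\<inverse>) (?C - S)" by (rule one_out_diff) (use S clo in auto)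
        moreover have "?C - S \<subset> ?C" "r \<in> ?C - S" using S False by auto
        ultimately show False using f(2) by (simp add: fails_def dir_rel_def)
      qed
    qed
  qed
  assume T: "two_edge_sc_set (graph_of n es) T" "T \<inter> ?C \<noteq> {}"
  \<comment> \<open>The component is left by no edge at all, so it is itself a cut, and
    \<open>T\<close> lies on one side of it.\<close>
  have "one_out (dir_rel 0 E) ?C" unfolding one_out_def dir_rel_def using clo by auto
  then show "T \<subseteq> ?C" using two_edge_sc_set_one_side[OF T(1) kept[OF T(1)]] T(2) by blast
qed

text \<open>The last conjunct says that a weak component is labelled as a whole or not at all, so
  the component of an unlabelled root is disjoint from the finished ones.\<close>

definition invar :: "nat \<Rightarrow> memory \<Rightarrow> bool" where
  "invar q M \<longleftrightarrow> static M \<and> (\<forall>v. M ONP v = 0) \<and> (\<forall>v. M MB v = 0) \<and> credit M \<le> 6 * m \<and>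
    stack M \<subseteq> {..<2 * n} \<and> M rQ 0 = q \<and> M rDELTA 0 = q ^ 3 \<and> covers (stack M) (q ^ 3) (alive M) \<and>
    (\<forall>T. two_edge_sc_set (graph_of n es) T \<longrightarrow> set es \<inter> T \<times> T \<subseteq> alive M) \<and>
    (\<forall>a b. (a, b) \<in> alive M \<longrightarrow> (M LAB a = 0 \<longleftrightarrow> M LAB b = 0))"

definition root_invar :: "nat \<Rightarrow> nat \<Rightarrow> memory \<Rightarrow> bool" where
  "root_invar q r M \<longleftrightarrow> invar q M \<and> M rR 0 = r \<and> M rGD 0 \<le> 2 \<and>
    (M rGD 0 > 0 \<longrightarrow> M rSP 0 = 0 \<and> fails 0 (alive M) r) \<and>
    (M rGD 0 = 2 \<longrightarrow> fails 1 (alive M) r \<and> M QA ` {..<M rAN 0} = weak_comp (alive M) r \<and>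
      M rAN 0 \<le> 1 + vol (weak_comp (alive M) r))"

text \<open>Of the constant, 20000 comes from \<open>search_spec\<close> and 100 covers the rest of
  a round. The factor 3 is \<open>K + 1\<close> for \<open>K = 2\<close>, and
  \<open>2 * q ^ 3\<close> is the limit.\<close>

definition local_cost :: "nat \<Rightarrow> nat" where
  "local_cost q = 20100 * (1 + 3 * (2 * q ^ 3))"

definition global_cost :: "nat \<Rightarrow> nat \<Rightarrow> nat" where
  "global_cost q x = 20100 * (1 + (2 * q + 1) * x)"

text \<open>Pays for the remaining local searches and for the remaining successful global searches:
  by \<open>psi_split\<close>, each of these decreases the number of pairs of edge ends in a common weak
  component by more than \<open>(q ^ 3)\<^sup>2\<close>.\<close>

definition pot :: "nat \<Rightarrow> memory \<Rightarrow> nat" where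
  "pot q M = local_cost q * (M rSP 0 + 3 * card (alive M)) +
    2 * global_cost q (2 * m) * (psi (alive M) div (q ^ 3 + 1)\<^sup>2)"

text \<open>A failed global search is charged to the component and leaves the potential alone. If a
  deletion then discards it, the potential must refund it, which is the conditional summand.\<close>

definition round_post :: "nat \<Rightarrow> nat \<Rightarrow> nat \<Rightarrow> memory \<Rightarrow> nat \<Rightarrow> memory \<Rightarrow> bool" where
  "round_post q r b M b' M' \<longleftrightarrow> root_invar q r M' \<and>
    (M' rGD 0 = Suc (M rGD 0) \<and> alive M' = alive M \<and> M' rSP 0 = M rSP 0 \<and>
       b' \<le> b + global_cost q (vol (weak_comp (alive M) r)) \<or>
     M' rGD 0 = 0 \<and> b' + pot q M' + (if M rGD 0 = 0 then 0 else global_cost q (2 * m)) \<le> b + pot q M)"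

lemma invar_delete:
  assumes M: "invar q M" and R: "alive M' = alive M - crossing R" "one_out (dir_rel d (alive M)) R"
    and p: "pushed M M'" "credit M' = credit M" and z: "\<And>v. M' ONP v = 0" "\<And>v. M' MB v = 0"
    and s: "static M'" "M' rQ = M rQ" "M' rDELTA = M rDELTA" "M' LAB = M LAB"
  shows "invar q M'"
proof -
  have "covers (stack M') (q ^ 3) (alive M')"
  proof (rule covers_delete)
    show "covers (stack M) (q ^ 3) (alive M)" using M by (simp add: invar_def)
    show "alive M' \<subseteq> alive M" using R(1) by blast
    show "alive M \<subseteq> set es" by (rule alive_subset)
    show "stack M \<subseteq> stack M'" by (rule stack_mono[OF p(1)])
    show "2 * a \<in> stack M' \<and> 2 * b + 1 \<in> stack M'" if "(a, b) \<in> alive M - alive M'" for a b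
      using p(1) that by (simp add: pushed_def)
  qed
  moreover have "set es \<inter> T \<times> T \<subseteq> alive M'" if T: "two_edge_sc_set (graph_of n es) T" for T
  proof -
    have sub: "set es \<inter> T \<times> T \<subseteq> alive M" using M T by (simp add: invar_def)
    have "T \<subseteq> R \<or> T \<inter> R = {}" using two_edge_sc_set_one_side[OF T sub R(2)] by blast
    then show ?thesis using sub R(1) by (auto simp: crossing_def)
  qed
  moreover have "stack M' \<subseteq> {..<2 * n}" using p(1) by (simp add: pushed_def)
  ultimately show ?thesis using M R(1) p(2) z s unfolding invar_def by auto
qed

lemma covers_stack_pop:
  assumes "covers (stack M) \<Delta> E" "0 < M rSP 0" "M STK (M rSP 0 - 1) = 2 * v + d" "d < 2"
    "\<And>S. \<not> small \<Delta> d E S v"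
  shows "covers (M STK ` {..<M rSP 0 - 1}) \<Delta> E"
proof (rule covers_pop)
  have "{..<M rSP 0} = insert (M rSP 0 - 1) {..<M rSP 0 - 1}" using assms(2) by auto
  then have "stack M = insert (2 * v + d) (M STK ` {..<M rSP 0 - 1})"
    unfolding stack_def by (simp only: image_insert assms(3))
  then show "covers (insert (2 * v + d) (M STK ` {..<M rSP 0 - 1})) \<Delta> E" using assms(1) by simp
qed (use assms in auto)

lemma root_bounds:
  assumes "m \<le> q ^ 4" "q ^ 4 \<le> 16 * m + 1"
  shows "2 * q * (2 * m) \<le> 50 * lim" "q + q \<le> 100 * lim" "q ^ 3 + q ^ 3 \<le> 100 * lim" "2 * m \<le> 2 * q * q ^ 3"
    "m \<noteq> 0 \<Longrightarrow> 0 < q"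
proof -
  have p: "q \<le> q ^ 4" "q ^ 3 \<le> q ^ 4" by (cases q; simp add: numeral_eq_Suc)+
  have "16 * m + 1 \<le> 5 * lim" using lim_bounds by linarith
  then show "q + q \<le> 100 * lim" "q ^ 3 + q ^ 3 \<le> 100 * lim" using p assms(2) by linarith+
  have "q * q ^ 3 = q ^ 4" using power_Suc[of q 3] by simp
  then show "2 * m \<le> 2 * q * q ^ 3" using assms(1) by (simp add: mult.assoc)
  show "0 < q" if "m \<noteq> 0" using assms(1) that by (cases q) auto
  have "q \<le> 3 * m \<or> m = 0"
  proof (rule ccontr)
    assume a: "\<not> (q \<le> 3 * m \<or> m = 0)"
    \<comment> \<open>The left side is at least \<open>81 * m\<close>, too much for
      \<open>16 * m + 1\<close>.\<close>
    then have "(3 * m) ^ 4 \<le> q ^ 4" by (intro power_mono) auto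
    moreover have "m \<le> m ^ 4" by (cases m) (simp_all add: numeral_eq_Suc)
    ultimately show False using assms(2) a by (simp add: power_mult_distrib)
  qed
  then have "q * m \<le> 3 * m * m" by (auto intro: mult_le_mono1)
  then have "q * m \<le> 3 * (m * m)" by (simp only: mult.assoc)
  moreover have "2 * q * (2 * m) = 4 * (q * m)" by simp
  ultimately show "2 * q * (2 * m) \<le> 50 * lim" using lim_bounds(3) by linarith
qed

lemma round_spec:
  assumes q: "m \<le> q ^ 4" "q ^ 4 \<le> 16 * m + 1" and r: "r < n" and M: "root_invar q r M" "M rGD 0 < 2"
    and b0: "b0 \<le> b + 5"
  shows "wp w search_round (round_post q r b M) b0 M"
proof -
  define E where "E = alive M"
  define SP where "SP = M rSP 0"
  define gd where "gd = M rGD 0"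
  define lo where "lo \<longleftrightarrow> SP \<noteq> 0"
  define v where "v = (if lo then M STK (SP - 1) div 2 else r)"
  define d where "d = (if lo then M STK (SP - 1) mod 2 else gd)"
  define L where "L = (if lo then 2 * q ^ 3 else 2 * m)"
  define K where "K = (if lo then 2 else 2 * q)"
  note rb = root_bounds[OF q]
  have iM: "invar q M" and rR: "M rR 0 = r" using M(1) by (simp_all add: root_invar_def)
  have st: "static M" and sn: "stack M \<subseteq> {..<2 * n}" and cr: "credit M \<le> 6 * m" and cov: "covers (stack M) (q ^ 3) E"
    and reg: "M rQ 0 = q" "M rDELTA 0 = q ^ 3" and zero: "\<And>v. M ONP v = 0" "\<And>v. M MB v = 0"
    using iM by (simp_all add: invar_def E_def)
  have lo0: "gd = 0" if lo using M(1) that by (auto simp: root_invar_def lo_def SP_def gd_def)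
  have E: "E \<subseteq> set es" by (simp add: E_def alive_subset)
  have top: "M STK (SP - 1) < 2 * n" if lo
  proof -
    have "M STK (SP - 1) \<in> stack M" using that unfolding stack_def lo_def SP_def by auto
    then show ?thesis using sn by auto
  qed
  have vn: "v < n" and d2: "d < 2" using top r M(2) by (auto simp: v_def d_def gd_def)
  define M1 where "M1 = M(rROOT := (M rROOT)(0 := v), rD := (M rD)(0 := d), rLIM := (M rLIM)(0 := L), rK := (M rK)(0 := K))"
  have al1: "alive M1 = E" unfolding E_def by (rule alive_cong) (simp add: M1_def)
  have M1v: "M1 rSP = M rSP" "M1 STK = M STK" "M1 rROOT 0 = v" "M1 rD 0 = d" by (simp_all add: M1_def)
  have st1: "static M1" using st static_cong[of M1 M] by (simp add: M1_def)
  have "wp w search (search_post b1 M1) b1 M1" for b1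
  proof (rule search_spec)
    show "static M1" by (rule st1)
    show "M1 rD 0 < 2" "M1 rROOT 0 < n" "\<And>v. M1 ONP v = 0" "\<And>v. M1 MB v = 0"
      using d2 vn zero by (simp_all add: M1_def)
    show "credit M1 \<le> 6 * m" using cr by (simp add: credit_def al1 E_def) (simp add: M1_def)
    show "stack M1 \<subseteq> {..<2 * n}" using sn by (simp add: stack_def M1_def)
    show "M1 rK 0 * (2 * m) \<le> 50 * lim" using rb(1) lim_bounds by (simp add: M1_def K_def algebra_simps)
    show "m = 0 \<or> 0 < M1 rLIM 0" using rb(5) by (auto simp: M1_def L_def)
  qed
  then have "wp w search (wp w conclude (round_post q r b M)) b1 M1" if b1: "b1 \<le> b + 60" for b1
  proof (rule wp_conseq)
    fix b2 M2 assume 2: "search_post b1 M1 b2 M2" and "unchanged search M1 M2"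
    note M2s = unchangedD[OF this(2), unfolded writes_search writes_test, simplified]
    define X where "X = M2 QA ` {..<M2 rAN 0}"
    have W: "M2 rW 0 = vol X" using 2 by (simp add: search_post_def Let_def X_def)
    have s: "outcome M1 M2" "\<And>v. M2 ONP v = 0" "\<And>v. M2 MB v = 0" "X \<subseteq> {..<n}" "M2 rW 0 = vol X"
      "X \<subseteq> weak_comp E v" "v \<in> X"
      "M2 rFOUND 0 = 0 \<Longrightarrow> vol X \<le> L \<Longrightarrow> X = weak_comp E v"
      "\<And>S. M2 rFOUND 0 = 0 \<Longrightarrow> v \<in> S \<Longrightarrow> S \<subseteq> {..<n} \<Longrightarrow> one_out (dir_rel d E) S \<Longrightarrow> vol S \<le> min L (vol X) \<Longrightarrow>
        0 < vol (X - S) \<Longrightarrow> \<not> vol X \<le> K * vol (X - S)"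
      "M2 rAN 0 \<le> 1 + vol X" "b2 \<le> b1 + 20000 * (1 + (K + 1) * min L (vol X))"
      using 2 unfolding search_post_def Let_def X_def[symmetric] al1 W by (simp_all add: M1_def)
    have Xm: "vol X \<le> 2 * m" by (rule vol_le[OF s(4)])
    have cX: "card X \<le> 1 + vol X" using card_image_le[of "{..<M2 rAN 0}" "M2 QA"] s(10) by (simp add: X_def)
    have st2: "static M2" using st1 static_cong[of M2 M1] by (simp add: M2s)
    have p: "pushed M M2" "credit M2 = credit M"
      using s(1) by (simp_all add: outcome_def pushed_def credit_def stack_def al1[unfolded E_def] M1v)
    have fnd: "M2 rFOUND 0 = 0 \<longleftrightarrow> alive M2 = E" using s(1) by (simp add: outcome_def al1)
    have cost: "b2 + 40 \<le> b + (if lo then local_cost q else global_cost q (vol X))"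
    proof (cases lo)
      case True
      have "(K + 1) * min L (vol X) \<le> 3 * (2 * q ^ 3)"
        using True by (simp add: K_def L_def)
      then have "20000 * (1 + (K + 1) * min L (vol X)) \<le> 20000 * (1 + 3 * (2 * q ^ 3))" by simp
      then have "b2 + 40 \<le> b + 100 + 20000 * (1 + 3 * (2 * q ^ 3))" using s(11) b1 by linarith
      then show ?thesis using True by (simp add: local_cost_def)
    next
      case False
      have "(K + 1) * min L (vol X) = (2 * q + 1) * vol X" using False Xm by (simp add: K_def L_def min_def)
      then have "b2 + 40 \<le> b + 100 + 20000 * (1 + (2 * q + 1) * vol X)" using s(11) b1 by simp
      then show ?thesis using False by (simp add: global_cost_def)
    qed
    have un2: "M2 rQ = M rQ" "M2 rDELTA = M rDELTA" "M2 LAB = M LAB" "M2 rR = M rR" "M2 rGD = M rGD"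
      by (simp_all add: M2s M1_def)
    have gm: "global_cost q (vol X) \<le> global_cost q (2 * m)"
      unfolding global_cost_def using Xm by (intro mult_le_mono2 add_left_mono)
    show "wp w conclude (round_post q r b M) b2 M2"
    proof (cases "M2 rFOUND 0 = 0")
      case False
      define M3 where "M3 = M2(rGD := (M2 rGD)(0 := 0))"
      obtain R where R: "R \<subseteq> weak_comp E v" "v \<in> R" "one_out (dir_rel d E) R" "alive M2 = E - crossing R" "alive M2 \<noteq> E"
        using s(1) False fnd by (auto simp: outcome_def al1 M1v)
      have inv2: "invar q M2"
        using R(3,4) s(2,3) st2 un2 by (intro invar_delete[OF iM _ _ p]) (auto simp: E_def)
      have al3: "alive M3 = alive M2" by (rule alive_cong) (simp add: M3_def)
      have "invar q M3"
        using inv2 static_cong[of M3 M2] by (simp add: invar_def al3 credit_def stack_def) (simp add: M3_def)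
      moreover have "b2 + 40 + pot q M3 + (if gd = 0 then 0 else global_cost q (2 * m)) \<le> b + pot q M"
      proof -
        have "card (alive M2) < card E"
          using R(4,5) by (intro psubset_card_mono) (auto simp: E_def)
        moreover have "M2 rSP 0 + 2 * card (alive M2) = SP + 2 * card E"
          using p(2) by (simp add: credit_def SP_def E_def)
        \<comment> \<open>Of the three units per deleted edge, two cover the pushed entries; one
          unit is left to pay for this search.\<close>
        ultimately have c: "M2 rSP 0 + 3 * card (alive M2) + 1 \<le> SP + 3 * card E" by linarith
        then have l: "local_cost q * (M2 rSP 0 + 3 * card (alive M2)) + local_cost q \<le> local_cost q * (SP + 3 * card E)"
          using mult_le_mono2[OF c, of "local_cost q"] by (simp add: algebra_simps)
        have ps: "psi (alive M2) div (q ^ 3 + 1)\<^sup>2 \<le> psi E div (q ^ 3 + 1)\<^sup>2"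
          using R(4) by (intro div_le_mono psi_mono[OF _ E]) auto
        have pt: "pot q M3 = local_cost q * (M2 rSP 0 + 3 * card (alive M2)) +
            2 * global_cost q (2 * m) * (psi (alive M2) div (q ^ 3 + 1)\<^sup>2)"
          "pot q M = local_cost q * (SP + 3 * card E) + 2 * global_cost q (2 * m) * (psi E div (q ^ 3 + 1)\<^sup>2)"
          by (simp_all add: pot_def al3 SP_def E_def) (simp add: M3_def)
        show ?thesis
        proof (cases lo)
          case True
          then have "b2 + 40 \<le> b + local_cost q" "(if gd = 0 then 0 else global_cost q (2 * m)) = 0"
            using cost lo0 by simp_all
          then show ?thesis
            using l mult_le_mono2[OF ps, of "2 * global_cost q (2 * m)"] unfolding pt by linarith
        next
          case False
          have cov0: "covers {} (q ^ 3) E" using cov False by (simp add: stack_def lo_def SP_def)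
          have vr: "v = r" using False by (simp add: v_def)
          \<comment> \<open>No edge crosses a weak component, so a deletion shows that
            \<open>R\<close> is a proper subset and therefore heavy on both sides.\<close>
          have "E \<inter> crossing R \<noteq> {}" using R(4,5) by blast
          then have "R \<noteq> weak_comp E r"
            using weak_comp_closed[of _ E r] by (auto simp: crossing_def)
          then have Rs: "R \<subset> weak_comp E r" using R(1) vr by auto
          have "q ^ 3 + 1 \<le> vol R" "q ^ 3 + 1 \<le> vol (weak_comp E r - R)"
            using covers_empty_large[OF cov0 E r d2 _ Rs R(3)] R(2) vr by auto
          then have "(q ^ 3 + 1)\<^sup>2 \<le> vol R * vol (weak_comp E r - R)"
            unfolding power2_eq_square by (rule mult_le_mono)
          then have "psi (alive M2) + (q ^ 3 + 1)\<^sup>2 \<le> psi E"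
            using psi_split[OF E r, of R] R(1,4) vr by simp
          then have "(psi (alive M2) + (q ^ 3 + 1)\<^sup>2) div (q ^ 3 + 1)\<^sup>2 \<le> psi E div (q ^ 3 + 1)\<^sup>2"
            by (rule div_le_mono)
          then have "psi (alive M2) div (q ^ 3 + 1)\<^sup>2 + 1 \<le> psi E div (q ^ 3 + 1)\<^sup>2" by simp
          \<comment> \<open>The factor 2 in the potential pays for this search and for a failed
            search in direction 0 that has to be repeated.\<close>
          from mult_le_mono2[OF this, of "2 * global_cost q (2 * m)"]
          have "2 * global_cost q (2 * m) * (psi (alive M2) div (q ^ 3 + 1)\<^sup>2) + 2 * global_cost q (2 * m)
            \<le> 2 * global_cost q (2 * m) * (psi E div (q ^ 3 + 1)\<^sup>2)" by (simp add: algebra_simps)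
          moreover have "b2 + 40 \<le> b + global_cost q (2 * m)"
            "(if gd = 0 then 0 else global_cost q (2 * m)) \<le> global_cost q (2 * m)"
            using cost gm False by simp_all
          ultimately show ?thesis using l unfolding pt by linarith
        qed
      qed
      ultimately have "round_post q r b M b3 M3" if "b3 \<le> b2 + 40" for b3
        using that un2 rR unfolding round_post_def gd_def root_invar_def by (simp add: M3_def)
      from this[unfolded M3_def] show ?thesis using False by (simp add: conclude_def wp_simps)
    next
      case True
      then have al2: "alive M2 = E" using fnd by simp
      have SP2: "M2 rSP 0 = SP" using p(2) al2 by (simp add: credit_def SP_def E_def)
      have stk2: "M2 STK i = M STK i" if "i < SP" for i using p(1) that by (simp add: pushed_def SP_def)
      show ?thesis
      proof (cases lo)
        case lo: True
        define M3 where "M3 = M2(rSP := (M2 rSP)(0 := SP - 1))"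
        have al3: "alive M3 = E" using alive_cong[of M3 M2] by (simp add: M3_def al2)
        have dv: "M STK (SP - 1) = 2 * v + d" using lo by (simp add: v_def d_def)
        have "\<not> small (q ^ 3) d E S v" for S
          by (rule local_complete[OF E vn s(6,7) cX]) (use s(8,9) True lo in \<open>auto simp: L_def K_def\<close>)
        then have "covers (M STK ` {..<M rSP 0 - 1}) (q ^ 3) E"
          using lo by (intro covers_stack_pop[OF cov _ dv[unfolded SP_def] d2]) (auto simp: lo_def SP_def)
        moreover have stk3: "stack M3 = M STK ` {..<M rSP 0 - 1}"
        proof -
          have "stack M3 = M2 STK ` {..<SP - 1}" by (simp add: stack_def M3_def)
          also have "\<dots> = M STK ` {..<SP - 1}" using stk2 by (intro image_cong) auto
          finally show ?thesis by (simp add: SP_def)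
        qed
        moreover have "M STK ` {..<M rSP 0 - 1} \<subseteq> stack M" by (auto simp: stack_def)
        moreover have "credit M3 \<le> credit M" by (simp add: credit_def al3 E_def[symmetric]) (simp add: M3_def SP_def)
        moreover have "static M3" using st2 static_cong[of M3 M2] by (simp add: M3_def)
        ultimately have "invar q M3"
          using iM s(2,3) un2 sn cr unfolding invar_def al3 E_def[symmetric] by (auto simp: M3_def)
        moreover have "pot q M3 + local_cost q = pot q M"
        proof -
          have "M3 rSP 0 + 3 * card E + 1 = SP + 3 * card E" using lo by (simp add: M3_def lo_def)
          then have "local_cost q * (M3 rSP 0 + 3 * card E) + local_cost q = local_cost q * (SP + 3 * card E)"
            by (metis mult.right_neutral distrib_left)
          then show ?thesis by (simp add: pot_def al3 SP_def E_def)
        qed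
        ultimately have "round_post q r b M b3 M3" if "b3 \<le> b2 + 40" for b3
          using that un2 rR lo lo0 cost unfolding round_post_def root_invar_def gd_def[symmetric] by (simp add: M3_def gd_def)
        from this[unfolded M3_def] show ?thesis using True lo by (simp add: conclude_def wp_simps SP2 lo_def)
      next
        case lo: False
        define M3 where "M3 = M2(rGD := (M2 rGD)(0 := Suc gd))"
        have al3: "alive M3 = E" using alive_cong[of M3 M2] by (simp add: M3_def al2)
        have SP0: "SP = 0" using lo by (simp add: lo_def)
        have vr: "v = r" "d = gd" "L = 2 * m" "K = 2 * q" using lo by (simp_all add: v_def d_def L_def K_def)
        have cov0: "covers {} (q ^ 3) E" using cov SP0 by (simp add: stack_def SP_def)
        have XC: "X = weak_comp E r" using s(8)[OF True] Xm vr by simp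
        have "fails gd E r"
          using global_complete[OF E r d2 cov0 rb(4) XC] s(9)[OF True] vr by blast
        moreover have "invar q M3"
        proof -
          have "static M3" using st2 static_cong[of M3 M2] by (simp add: M3_def)
          moreover have "credit M3 \<le> 6 * m"
            using cr SP2 SP0 by (simp add: credit_def al3 E_def[symmetric]) (simp add: M3_def)
          moreover have "stack M3 = {}" using SP2 SP0 by (simp add: stack_def M3_def)
          ultimately show ?thesis
            using iM s(2,3) un2 cov0 unfolding invar_def al3 E_def[symmetric] by (auto simp: M3_def)
        qed
        moreover have "fails 0 E r" if "gd = 1" using M(1) that by (simp add: root_invar_def E_def gd_def)
        moreover have "gd = 0 \<or> gd = 1" using M(2) by (auto simp: gd_def)
        ultimately have "root_invar q r M3"
          using rR un2 XC s(10) SP2 SP0 unfolding root_invar_def al3 by (auto simp: M3_def X_def)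
        then have "round_post q r b M b3 M3" if "b3 \<le> b2 + 40" for b3
          using that cost lo SP2 SP0 XC unfolding round_post_def al3 E_def[symmetric] gd_def[symmetric]
          by (simp add: M3_def SP_def)
        moreover have "Suc gd mod 2 ^ w = Suc gd" using M(2) lim_bounds mod_word[of "gd + 1"] by (simp add: gd_def)
        ultimately show ?thesis
          using True SP2 SP0 un2(5) unfolding M3_def by (simp add: conclude_def wp_simps gd_def)
      qed
    qed
  qed
  note srch = this
  show ?thesis
  proof (cases lo)
    case True
    have "M STK (SP - 1) - (v + v) = d" using True by (simp add: v_def d_def minus_mod_eq_mult_div[symmetric] mult_2[symmetric])
    moreover have "(v + v) mod 2 ^ w = v + v" using vn lim_bounds by (intro mod_word) linarith
    moreover have "(q ^ 3 + q ^ 3) mod 2 ^ w = q ^ 3 + q ^ 3" by (rule mod_word[OF rb(3)])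
    moreover have "M STK (SP - Suc 0) div 2 = v" using True by (simp add: v_def)
    ultimately show ?thesis
      using True srch[unfolded M1_def] b0 unfolding search_round_def select_root_def
      by (simp add: wp_simps lo_def SP_def[symmetric] reg L_def K_def mult_2)
  next
    case False
    moreover have "M 0 (Suc 0) = m" using st by (simp add: static_def)
    moreover have "(m + m) mod 2 ^ w = m + m" using lim_bounds by (intro mod_word) linarith
    moreover have "(q + q) mod 2 ^ w = q + q" by (rule mod_word[OF rb(2)])
    ultimately show ?thesis
      using srch[unfolded M1_def] b0 unfolding search_round_def select_root_def
      by (simp add: wp_simps lo_def SP_def[symmetric] reg L_def K_def mult_2 rR v_def d_def gd_def)
  qed
qed

end

section \<open>Finished components and the total time\<close>

section \<open>The main loop\<close>

context input
begin

lemma pot_cong: "alive M' = alive M \<Longrightarrow> M' rSP 0 = M rSP 0 \<Longrightarrow> pot q M' = pot q M"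
  by (simp add: pot_def)

lemma invar_cong:
  assumes "\<And>s. s \<notin> {rGD, rR, rI, rV} \<Longrightarrow> M' s = M s"
  shows "invar q M' = invar q M"
proof -
  have "static M' = static M" by (rule static_cong) (simp_all add: assms)
  moreover have "alive M' = alive M" by (rule alive_cong) (simp add: assms)
  moreover from this have "credit M' = credit M" "stack M' = stack M" by (simp_all add: credit_def stack_def assms)
  ultimately show ?thesis by (simp add: invar_def assms)
qed

lemma global_cost_mono: "x \<le> y \<Longrightarrow> global_cost q x \<le> global_cost q y"
  unfolding global_cost_def by (intro mult_le_mono2 add_left_mono)

lemma vol_comp_le: "r < n \<Longrightarrow> vol (weak_comp (alive M) r) \<le> 2 * m"
  by (intro vol_le weak_comp_bound alive_subset)

definition rounds_post :: "nat \<Rightarrow> nat \<Rightarrow> nat \<Rightarrow> memory \<Rightarrow> nat \<Rightarrow> memory \<Rightarrow> bool" where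
  "rounds_post q r b M b' M' \<longleftrightarrow> root_invar q r M' \<and> M' rGD 0 = 2 \<and>
    b' + pot q M' \<le> b + 5 + pot q M + 2 * global_cost q (vol (weak_comp (alive M') r))"

text \<open>The invariant charges only the \<open>rGD\<close> failures since the last deletion to
  the present component; earlier ones have been refunded by the potential. So two global searches
  remain to be paid.\<close>

lemma rounds_spec:
  assumes q: "m \<le> q ^ 4" "q ^ 4 \<le> 16 * m + 1" and r: "r < n" and M: "root_invar q r M" "M rGD 0 = 0"
  shows "wp w (While (C 2 [-] $rGD) search_round) (rounds_post q r b M) b M"
proof (rule wp_While[where I = "\<lambda>b' M'. root_invar q r M' \<and>
      b' + pot q M' \<le> b + pot q M + M' rGD 0 * global_cost q (vol (weak_comp (alive M') r))"
      and N = "b + pot q M + 2 * global_cost q (2 * m)"])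
  let ?g = "\<lambda>M'. global_cost q (vol (weak_comp (alive M') r))"
  have g: "?g M' \<le> global_cost q (2 * m)" for M' by (intro global_cost_mono vol_comp_le r)
  show "root_invar q r M \<and> b + pot q M \<le> b + pot q M + M rGD 0 * ?g M" using M by simp
  show "b' \<le> b + pot q M + 2 * global_cost q (2 * m)"
    if "root_invar q r M' \<and> b' + pot q M' \<le> b + pot q M + M' rGD 0 * ?g M'" for b' M'
  proof -
    have "M' rGD 0 * ?g M' \<le> 2 * global_cost q (2 * m)"
      using that g by (intro mult_le_mono) (auto simp: root_invar_def)
    then show ?thesis using that by linarith
  qed
  fix b' M' assume I: "root_invar q r M' \<and> b' + pot q M' \<le> b + pot q M + M' rGD 0 * ?g M'"
  have gd: "M' rGD 0 \<le> 2" using I by (simp add: root_invar_def)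
  {
    assume "expr_val w M' (C 2 [-] $rGD) \<noteq> 0"
    then have gd2: "M' rGD 0 < 2" by simp
    have "wp w search_round (round_post q r b' M') (b' + (1 + expr_cost (C 2 [-] $rGD))) M'"
      by (rule round_spec[OF q r]) (use I gd2 in auto)
    then show "wp w search_round (\<lambda>b' M'. root_invar q r M' \<and> b' + pot q M' \<le> b + pot q M + M' rGD 0 * ?g M')
      (b' + (1 + expr_cost (C 2 [-] $rGD))) M'"
    proof (rule wp_conseq)
      fix b2 M2 assume p: "round_post q r b' M' b2 M2"
      then have "root_invar q r M2" by (simp add: round_post_def)
      moreover from p consider "M2 rGD 0 = Suc (M' rGD 0)" "alive M2 = alive M'" "M2 rSP 0 = M' rSP 0" "b2 \<le> b' + ?g M'"
        | "M2 rGD 0 = 0" "b2 + pot q M2 + (if M' rGD 0 = 0 then 0 else global_cost q (2 * m)) \<le> b' + pot q M'"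
        by (auto simp: round_post_def)
      then have "b2 + pot q M2 \<le> b + pot q M + M2 rGD 0 * ?g M2"
      proof cases
        case 1
        then show ?thesis using I pot_cong[of M2 M'] by simp
      next
        case 2
        have "M' rGD 0 = 0 \<or> M' rGD 0 = 1" using gd2 by linarith
        then show ?thesis using 2 I g[of M'] by auto
      qed
      ultimately show "root_invar q r M2 \<and> b2 + pot q M2 \<le> b + pot q M + M2 rGD 0 * ?g M2" by blast
    qed
  next
    assume "expr_val w M' (C 2 [-] $rGD) = 0"
    then have "M' rGD 0 = 2" using gd by simp
    then show "rounds_post q r b M (b' + (1 + expr_cost (C 2 [-] $rGD))) M'"
      using I by (simp add: rounds_post_def)
  }
qed

lemma label_spec:
  assumes "M rR 0 < n" "M rAN 0 \<le> 1 + 2 * m"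
  shows "wp w label (\<lambda>b' M'. (\<forall>v. M' LAB v = (if v \<in> M QA ` {..<M rAN 0} then Suc (M rR 0) else M LAB v)) \<and>
    b' \<le> b + 10 + 30 * M rAN 0) b M"
proof -
  define k where "k = M rAN 0"
  define I where "I = (\<lambda>b' M'. M' rI 0 \<le> k \<and>
    (\<forall>v. M' LAB v = (if v \<in> M QA ` {..<M' rI 0} then Suc (M rR 0) else M LAB v)) \<and> b' \<le> b + 4 + 30 * M' rI 0)"
  have "wp w (While ($rAN [-] $rI) label_step) (\<lambda>b' M'. (\<forall>v. M' LAB v = (if v \<in> M QA ` {..<M rAN 0} then Suc (M rR 0) else M LAB v)) \<and>
    b' \<le> b + 10 + 30 * M rAN 0) b1 (M(rI := (M rI)(0 := 0)))" if "b1 \<le> b + 4" for b1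
  proof (rule wp_While[where I = I and N = "b + 4 + 30 * k"])
    show "I b1 (M(rI := (M rI)(0 := 0)))" using that by (simp add: I_def)
    show "b' \<le> b + 4 + 30 * k" if "I b' M'" for b' M' using that by (simp add: I_def)
    fix b' M' assume I: "I b' M'" and "unchanged label_step (M(rI := (M rI)(0 := 0))) M'"
    note M's = unchangedD[OF this(2), unfolded writes_label_step, simplified]
    define i where "i = M' rI 0"
    {
      assume "expr_val w M' ($rAN [-] $rI) \<noteq> 0"
      then have ik: "i < k" by (simp add: M's k_def i_def)
      have "Suc i mod 2 ^ w = Suc i" "Suc (M rR 0) mod 2 ^ w = Suc (M rR 0)"
        using ik assms lim_bounds by (intro mod_word; simp add: k_def)+
      moreover have "{..<Suc i} = insert i {..<i}" by auto
      ultimately show "wp w label_step I (b' + (1 + expr_cost ($rAN [-] $rI))) M'"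
        using I ik by (simp add: label_step_def wp_simps I_def M's i_def[symmetric])
    next
      assume "expr_val w M' ($rAN [-] $rI) = 0"
      then have "i = k" using I by (simp add: M's k_def i_def I_def)
      then show "(\<forall>v. M' LAB v = (if v \<in> M QA ` {..<M rAN 0} then Suc (M rR 0) else M LAB v)) \<and>
        b' + (1 + expr_cost ($rAN [-] $rI)) \<le> b + 10 + 30 * M rAN 0"
        using I by (simp add: I_def i_def k_def)
    }
  qed
  then show ?thesis by (simp add: label_def wp_simps)
qed

definition unlabelled :: "memory \<Rightarrow> nat set" where
  "unlabelled M = {v. v < n \<and> M LAB v = 0}"

definition class_of :: "memory \<Rightarrow> nat \<Rightarrow> nat set" where
  "class_of M u = {v \<in> {..<n}. M LAB v = M LAB u}"

text \<open>The bound of labels by \<open>rR\<close> makes the next label \<open>rR + 1\<close> new,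
  so that a finished component never merges with an older class.\<close>

definition main_invar :: "nat \<Rightarrow> memory \<Rightarrow> bool" where
  "main_invar q M \<longleftrightarrow> invar q M \<and> M rR 0 \<le> n \<and> (\<forall>v<M rR 0. M LAB v \<noteq> 0) \<and> (\<forall>v<n. M LAB v \<le> M rR 0) \<and>
    (\<forall>u<n. M LAB u \<noteq> 0 \<longrightarrow> two_edge_sc_set (graph_of n es) (class_of M u) \<and>
      (\<forall>T. two_edge_sc_set (graph_of n es) T \<longrightarrow> T \<inter> class_of M u \<noteq> {} \<longrightarrow> T \<subseteq> class_of M u))"

text \<open>Finished components are disjoint, so their final failed searches, two per component and
  linear in its weight, are paid from the unlabelled weight. The term in \<open>n\<close> pays for
  the roots themselves.\<close>

definition total :: "nat \<Rightarrow> memory \<Rightarrow> nat" where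
  "total q M = pot q M + 50000 * (n - M rR 0) + 50000 * (2 * q + 1) * vol (unlabelled M)"

lemma main_invar_label:
  assumes M: "main_invar q M" "M rR 0 = r" "r < n" "M LAB r = 0"
    and M1: "root_invar q r M1" "M1 rGD 0 = 2" "M1 LAB = M LAB"
    and M2: "\<And>v. M2 LAB v = (if v \<in> weak_comp (alive M1) r then Suc r else M LAB v)"
      "\<And>s. s \<notin> {LAB, rI} \<Longrightarrow> M2 s = M1 s"
    and M3: "M3 = M2(rR := (M2 rR)(0 := Suc r))"
  shows "main_invar q M3" "vol (unlabelled M3) + vol (weak_comp (alive M1) r) = vol (unlabelled M)"
    "pot q M3 = pot q M1"
proof -
  define E where "E = alive M1"
  define X where "X = weak_comp E r"
  have iM: "invar q M1" and f: "fails 0 E r" "fails 1 E r" using M1 by (simp_all add: root_invar_def E_def)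
  have E: "E \<subseteq> set es" by (simp add: E_def alive_subset)
  have Xn: "X \<subseteq> {..<n}" unfolding X_def by (rule weak_comp_bound[OF E M(3)])
  have lab: "M3 LAB v = (if v \<in> X then Suc r else M LAB v)" for v by (simp add: M3 M2(1) X_def E_def)
  have M3s: "M3 s = M1 s" if "s \<notin> {LAB, rI, rR}" for s using that by (simp add: M3 M2(2))
  have kept: "set es \<inter> T \<times> T \<subseteq> E" if "two_edge_sc_set (graph_of n es) T" for T
    using iM that by (simp add: invar_def E_def)
  have closed: "M LAB a = 0 \<longleftrightarrow> M LAB b = 0" if "(a, b) \<in> E" for a b
    using iM that by (simp add: invar_def E_def M1(3))
  have X0: "X \<subseteq> {v. M LAB v = 0}"
  proof -
    \<comment> \<open>Being unlabelled spreads along the remaining edges, hence from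
      \<open>r\<close> to its whole component.\<close>
    have "E \<inter> crossing {v. M LAB v = 0} = {}" using closed unfolding crossing_def by blast
    then show ?thesis unfolding X_def using M(4) by (intro weak_comp_least) simp_all
  qed
  have cloX: "a \<in> X \<longleftrightarrow> b \<in> X" if "(a, b) \<in> E" for a b
    using weak_comp_closed[of _ E r] that unfolding X_def by blast
  have rX: "r \<in> X" by (simp add: X_def)
  have al3: "alive M3 = E" unfolding E_def by (rule alive_cong) (simp add: M3s)
  have st3: "static M3 = static M1" by (rule static_cong) (simp_all add: M3s)
  have cr3: "credit M3 = credit M1" "stack M3 = stack M1"
    by (simp_all add: credit_def stack_def M3s al3 E_def)
  have "invar q M3"
    using iM closed cloX unfolding invar_def al3 E_def[symmetric] st3 cr3
    by (auto simp: M3s lab)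
  moreover have R3: "M3 rR 0 = Suc r" by (simp add: M3)
  moreover have "M3 LAB v \<noteq> 0" if "v < Suc r" for v
    using M(1,2) that rX by (cases "v = r") (auto simp: lab main_invar_def)
  moreover have le: "M LAB v \<le> r" if "v < n" for v using M(1,2) that by (simp add: main_invar_def)
  then have "M3 LAB v \<le> Suc r" if "v < n" for v using that by (auto simp: lab le_SucI)
  moreover have "two_edge_sc_set (graph_of n es) (class_of M3 u) \<and>
      (\<forall>T. two_edge_sc_set (graph_of n es) T \<longrightarrow> T \<inter> class_of M3 u \<noteq> {} \<longrightarrow> T \<subseteq> class_of M3 u)"
    if u: "u < n" "M3 LAB u \<noteq> 0" for u
  proof (cases "u \<in> X")
    case True
    have "class_of M3 u = X"
      using True Xn le by (fastforce simp: class_of_def lab split: if_splits)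
    then show ?thesis using verified[OF E M(3) f kept] by (simp add: X_def)
  next
    case False
    then have "M LAB u \<noteq> 0" using u(2) by (simp add: lab)
    moreover have "class_of M3 u = class_of M u"
      using False X0 le u(1) \<open>M LAB u \<noteq> 0\<close> by (fastforce simp: class_of_def lab split: if_splits)
    ultimately show ?thesis using M(1) u(1) by (simp add: main_invar_def)
  qed
  ultimately show "main_invar q M3" using M(3) unfolding main_invar_def by auto
  have "unlabelled M3 = unlabelled M - X" using X0 by (auto simp: unlabelled_def lab)
  moreover have "X \<subseteq> unlabelled M" using X0 Xn by (auto simp: unlabelled_def)
  ultimately show "vol (unlabelled M3) + vol (weak_comp (alive M1) r) = vol (unlabelled M)"
    using vol_diff[of X "unlabelled M"] by (auto simp: unlabelled_def X_def E_def)
  show "pot q M3 = pot q M1" by (rule pot_cong) (simp_all add: al3 E_def M3s)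
qed

lemma main_step_spec:
  assumes q: "m \<le> q ^ 4" "q ^ 4 \<le> 16 * m + 1" and M: "main_invar q M" "M rR 0 < n"
  shows "wp w main_step (\<lambda>b' M'. main_invar q M' \<and> M' rR 0 = Suc (M rR 0) \<and> b' + 1000 + total q M' \<le> b + total q M) b M"
proof -
  define r where "r = M rR 0"
  have iM: "invar q M" using M(1) by (simp add: main_invar_def)
  have rn: "r < n" using M(2) by (simp add: r_def)
  have md: "Suc r mod 2 ^ w = Suc r" using rn lim_bounds by (intro mod_word) linarith
  let ?Q = "\<lambda>b' M'. main_invar q M' \<and> M' rR 0 = Suc r \<and> b' + 1000 + total q M' \<le> b + total q M"
  have n1: "50000 * (n - r) = 50000 * (n - Suc r) + 50000" using rn by simp
  show ?thesis
  proof (cases "M LAB r = 0")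
    case False
    define M3 where "M3 = M(rR := (M rR)(0 := Suc r))"
    have "invar q M3 = invar q M" by (rule invar_cong) (simp add: M3_def)
    moreover have "M LAB v \<noteq> 0" if "v < Suc r" for v
      using M(1) False that by (cases "v = r") (auto simp: main_invar_def r_def)
    moreover have "M LAB v \<le> Suc r" if "v < n" for v using M(1) that by (auto simp: main_invar_def r_def intro: le_SucI)
    ultimately have "main_invar q M3" using M(1) rn unfolding main_invar_def by (simp add: M3_def class_of_def)
    moreover have "pot q M3 = pot q M" by (rule pot_cong) (simp_all add: M3_def alive_def)
    then have "total q M3 + 50000 = total q M"
      using n1 by (simp add: total_def M3_def unlabelled_def flip: r_def)
    ultimately show ?thesis
      using False unfolding M3_def by (simp add: main_step_def wp_simps md flip: r_def)
  next
    case True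
    define M0 where "M0 = M(rGD := (M rGD)(0 := 0))"
    have "invar q M0 = invar q M" by (rule invar_cong) (simp add: M0_def)
    then have g0: "root_invar q r M0" using iM by (simp add: root_invar_def) (simp add: M0_def r_def)
    have p0: "pot q M0 = pot q M" by (rule pot_cong) (simp_all add: M0_def alive_def)
    have "wp w (While (C 2 [-] $rGD) search_round) (wp w label (wp w (rR \<leftarrow> $rR [+] C 1) ?Q)) b0 M0"
      if b0: "b0 \<le> b + 20" for b0
    proof (rule wp_conseq[OF rounds_spec[OF q rn g0]])
      show "M0 rGD 0 = 0" by (simp add: M0_def)
      fix b1 M1 assume 1: "rounds_post q r b0 M0 b1 M1" and "unchanged (While (C 2 [-] $rGD) search_round) M0 M1"
      note M1s = unchangedD[OF this(2), unfolded writes.simps writes_search_round writes_search writes_test, simplified]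
      define x where "x = vol (weak_comp (alive M1) r)"
      have g1: "root_invar q r M1" "M1 rGD 0 = 2" "b1 + pot q M1 \<le> b0 + 5 + pot q M + 2 * global_cost q x"
        using 1 by (simp_all add: rounds_post_def p0 x_def)
      have QA: "M1 QA ` {..<M1 rAN 0} = weak_comp (alive M1) r" "M1 rAN 0 \<le> 1 + x" "M1 rR 0 = r"
        using g1 by (simp_all add: root_invar_def x_def)
      have xm: "x \<le> 2 * m" unfolding x_def by (rule vol_comp_le[OF rn])
      have L1: "M1 LAB = M LAB" by (simp add: M1s M0_def)
      show "wp w label (wp w (rR \<leftarrow> $rR [+] C 1) ?Q) b1 M1"
      proof (rule wp_conseq[OF label_spec])
        show "M1 rR 0 < n" "M1 rAN 0 \<le> 1 + 2 * m" using QA rn xm by simp_all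
        fix b2 M2 assume 2: "(\<forall>v. M2 LAB v = (if v \<in> M1 QA ` {..<M1 rAN 0} then Suc (M1 rR 0) else M1 LAB v)) \<and>
          b2 \<le> b1 + 10 + 30 * M1 rAN 0" and "unchanged label M1 M2"
        note M2s = unchangedD[OF this(2), unfolded writes_label]
        define M3 where "M3 = M2(rR := (M2 rR)(0 := Suc r))"
        have lab2: "M2 LAB v = (if v \<in> weak_comp (alive M1) r then Suc r else M LAB v)" for v
          using 2 by (simp add: QA L1)
        have mv: "main_invar q M3" "vol (unlabelled M3) + vol (weak_comp (alive M1) r) = vol (unlabelled M)"
          "pot q M3 = pot q M1"
          by (rule main_invar_label[OF M(1) r_def[symmetric] rn True g1(1,2) L1 lab2 _ M3_def]; rule M2s; simp)+
        have "b2 + 10 + 1000 + total q M3 \<le> b + total q M"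
        proof -
          have "b2 \<le> b1 + 40 + 30 * x" using 2 QA(2) by simp
          moreover have "2 * global_cost q x = 40200 + 40200 * ((2 * q + 1) * x)" by (simp add: global_cost_def)
          moreover have "x \<le> (2 * q + 1) * x" by simp
          moreover have "(2 * q + 1) * vol (unlabelled M) = (2 * q + 1) * vol (unlabelled M3) + (2 * q + 1) * x"
            using mv(2) by (metis x_def distrib_left)
          moreover have "total q M = pot q M + (50000 * (n - Suc r) + 50000) + 50000 * ((2 * q + 1) * vol (unlabelled M))"
            unfolding total_def r_def[symmetric] n1 by (simp only: mult.assoc)
          moreover have "total q M3 = pot q M1 + 50000 * (n - Suc r) + 50000 * ((2 * q + 1) * vol (unlabelled M3))"
          proof -
            have "M3 rR 0 = Suc r" by (simp add: M3_def)
            then show ?thesis using mv(3) unfolding total_def by (simp only: mult.assoc)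
          qed
          ultimately show ?thesis using g1(3) b0 by linarith
        qed
        then show "wp w (rR \<leftarrow> $rR [+] C 1) ?Q b2 M2"
          using QA(3) mv(1) unfolding M3_def by (simp add: wp_Assign M2s md)
      qed
    qed
    from this[unfolded M0_def] show ?thesis
      using True by (simp add: main_step_def wp_simps flip: r_def)
  qed
qed

definition correct :: "memory \<Rightarrow> bool" where
  "correct M \<longleftrightarrow> labelled_subgraphs (graph_of n es) (output_labels M) = two_edge_sccs (graph_of n es)"

lemma main_spec:
  "\<exists>q. m \<le> q ^ 4 \<and> q ^ 4 \<le> 16 * m + 1 \<and> wp w main (\<lambda>b' M'. correct M' \<and>
     b' \<le> 1000 * (m + 1) + 20 + local_cost q * (7 * m) +
       2 * global_cost q (2 * m) * (4 * (m * m) div (q ^ 3 + 1)\<^sup>2) + 50000 * n + 50000 * (2 * q + 1) * (2 * m)) 0 start"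
proof -
  have s0: "start 0 0 = n" "start LAB i = 0" "start ONP i = 0" "start MB i = 0" "start DEAD i = 0" for i
    by (simp_all add: start_def input_memory_def)
  define T where "T q = 1000 * (m + 1) + 20 + local_cost q * (7 * m) +
       2 * global_cost q (2 * m) * (4 * (m * m) div (q ^ 3 + 1)\<^sup>2) + 50000 * n + 50000 * (2 * q + 1) * (2 * m)" for q
  have loop: "wp w (rR \<leftarrow> C 0 ;; While (0\<lbrakk>C 0\<rbrakk> [-] $rR) main_step) (\<lambda>b' M'. correct M' \<and> b' \<le> T (M1 rQ 0)) b1 M1"
    if 1: "static M1" "M1 rDELTA 0 = (M1 rQ 0) ^ 3" "m \<le> (M1 rQ 0) ^ 4" "(M1 rQ 0) ^ 4 \<le> 16 * m + 1"
      "M1 rSP 0 = 4 * m" "stack M1 \<subseteq> {..<2 * n}"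
      "\<forall>e<m. \<forall>d<2. 2 * fst (es ! e) + d \<in> stack M1 \<and> 2 * snd (es ! e) + d \<in> stack M1" "b1 \<le> 1000 * (m + 1)"
      and un: "unchanged init start M1" for b1 M1
  proof -
    define q where "q = M1 rQ 0"
    have M1s: "M1 s = start s" if "s \<in> {0, LAB, ONP, MB, DEAD}" for s
      using un that by (auto simp: unchanged_def init_def root_loop_def root_step_def writes_build_step)
    define M2 where "M2 = M1(rR := (M1 rR)(0 := 0))"
    have al2: "alive M2 = set es"
      by (auto simp: alive_def M2_def M1s s0 m_def set_conv_nth)
    \<comment> \<open>Four stack entries and two units for the edge itself: this is the origin of
      the bound \<open>6 * m\<close> on the credit.\<close>
    have cr2: "credit M2 = 6 * m"
      using distinct_card[OF distinct_es] by (simp add: credit_def al2) (simp add: M2_def 1(5) m_def)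
    have st2: "stack M2 = stack M1" by (simp add: stack_def M2_def)
    have cov: "covers (stack M2) (q ^ 3) (set es)"
      unfolding covers_def
    proof (intro allI impI)
      fix d S x assume d: "d < (2::nat)" and "x < n" and s: "small (q ^ 3) d (set es) S x"
      \<comment> \<open>A proper part of a weak component is crossed by some edge, whose end in
        \<open>S\<close> was pushed for both directions.\<close>
      then have "set es \<inter> crossing S \<noteq> {}"
        using weak_comp_least[of x S "set es"] by (auto simp: small_def)
      then obtain p where "p \<in> set es" "p \<in> crossing S" by blast
      then obtain e where e: "e < m" "es ! e \<in> crossing S" unfolding m_def by (metis in_set_conv_nth)
      then have "fst (es ! e) \<in> S \<or> snd (es ! e) \<in> S" by (cases "es ! e") (auto simp: crossing_def)
      then show "\<exists>v\<in>S. 2 * v + d \<in> stack M2" using 1(7) e(1) d st2 by auto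
    qed
    have "static M2" using 1(1) static_cong[of M2 M1] by (simp add: M2_def)
    then have "invar q M2"
      using cov cr2 st2 1(2,6) unfolding invar_def al2 by (auto simp: M2_def M1s s0 q_def)
    then have m2: "main_invar q M2" by (simp add: main_invar_def M2_def M1s s0)
    have t2: "total q M2 \<le> local_cost q * (7 * m) + 2 * global_cost q (2 * m) * (4 * (m * m) div (q ^ 3 + 1)\<^sup>2) +
      50000 * n + 50000 * (2 * q + 1) * (2 * m)"
    proof -
      have "pot q M2 \<le> local_cost q * (7 * m) + 2 * global_cost q (2 * m) * (4 * (m * m) div (q ^ 3 + 1)\<^sup>2)"
        unfolding pot_def al2
      proof (intro add_mono mult_le_mono2 div_le_mono psi_le)
        show "M2 rSP 0 + 3 * card (set es) \<le> 7 * m"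
          using distinct_card[OF distinct_es] 1(5) by (simp add: M2_def m_def)
      qed simp
      moreover have "vol (unlabelled M2) \<le> 2 * m" by (rule vol_le) (auto simp: unlabelled_def)
      then have "50000 * (2 * q + 1) * vol (unlabelled M2) \<le> 50000 * (2 * q + 1) * (2 * m)" by (rule mult_le_mono2)
      moreover have "50000 * (n - M2 rR 0) \<le> 50000 * n" by simp
      ultimately show ?thesis unfolding total_def by linarith
    qed
    have "wp w (While (0\<lbrakk>C 0\<rbrakk> [-] $rR) main_step) (\<lambda>b' M'. correct M' \<and> b' \<le> T q) b2 M2" if b2: "b2 \<le> b1 + 10" for b2
    proof (rule wp_While[where I = "\<lambda>b' M'. main_invar q M' \<and> b' + total q M' \<le> b2 + total q M2" and N = "b2 + total q M2"])
      show "main_invar q M2 \<and> b2 + total q M2 \<le> b2 + total q M2" using m2 by simp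
      show "b' \<le> b2 + total q M2" if "main_invar q M' \<and> b' + total q M' \<le> b2 + total q M2" for b' M' using that by linarith
      fix b' M' assume I: "main_invar q M' \<and> b' + total q M' \<le> b2 + total q M2" and "unchanged main_step M2 M'"
      then have n0: "M' 0 0 = n"
        by (simp add: main_invar_def invar_def static_def)
      {
        assume "expr_val w M' (0\<lbrakk>C 0\<rbrakk> [-] $rR) \<noteq> 0"
        then have r: "M' rR 0 < n" using n0 by simp
        show "wp w main_step (\<lambda>b' M'. main_invar q M' \<and> b' + total q M' \<le> b2 + total q M2)
          (b' + (1 + expr_cost (0\<lbrakk>C 0\<rbrakk> [-] $rR))) M'"
          by (rule wp_conseq[OF main_step_spec[where M = M' and q = q, OF 1(3,4)[folded q_def] _ r]]) (use I in auto)
      next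
        assume "expr_val w M' (0\<lbrakk>C 0\<rbrakk> [-] $rR) = 0"
        then have r: "M' rR 0 = n" using n0 I by (simp add: main_invar_def)
        have "correct M'"
          unfolding correct_def output_labels_def
          by (rule labelled_subgraphs_two_edge_sccs) (use I r in \<open>auto simp: main_invar_def class_of_def\<close>)
        moreover have "b' + (1 + expr_cost (0\<lbrakk>C 0\<rbrakk> [-] $rR)) \<le> T q"
          using I t2 b2 1(8) unfolding T_def by (simp add: main_invar_def)
        ultimately show "correct M' \<and> b' + (1 + expr_cost (0\<lbrakk>C 0\<rbrakk> [-] $rR)) \<le> T q" by blast
      }
    qed
    from this[unfolded M2_def] show ?thesis by (simp add: wp_simps q_def)
  qed
  from init_spec[unfolded wp_def] obtain t M1 where e: "exec w init start t M1" and
    1: "static M1" "M1 rDELTA 0 = (M1 rQ 0) ^ 3" "m \<le> (M1 rQ 0) ^ 4" "(M1 rQ 0) ^ 4 \<le> 16 * m + 1"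
      "M1 rSP 0 = 4 * m" "stack M1 \<subseteq> {..<2 * n}"
      "\<forall>e<m. \<forall>d<2. 2 * fst (es ! e) + d \<in> stack M1 \<and> 2 * snd (es ! e) + d \<in> stack M1" "0 + t \<le> 1000 * (m + 1)"
    by blast
  have "wp w main (\<lambda>b' M'. correct M' \<and> b' \<le> T (M1 rQ 0)) 0 start"
    unfolding main_def wp_Seq[of _ init] wp_def[of _ init]
    using e loop[OF 1 exec_unchanged[OF e]] by blast
  then show ?thesis using 1(3,4) unfolding T_def by blast
qed

end

section \<open>From m q^3 to m^2 / log n\<close>

section \<open>Running time\<close>

definition step_bound :: "nat \<Rightarrow> nat \<Rightarrow> nat \<Rightarrow> nat" where
  "step_bound n m q = 3000000 * (n + m * q ^ 3)"

context input
begin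

lemma total_le_step_bound:
  assumes q: "m \<le> q ^ 4" and m: "0 < m" and
    T: "T \<le> 1000 * (m + 1) + 20 + local_cost q * (7 * m) +
       2 * global_cost q (2 * m) * (4 * (m * m) div (q ^ 3 + 1)\<^sup>2) + 50000 * n + 50000 * (2 * q + 1) * (2 * m)"
  shows "T \<le> step_bound n m q"
proof -
  have q0: "0 < q" using q m by (cases q) auto
  define y where "y = m * q ^ 3"
  have p1: "1 \<le> q ^ 3" "q \<le> q ^ 3" "q\<^sup>2 \<le> q ^ 3"
    using q0 power_increasing[of 0 3 q] power_increasing[of 1 3 q] power_increasing[of 2 3 q] by simp_all
  have my: "m \<le> y" "m * q \<le> y" "m * q\<^sup>2 \<le> y" "q\<^sup>2 \<le> y"
    using mult_le_mono2[OF p1(1), of m] mult_le_mono2[OF p1(2), of m] mult_le_mono2[OF p1(3), of m]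
      le_trans[OF p1(3)] m by (simp_all add: y_def)
  have "4 * (m * m) div (q ^ 3 + 1)\<^sup>2 \<le> 4 * q\<^sup>2"
  proof -
    \<comment> \<open>From \<open>m \<le> q ^ 4\<close> the square of \<open>m\<close> is at most
      \<open>q ^ 8\<close>, and division by the square of \<open>q ^ 3\<close> leaves only order
      \<open>q^2\<close> successful global searches.\<close>
    have "m * m \<le> q ^ 4 * q ^ 4" using q by (intro mult_le_mono)
    also have "\<dots> = q\<^sup>2 * (q ^ 3)\<^sup>2" by (simp flip: power_add power_mult)
    also have "\<dots> \<le> q\<^sup>2 * (q ^ 3 + 1)\<^sup>2" by (intro mult_le_mono2 power_mono) auto
    finally have "4 * (m * m) \<le> (4 * q\<^sup>2) * (q ^ 3 + 1)\<^sup>2" by simp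
    from div_le_mono[OF this, of "(q ^ 3 + 1)\<^sup>2"] show ?thesis by simp
  qed
  then have "2 * global_cost q (2 * m) * (4 * (m * m) div (q ^ 3 + 1)\<^sup>2) \<le> 2 * global_cost q (2 * m) * (4 * q\<^sup>2)"
    by (rule mult_le_mono2)
  also have "\<dots> = 160800 * (q\<^sup>2 + 4 * y + 2 * (m * q\<^sup>2))"
    by (simp add: y_def global_cost_def algebra_simps power2_eq_square power3_eq_cube)
  also have "\<dots> \<le> 160800 * (7 * y)" using my(3,4) by (intro mult_le_mono2) linarith
  finally have 1: "2 * global_cost q (2 * m) * (4 * (m * m) div (q ^ 3 + 1)\<^sup>2) \<le> 160800 * (7 * y)" .
  have "local_cost q * (7 * m) = 140700 * m + 844200 * y" by (simp add: local_cost_def y_def algebra_simps)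
  moreover have "50000 * (2 * q + 1) * (2 * m) = 200000 * (m * q) + 100000 * m" by (simp add: algebra_simps)
  moreover have "T \<le> 3000000 * n + 3000000 * y"
    if "T \<le> 1000 * (m + 1) + 20 + A + B + 50000 * n + D" "A = 140700 * m + 844200 * y"
      "B \<le> 160800 * (7 * y)" "D = 200000 * z + 100000 * m" "z \<le> y" for A B D z
    using that my(1) m by simp
  ultimately have "T \<le> 3000000 * n + 3000000 * y" using T 1 my(2) by blast
  then show ?thesis by (simp add: step_bound_def y_def)
qed

lemma main_exec:
  "\<exists>q t M. m \<le> q ^ 4 \<and> q ^ 4 \<le> 16 * m + 1 \<and> exec w main (input_memory n es) t M \<and> correct M \<and>
    (0 < m \<longrightarrow> t \<le> step_bound n m q)"
proof -
  from main_spec obtain q t M where "m \<le> q ^ 4" "q ^ 4 \<le> 16 * m + 1" "exec w main start t M" "correct M"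
    "t \<le> 1000 * (m + 1) + 20 + local_cost q * (7 * m) +
       2 * global_cost q (2 * m) * (4 * (m * m) div (q ^ 3 + 1)\<^sup>2) + 50000 * n + 50000 * (2 * q + 1) * (2 * m)"
    unfolding wp_def by auto
  then show ?thesis using total_le_step_bound unfolding start_def by blast
qed

end

text \<open>The hypothesis bounds the logarithm of \<open>n\<close> by that of \<open>K\<close> plus
  twice that of \<open>m\<close>, hence by \<open>(log 2 K + 8) * q\<close>. One factor
  \<open>q\<close> is thus traded for the logarithm, and \<open>q ^ 4\<close> is at most
  \<open>17 * m\<close>. The summand \<open>n\<close> is covered by the hypothesis directly.\<close>

lemma step_bound_real:
  fixes n m q :: nat and K :: real
  assumes n: "2 \<le> n" and m: "0 < m" and q: "m \<le> q ^ 4" "q ^ 4 \<le> 16 * m + 1"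
    and K: "1 \<le> K" "real n \<le> K * ((real m)\<^sup>2 / log 2 (real n))"
  shows "real (step_bound n m q) \<le> 3000000 * (K + 17 * (log 2 K + 8)) * ((real m)\<^sup>2 / log 2 (real n))"
proof -
  define l where "l = log 2 (real n)"
  have l1: "1 \<le> l" using n unfolding l_def by (simp add: le_log_iff)
  have q0: "0 < q" using q(1) m by (cases q) auto
  have K0: "0 \<le> log 2 K" using K(1) by simp
  have "real n \<le> K * (real m)\<^sup>2"
  proof -
    have "(real m)\<^sup>2 / l \<le> (real m)\<^sup>2" using l1 by (simp add: divide_le_eq mult_le_cancel_left1)
    then have "K * ((real m)\<^sup>2 / l) \<le> K * (real m)\<^sup>2" using K(1) by (intro mult_left_mono) auto
    then show ?thesis using K(2) by (simp add: l_def)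
  qed
  then have "l \<le> log 2 (K * (real m)\<^sup>2)" using n unfolding l_def by (intro log_mono) auto
  also have "\<dots> = log 2 K + 2 * log 2 (real m)"
    using K(1) m by (simp add: log_mult log_nat_power)
  also have "log 2 (real m) \<le> log 2 (real q ^ 4)"
    using q(1) m by (intro log_mono) (auto simp flip: of_nat_power)
  also have "log 2 (real q ^ 4) = 4 * log 2 (real q)" using q0 by (simp add: log_nat_power)
  also have "log 2 (real q) \<le> real q"
  proof -
    have "real q \<le> 2 ^ q" using less_exp[of q] by (metis less_imp_le of_nat_le_iff of_nat_numeral of_nat_power)
    then show ?thesis using q0 by (simp add: log_le_iff powr_realpow)
  qed
  finally have "l \<le> log 2 K + 8 * real q" by simp
  also have "\<dots> \<le> (log 2 K + 8) * real q"
  proof -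
    have "log 2 K * 1 \<le> log 2 K * real q" using K0 q0 by (intro mult_left_mono) auto
    then show ?thesis by (simp add: algebra_simps)
  qed
  finally have "real q ^ 3 * l \<le> real q ^ 3 * ((log 2 K + 8) * real q)" by (intro mult_left_mono) auto
  also have "\<dots> = (log 2 K + 8) * real (q ^ 4)" by (simp add: power_numeral_reduce)
  also have "\<dots> \<le> (log 2 K + 8) * (17 * real m)"
  proof (rule mult_left_mono)
    have "q ^ 4 \<le> 17 * m" using q(2) m by simp
    then show "real (q ^ 4) \<le> 17 * real m" by (metis of_nat_le_iff of_nat_mult of_nat_numeral)
  qed (use K0 in simp)
  finally have "real q ^ 3 * l * real m \<le> (log 2 K + 8) * (17 * real m) * real m" by (intro mult_right_mono) auto
  then have "real m * real q ^ 3 * l \<le> 17 * (log 2 K + 8) * (real m)\<^sup>2"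
    by (simp add: power2_eq_square algebra_simps)
  then have "real m * real q ^ 3 \<le> 17 * (log 2 K + 8) * ((real m)\<^sup>2 / l)"
    using l1 by (simp add: pos_le_divide_eq)
  then have "real n + real m * real q ^ 3 \<le> (K + 17 * (log 2 K + 8)) * ((real m)\<^sup>2 / l)"
    using K(2) unfolding l_def[symmetric] by (simp only: distrib_right)
  then have "3000000 * (real n + real m * real q ^ 3) \<le> 3000000 * ((K + 17 * (log 2 K + 8)) * ((real m)\<^sup>2 / l))"
    by (intro mult_left_mono) auto
  moreover have "real (step_bound n m q) = 3000000 * (real n + real m * real q ^ 3)"
    by (simp add: step_bound_def)
  ultimately show ?thesis unfolding l_def[symmetric] by (simp only: mult.assoc)
qed

theorem mainTheorem3:
  shows "\<exists>P c. computes_two_edge_sccs P c \<and> 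
     runs_in_time P c (\<lambda>n m. (real m)\<^sup>2 / log 2 (real n))"
proof (intro exI[of _ main] exI[of _ 11] conjI)
  show "computes_two_edge_sccs main 11"
    unfolding computes_two_edge_sccs_def
  proof (intro allI impI)
    fix n es w assume a: "digraph (graph_of n es) \<and> distinct es \<and> (n + 2) ^ 11 \<le> 2 ^ w"
    interpret input w n es using a by (intro input.intro) simp_all
    show "\<exists>t M. exec w main (input_memory n es) t M \<and>
      labelled_subgraphs (graph_of n es) (output_labels M) = two_edge_sccs (graph_of n es)"
      using main_exec unfolding correct_def by blast
  qed
  show "runs_in_time main 11 (\<lambda>n m. (real m)\<^sup>2 / log 2 (real n))"
    unfolding runs_in_time_def
  proof
    fix K :: real
    \<comment> \<open>Raising \<open>K\<close> to at least 1 weakens the range condition and makes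
      its logarithm nonnegative.\<close>
    let ?K = "max K 1"
    show "\<exists>C. \<forall>n es w t M. digraph (graph_of n es) \<and> distinct es \<and> (n + 2) ^ 11 \<le> 2 ^ w \<and> 2 \<le> n \<and>
      real n \<le> K * ((real (length es))\<^sup>2 / log 2 (real n)) \<and> exec w main (input_memory n es) t M \<longrightarrow>
      real t \<le> C * ((real (length es))\<^sup>2 / log 2 (real n))"
    proof (intro exI[of _ "3000000 * (?K + 17 * (log 2 ?K + 8))"] allI impI)
      fix n es w t M
      assume a: "digraph (graph_of n es) \<and> distinct es \<and> (n + 2) ^ 11 \<le> 2 ^ w \<and> 2 \<le> n \<and>
        real n \<le> K * ((real (length es))\<^sup>2 / log 2 (real n)) \<and> exec w main (input_memory n es) t M"
      interpret input w n es using a by (intro input.intro) simp_all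
      have f: "0 \<le> (real (length es))\<^sup>2 / log 2 (real n)" using a by simp
      \<comment> \<open>Without edges the claimed bound is 0, which contradicts
        \<open>2 \<le> n\<close> in the range condition.\<close>
      have m0: "0 < length es" using a by (cases "length es") auto
      have nK: "real n \<le> ?K * ((real (length es))\<^sup>2 / log 2 (real n))"
        using a mult_right_mono[OF max.cobounded1[of K 1] f] by linarith
      obtain q t' M' where q: "m \<le> q ^ 4" "q ^ 4 \<le> 16 * m + 1" "exec w main (input_memory n es) t' M'"
        "0 < m \<longrightarrow> t' \<le> step_bound n m q"
        using main_exec by (elim exE conjE) (rule that)
      \<comment> \<open>The running time is claimed for any halting run; determinism identifies it
        with the one constructed.\<close>
      have "t = t'" using exec_deterministic[OF q(3)] a by blast
      then have "real t \<le> real (step_bound n m q)" using q(4) m0 by (simp add: m_def)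
      also have "\<dots> \<le> 3000000 * (?K + 17 * (log 2 ?K + 8)) * ((real (length es))\<^sup>2 / log 2 (real n))"
        using step_bound_real[of n m q ?K] a m0 q(1,2) nK by (simp add: m_def)
      finally show "real t \<le> 3000000 * (?K + 17 * (log 2 ?K + 8)) * ((real (length es))\<^sup>2 / log 2 (real n))" .
    qed
  qed
qed

end
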